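(* Let $x>0$. Then there exists $\zeta_x\in\mathbb{R}$ such that $$\frac{j_{xk,k}}{k}-x\,\sigma^{-1}(x)=-\frac{\pi}{4k}\,\frac{\sigma^{-1}(x)}{\sqrt{(\sigma^{-1}(x))^2-1}}+\frac{\zeta_x}{k^2}+o\!\left(\frac1{k^2}\right)$$ as $k\to\infty$ ($k\in\mathbb{N}$).
   Context: For real $\nu\ge 0$ and $k\in\mathbb{N}=\{1,2,\dots\}$, $j_{\nu,k}$ denotes the $k$-th positive zero of the Bessel function of the first kind $J_\nu$. The function $\sigma:(1,\infty)\to(0,\infty)$, $\sigma(\alpha)=\dfrac{\pi}{\sqrt{\alpha^2-1}-\arccos\frac1\alpha}$, is a smooth strictly decreasing bijection, and $\sigma^{-1}:(0,\infty)\to(1,\infty)$ denotes its inverse function. *)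

theory Defs
  imports "HOL-Analysis.Analysis" "HOL-Library.Landau_Symbols"
begin

text \<open>The power series definition of the Bessel function of the first kind, meant for
  arguments \<open>x > 0\<close> only: since \<open>0 powr 0 = 0\<close> in HOL, the value at \<open>x = 0\<close> is wrong for order 0.\<close>

definition bessel_J :: "real \<Rightarrow> real \<Rightarrow> real" where
  "bessel_J \<nu> x =
     (\<Sum>m. (-1) ^ m / (fact m * Gamma (real m + \<nu> + 1)) * (x / 2) powr (2 * real m + \<nu>))"

text \<open>Positive zeros are counted from 1 and without multiplicity (they are all simple).
  For \<open>k \<ge> 1\<close> the cardinality condition forces finiteness of the set of zeros in \<open>(0, z]\<close>, and it
  determines \<open>z\<close> uniquely.\<close>

definition bessel_zero :: "real \<Rightarrow> nat \<Rightarrow> real" where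
  "bessel_zero \<nu> k =
     (THE z. 0 < z \<and> bessel_J \<nu> z = 0 \<and> card {y. 0 < y \<and> y \<le> z \<and> bessel_J \<nu> y = 0} = k)"

definition sigma :: "real \<Rightarrow> real" where
  "sigma \<alpha> = pi / (sqrt (\<alpha>\<^sup>2 - 1) - arccos (1 / \<alpha>))"

definition sigma_inv :: "real \<Rightarrow> real" where
  "sigma_inv = inv_into {1<..} sigma"

end

theory Submission
  imports
    Defs
    "HOL-Complex_Analysis.Cauchy_Integral_Theorem"
    "HOL-Real_Asymp.Real_Asymp"
begin

text \<open>
Let \<open>\<nu> = x k\<close>, \<open>\<alpha> = sigma_inv x\<close> and \<open>\<xi> z = sqrt (z\<^sup>2 - 1) - arccos (1 / z)\<close>, so that \<open>\<nu> * \<xi> \<alpha> = k pi\<close>. The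
zero number \<open>k\<close> of \<open>J_\<nu>\<close> turns out to be \<open>\<nu> z\<close>, where \<open>z\<close> is close to \<open>\<alpha>\<close> and
\<open>\<nu> * \<xi> z + pi/4 - E z / (2 \<nu>) + O(1/\<nu>\<^sup>2) = k pi\<close> for an explicit continuous function \<open>E\<close>
(\<open>bessel_zero_Debye\<close>). Inverting \<open>\<xi>\<close> near \<open>\<alpha>\<close> to second order (\<open>second_order_inversion\<close>) gives the
theorem; the coefficient of \<open>1/k\<close> is what it is because \<open>\<xi>' z = sqrt (z\<^sup>2 - 1) / z\<close>.

The equation for \<open>z\<close> comes from a Pruefer angle. For \<open>t > \<nu>\<close> the Liouville-Green change of variables brings the
Bessel equation into the form \<open>v'' + (1 + \<epsilon>) v = 0\<close> with an explicit positive \<open>\<epsilon>\<close>. The polar angle \<open>\<Theta>\<close> of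
\<open>(v', v)\<close> satisfies \<open>\<Theta>' = 1 + \<epsilon> (sin \<Theta>)\<^sup>2\<close>, so that it increases and \<open>J_\<nu>\<close> vanishes where \<open>\<Theta>\<close> is a
multiple of \<open>pi\<close> (\<open>bessel_J_Pruefer\<close>). The angle is integrated from infinity down to \<open>t = \<nu> z\<close>, hence the
turning point \<open>t = \<nu>\<close> is never approached. On this range \<open>\<epsilon>\<close> is of order \<open>1/\<nu>\<^sup>2\<close> and \<open>(sin \<Theta>)\<^sup>2\<close> may be
replaced by its mean \<open>1/2\<close> at a cost of order \<open>1/\<nu>\<^sup>2\<close> (\<open>bessel_phase_expansion\<close>).

Two constants at infinity have to be supplied, both for a fixed order. The first is the limit of \<open>\<Theta>\<close> minus its
Liouville-Green approximation, modulo \<open>2 pi\<close>. It is read off from the signs of \<open>J_\<nu>\<close> at large arguments, which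
Poisson's integral reveals when the contour is turned into the upper half-plane (\<open>bessel_J_eventual_sign\<close>). The
second is the integer that relates the number of zeros up to \<open>t\<close> to \<open>\<Theta> t / pi\<close>. For order \<open>1/2\<close> the Bessel function is
elementary and the integer is \<open>0\<close>. Rolle's theorem and Sturm's comparison theorem show that the number of
zeros in \<open>(0, t]\<close> is a decreasing function of the order and drops by at most one when the order is raised by one; this
forces the integer to be \<open>0\<close> for all orders \<open>\<ge> 1/2\<close> (\<open>zero_offset_zero\<close>).
\<close>

section \<open>Power series and recurrences\<close>

definition bessel_coeff :: "real \<Rightarrow> nat \<Rightarrow> real" where
  "bessel_coeff \<nu> m = (-1) ^ m / (fact m * Gamma (real m + \<nu> + 1))"

text \<open>
This is the entire factor of the Bessel function,
\<open>J_\<nu> t = (t/2) powr \<nu> * bessel_entire \<nu> (t\<^sup>2/4)\<close>; in terms of it, differentiation just raises the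
order, up to sign.
\<close>

definition bessel_entire :: "real \<Rightarrow> real \<Rightarrow> real" where
  "bessel_entire \<nu> y = (\<Sum>m. bessel_coeff \<nu> m * y ^ m)"

lemma Gamma_shift_pos:
  fixes \<nu> :: real
  assumes "\<nu> > -1"
  shows "Gamma (real m + \<nu> + 1) > 0"
    and "Gamma (real (Suc m) + \<nu> + 1) = (real m + \<nu> + 1) * Gamma (real m + \<nu> + 1)"
proof -
  show "Gamma (real m + \<nu> + 1) > 0"
    using assms by (intro Gamma_real_pos) auto
  have "real m + \<nu> + 1 \<notin> \<int>\<^sub>\<le>\<^sub>0"
    using assms by (auto elim!: nonpos_Ints_cases)
  from Gamma_plus1[OF this] show "Gamma (real (Suc m) + \<nu> + 1) = (real m + \<nu> + 1) * Gamma (real m + \<nu> + 1)"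
    by (simp add: algebra_simps)
qed

lemma bessel_coeff_Suc:
  assumes "\<nu> > -1"
  shows "bessel_coeff \<nu> (Suc m) = - bessel_coeff \<nu> m / ((real m + 1) * (real m + \<nu> + 1))"
  using Gamma_shift_pos[OF assms, of m] assms
  unfolding bessel_coeff_def Gamma_shift_pos(2)[OF assms]
  by (simp add: divide_simps)

lemma summable_bessel_coeff:
  assumes "\<nu> > -1"
  shows "summable (\<lambda>m. bessel_coeff \<nu> m * y ^ m)"
proof -
  have pos: "Gamma (real m + \<nu> + 1) > 0" for m
    using Gamma_shift_pos(1)[OF assms] .
  have ev: "eventually (\<lambda>m. \<bar>y\<bar> / ((real m + 1) * (real m + \<nu> + 1)) < 1/2) sequentially"
    by real_asymp
  then obtain N where N: "\<And>m. m \<ge> N \<Longrightarrow> \<bar>y\<bar> / ((real m + 1) * (real m + \<nu> + 1)) < 1/2"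
    by (auto simp: eventually_at_top_linorder)
  show ?thesis
  proof (rule summable_ratio_test)
    fix m assume "m \<ge> N"
    have "norm (bessel_coeff \<nu> (Suc m) * y ^ Suc m)
        = \<bar>y\<bar> / ((real m + 1) * (real m + \<nu> + 1)) * norm (bessel_coeff \<nu> m * y ^ m)"
      using assms by (simp add: bessel_coeff_Suc abs_mult power_abs)
    also have "\<dots> \<le> 1/2 * norm (bessel_coeff \<nu> m * y ^ m)"
      using N[OF \<open>m \<ge> N\<close>] by (intro mult_right_mono) auto
    finally show "norm (bessel_coeff \<nu> (Suc m) * y ^ Suc m) \<le> 1/2 * norm (bessel_coeff \<nu> m * y ^ m)" .
  qed simp
qed

lemma diffs_bessel_coeff:
  "diffs (bessel_coeff \<nu>) m = - bessel_coeff (\<nu> + 1) m"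
  by (simp add: diffs_def bessel_coeff_def add_ac divide_simps)

lemma DERIV_bessel_entire:
  assumes "\<nu> > -1"
  shows "(bessel_entire \<nu> has_real_derivative - bessel_entire (\<nu> + 1) y) (at y)"
proof -
  have "(bessel_entire \<nu> has_real_derivative (\<Sum>m. diffs (bessel_coeff \<nu>) m * y ^ m)) (at y)"
    unfolding bessel_entire_def [abs_def]
    by (rule termdiffs_strong_converges_everywhere) (rule summable_bessel_coeff[OF assms])
  moreover have "(\<Sum>m. diffs (bessel_coeff \<nu>) m * y ^ m) = - bessel_entire (\<nu> + 1) y"
    unfolding diffs_bessel_coeff bessel_entire_def
    using suminf_minus[OF summable_bessel_coeff[of "\<nu> + 1" y]] assms by simp
  ultimately show ?thesis by simp
qed

lemma bessel_entire_recurrence: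
  assumes "\<nu> > -1"
  shows "bessel_entire \<nu> y = (\<nu> + 1) * bessel_entire (\<nu> + 1) y - y * bessel_entire (\<nu> + 2) y"
proof -
  have s1: "(\<lambda>m. bessel_coeff (\<nu> + 1) m * y ^ m) sums bessel_entire (\<nu> + 1) y"
    unfolding bessel_entire_def using assms by (intro summable_sums summable_bessel_coeff) auto
  have "(\<lambda>m. bessel_coeff (\<nu> + 2) m * y ^ m) sums bessel_entire (\<nu> + 2) y"
    unfolding bessel_entire_def using assms by (intro summable_sums summable_bessel_coeff) auto
  then have "(\<lambda>m. y * (bessel_coeff (\<nu> + 2) m * y ^ m)) sums (y * bessel_entire (\<nu> + 2) y)"
    by (rule sums_mult)
  then have s2: "(\<lambda>m. case m of 0 \<Rightarrow> 0 | Suc m \<Rightarrow> y * (bessel_coeff (\<nu> + 2) m * y ^ m))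
      sums (y * bessel_entire (\<nu> + 2) y)"
    using sums_Suc_iff[of "\<lambda>m. case m of 0 \<Rightarrow> 0 | Suc m \<Rightarrow> y * (bessel_coeff (\<nu> + 2) m * y ^ m)"
        "y * bessel_entire (\<nu> + 2) y"] by simp
  have "(\<lambda>m. (\<nu> + 1) * (bessel_coeff (\<nu> + 1) m * y ^ m)
      - (case m of 0 \<Rightarrow> 0 | Suc m \<Rightarrow> y * (bessel_coeff (\<nu> + 2) m * y ^ m)))
      sums ((\<nu> + 1) * bessel_entire (\<nu> + 1) y - y * bessel_entire (\<nu> + 2) y)"
    by (intro sums_diff sums_mult s1 s2)
  also have "(\<lambda>m. (\<nu> + 1) * (bessel_coeff (\<nu> + 1) m * y ^ m)
      - (case m of 0 \<Rightarrow> 0 | Suc m \<Rightarrow> y * (bessel_coeff (\<nu> + 2) m * y ^ m)))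
      = (\<lambda>m. bessel_coeff \<nu> m * y ^ m)"
  proof
    fix m
    have G: "Gamma (\<nu> + 1) > 0" "Gamma (1 + (\<nu> + 1)) = (\<nu> + 1) * Gamma (\<nu> + 1)"
      using Gamma_shift_pos[OF assms, of 0] by (auto simp: add_ac)
    show "(\<nu> + 1) * (bessel_coeff (\<nu> + 1) m * y ^ m)
      - (case m of 0 \<Rightarrow> 0 | Suc m \<Rightarrow> y * (bessel_coeff (\<nu> + 2) m * y ^ m))
      = bessel_coeff \<nu> m * y ^ m"
    proof (cases m)
      case 0
      then show ?thesis using G assms by (simp add: bessel_coeff_def add_ac)
    next
      case (Suc n)
      define g where "g = Gamma (real (Suc n) + \<nu> + 1)"
      have g: "g > 0" "Gamma (real (Suc n) + (\<nu> + 1) + 1) = (real n + \<nu> + 2) * g"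
        "Gamma (real n + (\<nu> + 2) + 1) = (real n + \<nu> + 2) * g"
        using Gamma_shift_pos[OF assms, of "Suc n"] by (auto simp: g_def add_ac)
      have nz: "real n + \<nu> + 2 \<noteq> 0" using assms by linarith
      define q where "q = (-1) ^ m / (fact m * ((real n + \<nu> + 2) * g))"
      have eqs: "bessel_coeff (\<nu> + 1) m = q" "bessel_coeff (\<nu> + 2) n = - (real n + 1) * q"
        "bessel_coeff \<nu> m = (real n + \<nu> + 2) * q"
        unfolding bessel_coeff_def Suc g q_def
        using g(1) nz by (simp_all add: g_def divide_simps add_ac) (simp add: algebra_simps)
      show ?thesis
        unfolding eqs by (simp add: Suc eqs(2) algebra_simps)
    qed
  qed
  finally show ?thesis
    unfolding bessel_entire_def[of \<nu>] by (rule sums_unique [symmetric])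
qed

lemma bessel_J_eq:
  assumes "\<nu> > -1" "t > 0"
  shows "bessel_J \<nu> t = (t / 2) powr \<nu> * bessel_entire \<nu> (t\<^sup>2 / 4)"
proof -
  have "(t / 2) powr (2 * real m + \<nu>) = (t / 2) powr \<nu> * (t\<^sup>2 / 4) ^ m" for m
  proof -
    have "(t / 2) powr (2 * real m) = (t / 2) ^ (2 * m)"
      using assms by (subst powr_realpow [symmetric]) auto
    also have "\<dots> = (t\<^sup>2 / 4) ^ m"
      by (simp add: power_mult power2_eq_square)
    finally show ?thesis by (simp add: powr_add)
  qed
  then have "bessel_J \<nu> t = (\<Sum>m. (t / 2) powr \<nu> * (bessel_coeff \<nu> m * (t\<^sup>2 / 4) ^ m))"
    unfolding bessel_J_def bessel_coeff_def by (simp add: mult_ac)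
  then show ?thesis
    unfolding bessel_entire_def
    using suminf_mult[OF summable_bessel_coeff[OF assms(1), of "t\<^sup>2 / 4"]] by simp
qed

lemma DERIV_bessel_J:
  assumes "\<nu> > -1" "t > 0"
  shows "(bessel_J \<nu> has_real_derivative (\<nu> / t * bessel_J \<nu> t - bessel_J (\<nu> + 1) t)) (at t)"
proof -
  have "((\<lambda>t. (t / 2) powr \<nu> * bessel_entire \<nu> (t\<^sup>2 / 4)) has_real_derivative
     (\<nu> * (t / 2) powr (\<nu> - 1) * (1/2)) * bessel_entire \<nu> (t\<^sup>2 / 4)
      + (- bessel_entire (\<nu> + 1) (t\<^sup>2 / 4) * (t / 2)) * (t / 2) powr \<nu>) (at t)"
    using assms by (auto intro!: derivative_eq_intros DERIV_chain2[OF DERIV_bessel_entire[OF assms(1)]])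
  also have "(\<nu> * (t / 2) powr (\<nu> - 1) * (1/2)) * bessel_entire \<nu> (t\<^sup>2 / 4)
      + (- bessel_entire (\<nu> + 1) (t\<^sup>2 / 4) * (t / 2)) * (t / 2) powr \<nu>
      = \<nu> / t * bessel_J \<nu> t - bessel_J (\<nu> + 1) t"
    using assms by (simp add: bessel_J_eq powr_add powr_diff field_simps)
  finally have D: "((\<lambda>t. (t / 2) powr \<nu> * bessel_entire \<nu> (t\<^sup>2 / 4)) has_real_derivative
     (\<nu> / t * bessel_J \<nu> t - bessel_J (\<nu> + 1) t)) (at t)" .
  show ?thesis
    by (rule has_field_derivative_transform_within_open[OF D open_greaterThan[of 0]])
       (use assms in \<open>auto simp: bessel_J_eq\<close>)
qed

lemma bessel_J_recurrence:
  assumes "\<nu> > -1" "t > 0"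
  shows "bessel_J (\<nu> + 2) t = 2 * (\<nu> + 1) / t * bessel_J (\<nu> + 1) t - bessel_J \<nu> t"
proof -
  define p where "p = (t / 2) powr \<nu>"
  have "bessel_J \<nu> t = p * bessel_entire \<nu> (t\<^sup>2 / 4)"
    "bessel_J (\<nu> + 1) t = p * (t / 2) * bessel_entire (\<nu> + 1) (t\<^sup>2 / 4)"
    "bessel_J (\<nu> + 2) t = p * (t\<^sup>2 / 4) * bessel_entire (\<nu> + 2) (t\<^sup>2 / 4)"
    using assms by (simp_all add: bessel_J_eq p_def powr_add power_divide)
  moreover have "(2 * (\<nu> + 1) / t) * (p * (t / 2) * x) = p * ((\<nu> + 1) * x)" for x
    using assms by simp
  ultimately show ?thesis
    using bessel_entire_recurrence[OF assms(1), of "t\<^sup>2 / 4"]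
    by (simp only:) (simp add: algebra_simps)
qed

lemma DERIV_bessel_J_down:
  assumes "\<nu> > -1" "t > 0"
  shows "(bessel_J (\<nu> + 1) has_real_derivative
           (bessel_J \<nu> t - (\<nu> + 1) / t * bessel_J (\<nu> + 1) t)) (at t)"
proof -
  have "bessel_J (\<nu> + 1 + 1) t = 2 * ((\<nu> + 1) / t * bessel_J (\<nu> + 1) t) - bessel_J \<nu> t"
    using bessel_J_recurrence[OF assms] by (simp add: add.assoc)
  then have "(\<nu> + 1) / t * bessel_J (\<nu> + 1) t - bessel_J (\<nu> + 1 + 1) t
      = bessel_J \<nu> t - (\<nu> + 1) / t * bessel_J (\<nu> + 1) t"
    by linarith
  moreover have "(bessel_J (\<nu> + 1) has_real_derivative
      ((\<nu> + 1) / t * bessel_J (\<nu> + 1) t - bessel_J (\<nu> + 1 + 1) t)) (at t)"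
    using assms by (intro DERIV_bessel_J) auto
  ultimately show ?thesis by (simp only:)
qed

text \<open>
Below \<open>t\<^sup>2 = 4 (\<nu> + 1)\<close> the terms of the alternating series decrease in absolute value, so that the
sum exceeds the difference of its first two terms.
\<close>

lemma bessel_J_pos:
  assumes "\<nu> > -1" "t > 0" "t\<^sup>2 < 4 * (\<nu> + 1)"
  shows "bessel_J \<nu> t > 0"
proof -
  define y where "y = t\<^sup>2 / 4"
  define a where "a m = y ^ m / (fact m * Gamma (real m + \<nu> + 1))" for m
  have y: "0 < y" "y < \<nu> + 1" using assms by (auto simp: y_def)
  have pos: "a m > 0" for m
    using Gamma_shift_pos(1)[OF assms(1), of m] y by (simp add: a_def)
  have Suc: "a (Suc m) = a m * (y / ((real m + 1) * (real m + \<nu> + 1)))" for m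
    using Gamma_shift_pos[OF assms(1), of m] assms(1)
    unfolding a_def Gamma_shift_pos(2)[OF assms(1)] by (simp add: divide_simps)
  have dec: "a (Suc m) < a m" for m
  proof -
    have "y < 1 * (real m + \<nu> + 1)" using y by simp
    also have "\<dots> \<le> (real m + 1) * (real m + \<nu> + 1)"
      using assms(1) by (intro mult_right_mono) auto
    finally have "y / ((real m + 1) * (real m + \<nu> + 1)) < 1"
      using assms(1) by (simp add: divide_simps)
    from mult_strict_left_mono[OF this pos[of m]] show ?thesis by (simp add: Suc)
  qed
  have eq: "bessel_coeff \<nu> m * y ^ m = (-1) ^ m * a m" for m
    by (simp add: bessel_coeff_def a_def)
  have sm: "summable (\<lambda>m. (-1) ^ m * a m)"
    using summable_bessel_coeff[OF assms(1), of y] by (simp add: eq)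
  have "(\<lambda>n. \<Sum>m<n. (-1) ^ m * a m) \<longlonglongrightarrow> bessel_entire \<nu> y"
    using summable_LIMSEQ[OF sm] by (simp add: bessel_entire_def eq)
  then have "(\<lambda>n. \<Sum>m<2 * (n+1). (-1) ^ m * a m) \<longlonglongrightarrow> bessel_entire \<nu> y"
    by (rule LIMSEQ_subseq_LIMSEQ[unfolded o_def]) (auto simp: strict_mono_def)
  moreover have "(\<Sum>m<2 * (n+1). (-1) ^ m * a m) \<ge> a 0 - a 1" for n
  proof (induction n)
    case 0
    then show ?case by (simp add: numeral_2_eq_2)
  next
    case (Suc n)
    then show ?case using dec[of "2 * (n + 1)"] by simp
  qed
  ultimately have "bessel_entire \<nu> y \<ge> a 0 - a 1"
    by (intro LIMSEQ_le_const) auto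
  then have "bessel_entire \<nu> y > 0" using dec[of 0] by simp
  then show ?thesis
    using assms by (simp add: bessel_J_eq y_def)
qed

text \<open>
This replaces uniqueness for the initial value problem. By the three-term recurrence a common zero
\<open>t\<close> of two neighbouring orders would be a zero for all higher orders too, but for orders above
\<open>t\<^sup>2\<close> the function is positive at \<open>t\<close>.
\<close>

lemma bessel_J_no_common_zero:
  assumes "\<nu> > -1" "t > 0" "bessel_J \<nu> t = 0"
  shows "bessel_J (\<nu> + 1) t \<noteq> 0"
proof
  assume "bessel_J (\<nu> + 1) t = 0"
  then have "bessel_J (\<nu> + real n) t = 0 \<and> bessel_J (\<nu> + real n + 1) t = 0" for n
  proof (induction n)
    case 0
    then show ?case using assms by simp
  next
    case (Suc n)
    then show ?case
      using bessel_J_recurrence[of "\<nu> + real n" t] assms by (simp add: add_ac)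
  qed
  moreover obtain n where "real n > t\<^sup>2" using reals_Archimedean2 by blast
  then have "bessel_J (\<nu> + real n) t > 0"
    using assms by (intro bessel_J_pos) (auto intro: less_le_trans)
  ultimately show False by (metis less_irrefl)
qed

text \<open>
The duplication formula turns \<open>m! * Gamma (m + 3/2)\<close> into \<open>(2m + 1)!\<close>, up to elementary factors, and
the series of order \<open>1/2\<close> becomes that of the sine. This is the one order whose zeros can be
numbered by inspection.
\<close>

lemma bessel_entire_half:
  "bessel_entire (1/2) (t\<^sup>2 / 4) * t = 2 / sqrt pi * sin t"
proof -
  have G: "Gamma (real m + 1/2 + 1) = fact (2 * m + 1) * sqrt pi / (2 * 4 ^ m * fact m)" for m
  proof (induction m)
    case 0
    have "Gamma (1/2 + 1 :: real) = 1/2 * Gamma (1/2)"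
      by (rule Gamma_plus1) (auto elim!: nonpos_Ints_cases)
    then show ?case by (simp add: Gamma_one_half_real add_ac)
  next
    case (Suc m)
    have "Gamma (real (Suc m) + 1/2 + 1) = (real m + 1/2 + 1) * (fact (2 * m + 1) * sqrt pi / (2 * 4 ^ m * fact m))"
      unfolding Suc[symmetric] by (rule Gamma_shift_pos(2)) simp
    also have "\<dots> = fact (2 * Suc m + 1) * sqrt pi / (2 * 4 ^ Suc m * fact (Suc m))"
      by (simp add: divide_simps)
    finally show ?case .
  qed
  have "(\<lambda>m. bessel_coeff (1/2) m * (t\<^sup>2/4) ^ m * t * (sqrt pi / 2))
       = (\<lambda>m. (-1) ^ m / fact (2 * m + 1) * t ^ (2 * m + 1))"
  proof
    fix m
    show "bessel_coeff (1/2) m * (t\<^sup>2/4) ^ m * t * (sqrt pi / 2)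
       = (-1) ^ m / fact (2 * m + 1) * t ^ (2 * m + 1)"
      unfolding bessel_coeff_def G
      by (simp add: power_divide power_mult divide_simps)
  qed
  moreover have S: "(\<lambda>m. (-1) ^ m / fact (2 * m + 1) * t ^ (2 * m + 1)) sums sin t"
    using sin_paired[of t] by simp
  moreover have "(\<lambda>m. bessel_coeff (1/2) m * (t\<^sup>2/4) ^ m * t * (sqrt pi / 2)) sums
      (bessel_entire (1/2) (t\<^sup>2/4) * t * (sqrt pi / 2))"
    unfolding bessel_entire_def
    by (intro sums_mult2 summable_sums summable_bessel_coeff) simp
  ultimately have "(\<lambda>m. (-1) ^ m / fact (2 * m + 1) * t ^ (2 * m + 1)) sums
      (bessel_entire (1/2) (t\<^sup>2/4) * t * (sqrt pi / 2))"
    by (simp only:)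
  from sums_unique2[OF this S]
  have "bessel_entire (1/2) (t\<^sup>2/4) * t * (sqrt pi / 2) = sin t" .
  then show ?thesis by (simp add: field_simps)
qed

lemma bessel_J_half_zero_iff:
  assumes "t > 0"
  shows "bessel_J (1/2) t = 0 \<longleftrightarrow> sin t = 0"
  using bessel_entire_half[of t] assms by (auto simp: bessel_J_eq)

section \<open>Counting zeros: Rolle and Sturm\<close>

definition bessel_zeros :: "real \<Rightarrow> real \<Rightarrow> real set" where
  "bessel_zeros \<nu> t = {y. 0 < y \<and> y \<le> t \<and> bessel_J \<nu> y = 0}"

text \<open>
Sending each point of \<open>A\<close> to the last point of \<open>B\<close> below it is injective, and at most one point of
\<open>A\<close> has no point of \<open>B\<close> below it. Finiteness of \<open>A\<close> is part of the conclusion: the zeros of a Bessel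
function are shown to be finite in number by this very argument.
\<close>

lemma card_le_Suc_card_of_separating:
  fixes A B :: "real set"
  assumes "finite B" and sep: "\<And>a b. a \<in> A \<Longrightarrow> b \<in> A \<Longrightarrow> a < b \<Longrightarrow> \<exists>c\<in>B. a < c \<and> c < b"
  shows "finite A" and "card A \<le> Suc (card B)"
proof -
  define A1 where "A1 = {a \<in> A. \<exists>c\<in>B. c < a}"
  define h where "h a = Max {c \<in> B. c < a}" for a
  have h: "h a \<in> B" "h a < a" if "a \<in> A1" for a
  proof -
    have "h a \<in> {c \<in> B. c < a}"
      unfolding h_def using that \<open>finite B\<close> by (intro Max_in) (auto simp: A1_def)
    then show "h a \<in> B" "h a < a" by auto
  qed
  have mono: "h a < h b" if "a \<in> A1" "b \<in> A1" "a < b" for a b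
  proof -
    have "a \<in> A" "b \<in> A" using that by (auto simp: A1_def)
    then obtain c where c: "c \<in> B" "a < c" "c < b"
      using sep[OF _ _ \<open>a < b\<close>] by blast
    have "c \<le> h b" unfolding h_def using c \<open>finite B\<close> by (intro Max_ge) auto
    then show ?thesis using h[OF that(1)] c by linarith
  qed
  have inj: "inj_on h A1"
    by (rule inj_onI) (metis mono less_irrefl linorder_neqE)
  have fin1: "finite A1"
    using h(1) by (intro inj_on_finite[OF inj _ \<open>finite B\<close>]) auto
  have card1: "card A1 \<le> card B"
    using h(1) by (intro card_inj_on_le[OF inj _ \<open>finite B\<close>]) auto
  obtain x where x: "A - A1 \<subseteq> {x}"
  proof (cases "A - A1 = {}")
    case False
    then obtain x where "x \<in> A - A1" by auto
    moreover have "y = x" if "y \<in> A - A1" for y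
      using that calculation sep[of x y] sep[of y x]
      by (cases x y rule: linorder_cases) (auto simp: A1_def)
    ultimately show ?thesis using that by blast
  qed (use that in blast)
  have sub: "A \<subseteq> insert x A1" using x by auto
  show "finite A" using sub fin1 by (meson finite_insert finite_subset)
  have "card A \<le> card (insert x A1)" using sub fin1 by (intro card_mono) auto
  also have "\<dots> \<le> Suc (card A1)" using fin1 by (simp add: card_insert_if)
  finally show "card A \<le> Suc (card B)" using card1 by simp
qed

lemma bessel_J_zero_iff:
  assumes "\<nu> > -1" "t > 0"
  shows "bessel_J \<nu> t = 0 \<longleftrightarrow> bessel_entire \<nu> (t\<^sup>2 / 4) = 0"
  using assms by (simp add: bessel_J_eq)

text \<open>
Rolle's theorem applies to \<open>J_\<nu> t / (t/2) powr \<nu>\<close>, whose derivative is a nonzero multiple of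
the Bessel function of order \<open>\<nu> + 1\<close>.
\<close>

lemma bessel_J_Rolle:
  assumes "\<nu> > -1" "0 < a" "a < b" "bessel_J \<nu> a = 0" "bessel_J \<nu> b = 0"
  shows "\<exists>c. a < c \<and> c < b \<and> bessel_J (\<nu> + 1) c = 0"
proof -
  have D: "((\<lambda>t. bessel_entire \<nu> (t\<^sup>2 / 4)) has_real_derivative
     - bessel_entire (\<nu> + 1) (t\<^sup>2 / 4) * (t / 2)) (at t)" for t
  proof -
    have "((\<lambda>t::real. t\<^sup>2 / 4) has_real_derivative t / 2) (at t)"
      by (auto intro!: derivative_eq_intros)
    from DERIV_chain2[OF DERIV_bessel_entire[OF assms(1)] this] show ?thesis .
  qed
  have "\<exists>c. a < c \<and> c < b \<and> - bessel_entire (\<nu> + 1) (c\<^sup>2 / 4) * (c / 2) = 0"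
  proof -
    obtain c where c: "a < c" "c < b"
      "bessel_entire \<nu> (b\<^sup>2 / 4) - bessel_entire \<nu> (a\<^sup>2 / 4)
        = (b - a) * (- bessel_entire (\<nu> + 1) (c\<^sup>2 / 4) * (c / 2))"
      using MVT2[OF \<open>a < b\<close> D] by blast
    moreover have "bessel_entire \<nu> (a\<^sup>2 / 4) = 0" "bessel_entire \<nu> (b\<^sup>2 / 4) = 0"
      using assms by (simp_all add: bessel_J_zero_iff)
    ultimately show ?thesis using \<open>a < b\<close> by auto
  qed
  then show ?thesis
    using assms by (auto simp: bessel_J_zero_iff)
qed

lemma bessel_zeros_Suc_order:
  assumes "\<nu> > -1" "finite (bessel_zeros (\<nu> + 1) t)"
  shows "finite (bessel_zeros \<nu> t)" "card (bessel_zeros \<nu> t) \<le> Suc (card (bessel_zeros (\<nu> + 1) t))"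
proof -
  have "\<exists>c\<in>bessel_zeros (\<nu> + 1) t. a < c \<and> c < b"
    if "a \<in> bessel_zeros \<nu> t" "b \<in> bessel_zeros \<nu> t" "a < b" for a b
    using bessel_J_Rolle[OF assms(1), of a b] that by (fastforce simp: bessel_zeros_def)
  from card_le_Suc_card_of_separating[OF assms(2) this]
  show "finite (bessel_zeros \<nu> t)" "card (bessel_zeros \<nu> t) \<le> Suc (card (bessel_zeros (\<nu> + 1) t))"
    by blast+
qed

text \<open>
Downward induction on the order: for a large order there are no zeros in \<open>(0, t]\<close> at all, and lowering
the order by one adds at most one.
\<close>

lemma finite_bessel_zeros:
  assumes "\<nu> > -1"
  shows "finite (bessel_zeros \<nu> t)"
proof -
  obtain n where n: "real n > t\<^sup>2" using reals_Archimedean2 by blast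
  have "finite (bessel_zeros (\<nu> + real m) t)" if "m \<le> n" for m
    using that
  proof (induction rule: inc_induct)
    case base
    have "bessel_J (\<nu> + real n) y > 0" if "0 < y" "y \<le> t" for y
    proof -
      have "y\<^sup>2 \<le> t\<^sup>2" using that by (intro power_mono) auto
      also note n
      also have "real n \<le> 4 * real n" by simp
      also have "\<dots> < 4 * (\<nu> + real n + 1)" using assms by simp
      finally have "y\<^sup>2 < 4 * (\<nu> + real n + 1)" .
      then show ?thesis using that assms by (intro bessel_J_pos) auto
    qed
    then have "bessel_zeros (\<nu> + real n) t = {}"
      by (force simp: bessel_zeros_def)
    then show ?case by simp
  next
    case (step m)
    then show ?case
      using bessel_zeros_Suc_order(1)[of "\<nu> + real m" t] assms by (simp add: add_ac)
  qed
  from this[of 0] show ?thesis by simp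
qed

text \<open>
For positive orders this is the true value, and the origin can serve as an additional zero below
all others.
\<close>

lemma bessel_J_at_0 [simp]: "bessel_J \<nu> 0 = 0"
  by (simp add: bessel_J_def)

lemma continuous_on_bessel_J:
  assumes "\<nu> > 0"
  shows "continuous_on {0..} (bessel_J \<nu>)"
proof -
  have "isCont (bessel_entire \<nu>) y" for y
    using DERIV_bessel_entire[of \<nu> y] assms by (auto intro: DERIV_isCont)
  then have "continuous_on UNIV (bessel_entire \<nu>)"
    by (simp add: continuous_at_imp_continuous_on)
  then have "continuous_on {0..} (\<lambda>t. bessel_entire \<nu> (t\<^sup>2 / 4))"
    by (rule continuous_on_compose2) (auto intro!: continuous_intros)
  moreover have "continuous_on {0..} (\<lambda>t. (t / 2) powr \<nu>)"
    using assms by (intro continuous_on_powr' continuous_intros) auto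
  ultimately have "continuous_on {0..} (\<lambda>t. (t / 2) powr \<nu> * bessel_entire \<nu> (t\<^sup>2 / 4))"
    by (intro continuous_on_mult)
  then show ?thesis
  proof (rule continuous_on_eq)
    fix t :: real assume "t \<in> {0..}"
    then show "(t / 2) powr \<nu> * bessel_entire \<nu> (t\<^sup>2 / 4) = bessel_J \<nu> t"
      using assms by (cases "t = 0") (auto simp: bessel_J_eq)
  qed
qed

text \<open>
This is \<open>t * J_\<nu>' t\<close>, written without a derivative. With the derivative \<open>t d/dt\<close> the Bessel equation
has no first-order term, so that \<open>J\<close> and \<open>K\<close> form a first-order system.
\<close>

definition bessel_K :: "real \<Rightarrow> real \<Rightarrow> real" where
  "bessel_K \<nu> t = \<nu> * bessel_J \<nu> t - t * bessel_J (\<nu> + 1) t"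

lemma DERIV_bessel_J_K:
  assumes "\<nu> > -1" "t > 0"
  shows "(bessel_J \<nu> has_real_derivative bessel_K \<nu> t / t) (at t)"
  using DERIV_bessel_J[OF assms] assms by (simp add: bessel_K_def diff_divide_distrib)

lemma DERIV_bessel_K:
  assumes "\<nu> > -1" "t > 0"
  shows "(bessel_K \<nu> has_real_derivative (\<nu>\<^sup>2 - t\<^sup>2) / t * bessel_J \<nu> t) (at t)"
proof -
  have "(bessel_K \<nu> has_real_derivative \<nu> * (\<nu> / t * bessel_J \<nu> t - bessel_J (\<nu> + 1) t)
      - (1 * bessel_J (\<nu> + 1) t + (bessel_J \<nu> t - (\<nu> + 1) / t * bessel_J (\<nu> + 1) t) * t)) (at t)"
    unfolding bessel_K_def [abs_def]
    using assms by (intro DERIV_diff DERIV_cmult DERIV_mult DERIV_ident DERIV_bessel_J DERIV_bessel_J_down)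
  moreover have "\<nu> * (\<nu> / t * bessel_J \<nu> t - bessel_J (\<nu> + 1) t)
      - (1 * bessel_J (\<nu> + 1) t + (bessel_J \<nu> t - (\<nu> + 1) / t * bessel_J (\<nu> + 1) t) * t)
      = (\<nu>\<^sup>2 - t\<^sup>2) / t * bessel_J \<nu> t"
    using assms by (simp add: field_simps power2_eq_square)
  ultimately show ?thesis by simp
qed

lemma continuous_nonzero_constant_sign:
  fixes f :: "real \<Rightarrow> real"
  assumes "continuous_on {a<..<b} f" "\<And>x. a < x \<Longrightarrow> x < b \<Longrightarrow> f x \<noteq> 0"
  shows "\<exists>s\<in>{1, -1}. \<forall>x. a < x \<longrightarrow> x < b \<longrightarrow> s * f x > 0"
proof (rule ccontr)
  assume *: "\<not> ?thesis"
  then have "\<not> (\<forall>x. a < x \<longrightarrow> x < b \<longrightarrow> 1 * f x > 0)" "\<not> (\<forall>x. a < x \<longrightarrow> x < b \<longrightarrow> -1 * f x > 0)"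
    by blast+
  then obtain x y where "a < x" "x < b" "\<not> f x > 0" "a < y" "y < b" "\<not> - f y > 0"
    by auto
  then have xy: "a < x" "x < b" "f x < 0" "a < y" "y < b" "f y > 0"
    using assms(2)[of x] assms(2)[of y] by linarith+
  have "connected (f ` {a<..<b})"
    using assms(1) by (intro connected_continuous_image) auto
  then have "0 \<in> f ` {a<..<b}"
    using connectedD_interval[of "f ` {a<..<b}" "f x" "f y" 0] xy by force
  then show False using assms(2) by auto
qed

lemma DERIV_sign_at_right_zero:
  fixes f :: "real \<Rightarrow> real"
  assumes "(f has_real_derivative D) (at a)" "f a = 0" "a < b" "\<And>x. a < x \<Longrightarrow> x < b \<Longrightarrow> f x > 0"
  shows "D \<ge> 0"
proof (rule ccontr)
  assume "\<not> D \<ge> 0"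
  then obtain d where d: "d > 0" "\<And>h. h > 0 \<Longrightarrow> h < d \<Longrightarrow> f (a + h) < f a"
    using DERIV_neg_dec_right[OF assms(1)] by auto
  define h where "h = min d (b - a) / 2"
  have "h > 0" "h < d" "a + h < b" using d assms(3) by (auto simp: h_def min_def field_simps)
  then show False using d(2)[of h] assms(2) assms(4)[of "a + h"] by simp
qed

lemma DERIV_sign_at_left_zero:
  fixes f :: "real \<Rightarrow> real"
  assumes "(f has_real_derivative D) (at b)" "f b = 0" "a < b" "\<And>x. a < x \<Longrightarrow> x < b \<Longrightarrow> f x > 0"
  shows "D \<le> 0"
proof (rule ccontr)
  assume "\<not> D \<le> 0"
  then obtain d where d: "d > 0" "\<And>h. h > 0 \<Longrightarrow> h < d \<Longrightarrow> f (b - h) < f b"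
    using DERIV_pos_inc_left[OF assms(1)] by auto
  define h where "h = min d (b - a) / 2"
  have "h > 0" "h < d" "a < b - h" using d assms(3) by (auto simp: h_def min_def field_simps)
  then show False using d(2)[of h] assms(2) assms(4)[of "b - h"] by simp
qed

text \<open>
Sturm comparison: for \<open>\<nu> < \<mu>\<close> the function of order \<open>\<nu>\<close> oscillates faster. Up to the signs that make both
functions positive between two adjacent zeros of \<open>J_\<mu>\<close>, their Wronskian decreases strictly, whereas its
values at the two ends do not allow this unless \<open>J_\<nu>\<close> has a zero in between. The left end may be
the singular point \<open>0\<close>, where the Wronskian vanishes; this makes the comparison one of
absolute zero counts.
\<close>

lemma bessel_J_Sturm:
  assumes "0 < \<nu>" "\<nu> < \<mu>" "0 \<le> a" "a < b" "bessel_J \<mu> a = 0" "bessel_J \<mu> b = 0"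
  shows "\<exists>c. a < c \<and> c < b \<and> bessel_J \<nu> c = 0"
proof (rule ccontr)
  assume none: "\<not> ?thesis"
  define Z where "Z = {c \<in> bessel_zeros \<mu> b. a < c}"
  have "finite Z" unfolding Z_def using finite_bessel_zeros[of \<mu> b] assms by auto
  moreover have "b \<in> Z" using assms by (auto simp: Z_def bessel_zeros_def)
  ultimately have "Min Z \<in> Z" and Min: "\<And>c. c \<in> Z \<Longrightarrow> Min Z \<le> c"
    by (auto intro: Min_in)
  define c where "c = Min Z"
  have c: "a < c" "c \<le> b" "bessel_J \<mu> c = 0"
    using \<open>Min Z \<in> Z\<close> by (auto simp: c_def Z_def bessel_zeros_def)
  have nz: "bessel_J \<mu> y \<noteq> 0" if "a < y" "y < c" for y
  proof
    assume "bessel_J \<mu> y = 0"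
    then have "y \<in> Z" using that c assms by (auto simp: Z_def bessel_zeros_def)
    then show False using Min[of y] that by (simp add: c_def)
  qed
  have cont: "continuous_on {a..c} (bessel_J \<kappa>)" if "\<kappa> > 0" for \<kappa>
    using continuous_on_bessel_J[OF that] assms by (intro continuous_on_subset[OF continuous_on_bessel_J[OF that]]) auto
  have cont': "continuous_on {a<..<c} (bessel_J \<kappa>)" if "\<kappa> > 0" for \<kappa>
    using cont[OF that] by (rule continuous_on_subset) auto
  obtain s where s: "s \<in> {1, -1}" "\<And>y. a < y \<Longrightarrow> y < c \<Longrightarrow> s * bessel_J \<nu> y > 0"
    using continuous_nonzero_constant_sign[OF cont'[of \<nu>]] none c(2) assms(1) by force
  obtain r where r: "r \<in> {1, -1}" "\<And>y. a < y \<Longrightarrow> y < c \<Longrightarrow> r * bessel_J \<mu> y > 0"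
    using continuous_nonzero_constant_sign[OF cont'[of \<mu>]] nz assms by force
  \<comment> \<open>The factors \<open>s\<close> and \<open>r\<close> are the signs of the two functions on \<open>(a, c)\<close>.\<close>
  define W where "W y = (s * bessel_K \<nu> y) * (r * bessel_J \<mu> y) - (s * bessel_J \<nu> y) * (r * bessel_K \<mu> y)" for y
  have DW: "(W has_real_derivative (\<nu>\<^sup>2 - \<mu>\<^sup>2) / y * ((s * bessel_J \<nu> y) * (r * bessel_J \<mu> y))) (at y)"
    if "y > 0" for y
    unfolding W_def [abs_def] using that assms
    by (auto intro!: derivative_eq_intros DERIV_bessel_J_K DERIV_bessel_K simp: field_simps)
  have "W c < W a"
  proof (rule DERIV_neg_imp_decreasing_open[OF c(1)])
    show "\<exists>D. (W has_real_derivative D) (at y) \<and> D < 0" if "a < y" "y < c" for y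
    proof -
      have "\<nu>\<^sup>2 < \<mu>\<^sup>2" using assms by (intro power_strict_mono) auto
      then have "(\<nu>\<^sup>2 - \<mu>\<^sup>2) / y < 0" using that assms by (simp add: divide_neg_pos)
      moreover have "(s * bessel_J \<nu> y) * (r * bessel_J \<mu> y) > 0"
        by (rule mult_pos_pos[OF s(2)[OF that] r(2)[OF that]])
      ultimately have "(\<nu>\<^sup>2 - \<mu>\<^sup>2) / y * ((s * bessel_J \<nu> y) * (r * bessel_J \<mu> y)) < 0"
        by (rule mult_neg_pos)
      then show ?thesis using DW[of y] that assms by force
    qed
    show "continuous_on {a..c} W"
      unfolding W_def [abs_def] bessel_K_def
      using assms by (intro continuous_intros cont) auto
  qed
  moreover have "W a \<le> 0"
  proof (cases "a = 0")
    case True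
    then show ?thesis by (simp add: W_def bessel_K_def)
  next
    case False
    then have "a > 0" using assms by simp
    have "((\<lambda>y. r * bessel_J \<mu> y) has_real_derivative r * (bessel_K \<mu> a / a)) (at a)"
      using assms \<open>a > 0\<close> by (intro DERIV_cmult DERIV_bessel_J_K) auto
    then have "r * (bessel_K \<mu> a / a) \<ge> 0"
      by (rule DERIV_sign_at_right_zero[OF _ _ c(1)]) (use r assms in auto)
    then have "r * bessel_K \<mu> a \<ge> 0" using \<open>a > 0\<close> by (simp add: zero_le_divide_iff)
    moreover have "s * bessel_J \<nu> a \<ge> 0"
    proof (rule continuous_ge_on_closure[of "{a<..<c}" "\<lambda>y. s * bessel_J \<nu> y"])
      show "continuous_on (closure {a<..<c}) (\<lambda>y. s * bessel_J \<nu> y)"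
        using c(1) cont[of \<nu>] assms by (simp add: continuous_intros)
    qed (use s c in \<open>auto simp: less_imp_le\<close>)
    ultimately show ?thesis using assms by (simp add: W_def)
  qed
  moreover have "W c \<ge> 0"
  proof -
    have "c > 0" using c assms by simp
    have "((\<lambda>y. r * bessel_J \<mu> y) has_real_derivative r * (bessel_K \<mu> c / c)) (at c)"
      using assms \<open>c > 0\<close> by (intro DERIV_cmult DERIV_bessel_J_K) auto
    then have "r * (bessel_K \<mu> c / c) \<le> 0"
      by (rule DERIV_sign_at_left_zero[OF _ _ c(1)]) (use r c in auto)
    then have "r * bessel_K \<mu> c \<le> 0" using \<open>c > 0\<close> by (simp add: divide_le_0_iff)
    moreover have "s * bessel_J \<nu> c \<ge> 0"
    proof (rule continuous_ge_on_closure[of "{a<..<c}" "\<lambda>y. s * bessel_J \<nu> y"])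
      show "continuous_on (closure {a<..<c}) (\<lambda>y. s * bessel_J \<nu> y)"
        using c(1) cont[of \<nu>] assms by (simp add: continuous_intros)
    qed (use s c in \<open>auto simp: less_imp_le\<close>)
    ultimately show ?thesis using c by (simp add: W_def mult_nonneg_nonpos)
  qed
  ultimately show False by linarith
qed

lemma card_bessel_zeros_antimono:
  assumes "0 < \<nu>" "\<nu> \<le> \<mu>"
  shows "card (bessel_zeros \<mu> t) \<le> card (bessel_zeros \<nu> t)"
proof (cases "\<nu> = \<mu>")
  case False
  let ?A = "insert 0 (bessel_zeros \<mu> t)"
  have "\<exists>c\<in>bessel_zeros \<nu> t. a < c \<and> c < b" if "a \<in> ?A" "b \<in> ?A" "a < b" for a b
  proof -
    have "0 \<le> a" "b \<le> t" "bessel_J \<mu> a = 0" "bessel_J \<mu> b = 0"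
      using that by (auto simp: bessel_zeros_def)
    with bessel_J_Sturm[of \<nu> \<mu> a b] that(3) assms False
    obtain c where "a < c" "c < b" "bessel_J \<nu> c = 0" by auto
    then show ?thesis using \<open>0 \<le> a\<close> \<open>b \<le> t\<close> by (intro bexI[of _ c]) (auto simp: bessel_zeros_def)
  qed
  then have "card ?A \<le> Suc (card (bessel_zeros \<nu> t))"
    using card_le_Suc_card_of_separating(2)[OF finite_bessel_zeros[of \<nu> t], of ?A] assms(1) by simp
  moreover have "0 \<notin> bessel_zeros \<mu> t" by (simp add: bessel_zeros_def)
  moreover have "finite (bessel_zeros \<mu> t)" using assms by (intro finite_bessel_zeros) auto
  ultimately show ?thesis by simp
qed simp

lemma card_bessel_zeros_Suc_order:
  assumes "\<nu> > -1"
  shows "card (bessel_zeros \<nu> t) \<le> Suc (card (bessel_zeros (\<nu> + 1) t))"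
  using assms by (intro bessel_zeros_Suc_order(2) finite_bessel_zeros) auto

lemma card_bessel_zeros_half:
  assumes "0 < \<delta>" "\<delta> < 1"
  shows "card (bessel_zeros (1/2) ((real m + \<delta>) * pi)) = m"
proof -
  have "bessel_zeros (1/2) ((real m + \<delta>) * pi) = (\<lambda>i. real i * pi) ` {1..m}"
  proof (intro equalityI subsetI)
    fix y assume "y \<in> bessel_zeros (1/2) ((real m + \<delta>) * pi)"
    then have y: "0 < y" "y \<le> (real m + \<delta>) * pi" "sin y = 0"
      by (auto simp: bessel_zeros_def bessel_J_half_zero_iff)
    then obtain i :: int where i: "y = of_int i * pi" using sin_zero_iff_int2 by auto
    have "of_int i \<le> real m + \<delta>" using y i by simp
    moreover have "i > 0" using y i by (simp add: zero_less_mult_iff)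
    ultimately have "i \<le> int m" "i \<ge> 1" using assms by linarith+
    then show "y \<in> (\<lambda>i. real i * pi) ` {1..m}"
      using i by (intro image_eqI[of _ _ "nat i"]) auto
  next
    fix y assume "y \<in> (\<lambda>i. real i * pi) ` {1..m}"
    then show "y \<in> bessel_zeros (1/2) ((real m + \<delta>) * pi)"
      using assms by (auto simp: bessel_zeros_def bessel_J_half_zero_iff intro!: mult_right_mono)
  qed
  moreover have "inj_on (\<lambda>i. real i * pi) {1..m}" by (auto simp: inj_on_def)
  ultimately show ?thesis by (simp add: card_image)
qed

lemma bessel_zero_eqI:
  assumes "\<nu> > -1" "0 < z" "bessel_J \<nu> z = 0" "card (bessel_zeros \<nu> z) = k"
  shows "bessel_zero \<nu> k = z"
  unfolding bessel_zero_def
proof (rule the_equality)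
  show "0 < z \<and> bessel_J \<nu> z = 0 \<and> card {y. 0 < y \<and> y \<le> z \<and> bessel_J \<nu> y = 0} = k"
    using assms by (simp add: bessel_zeros_def)
  have less: "card (bessel_zeros \<nu> u) < card (bessel_zeros \<nu> v)"
    if "u < v" "0 < v" "bessel_J \<nu> v = 0" for u v
  proof (rule psubset_card_mono)
    show "finite (bessel_zeros \<nu> v)" by (rule finite_bessel_zeros[OF assms(1)])
    have "v \<in> bessel_zeros \<nu> v" "v \<notin> bessel_zeros \<nu> u" using that by (auto simp: bessel_zeros_def)
    moreover have "bessel_zeros \<nu> u \<subseteq> bessel_zeros \<nu> v" using that by (auto simp: bessel_zeros_def)
    ultimately show "bessel_zeros \<nu> u \<subset> bessel_zeros \<nu> v" by blast
  qed
  fix z' assume z': "0 < z' \<and> bessel_J \<nu> z' = 0 \<and> card {y. 0 < y \<and> y \<le> z' \<and> bessel_J \<nu> y = 0} = k"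
  then have "card (bessel_zeros \<nu> z') = k" by (simp add: bessel_zeros_def)
  then show "z' = z"
    using less[of z z'] less[of z' z] assms z' by (cases z z' rule: linorder_cases) auto
qed

section \<open>Sign of the Bessel function at large arguments\<close>

lemma continuous_on_one_minus_square_powr:
  assumes "a > 0"
  shows "continuous_on {0..1::real} (\<lambda>s. (1 - s\<^sup>2) powr a)"
  using assms by (intro continuous_on_powr' continuous_intros) (auto simp: power_le_one)

text \<open>
Integrate the derivative of \<open>s ^ (2m + 1) * (1 - s\<^sup>2) powr (a + 1)\<close>, which vanishes at both ends.
\<close>

lemma even_moment_recurrence:
  fixes a :: real
  assumes "a > 0"
  shows "(2 * a + 2 * real m + 3) * integral {0..1} (\<lambda>s. s ^ (2 * Suc m) * (1 - s\<^sup>2) powr a)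
       = (2 * real m + 1) * integral {0..1} (\<lambda>s. s ^ (2 * m) * (1 - s\<^sup>2) powr a)"
proof -
  have int: "(\<lambda>s. s ^ n * (1 - s\<^sup>2) powr a) integrable_on {0..1}" for n
    using assms by (intro integrable_continuous_interval continuous_intros continuous_on_one_minus_square_powr) auto
  define g where "g s = (2 * real m + 1) * (s ^ (2 * m) * (1 - s\<^sup>2) powr a)
      - (2 * a + 2 * real m + 3) * (s ^ (2 * Suc m) * (1 - s\<^sup>2) powr a)" for s :: real
  have "(g has_integral (1 ^ (2 * m + 1) * (1 - 1\<^sup>2) powr (a + 1) - 0 ^ (2 * m + 1) * (1 - 0\<^sup>2) powr (a + 1))) {0..1}"
  proof (rule fundamental_theorem_of_calculus_interior)
    show "continuous_on {0..1} (\<lambda>s::real. s ^ (2 * m + 1) * (1 - s\<^sup>2) powr (a + 1))"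
      using assms by (intro continuous_intros continuous_on_one_minus_square_powr) auto
    fix s :: real assume s: "s \<in> {0<..<1}"
    then have pos: "1 - s\<^sup>2 > 0" by (simp add: power_less_one_iff abs_square_less_1)
    have "((\<lambda>s. s ^ (2 * m + 1) * (1 - s\<^sup>2) powr (a + 1)) has_real_derivative
        real (2 * m + 1) * s ^ (2 * m) * (1 - s\<^sup>2) powr (a + 1)
        + ((a + 1) * (1 - s\<^sup>2) powr a * (- 2 * s)) * s ^ (2 * m + 1)) (at s)"
    proof (rule DERIV_mult)
      show "((\<lambda>s. s ^ (2 * m + 1)) has_real_derivative real (2 * m + 1) * s ^ (2 * m)) (at s)"
        using DERIV_pow[of "2 * m + 1" s] by simp
      show "((\<lambda>s. (1 - s\<^sup>2) powr (a + 1)) has_real_derivative (a + 1) * (1 - s\<^sup>2) powr a * (- 2 * s)) (at s)"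
        using pos by (auto intro!: derivative_eq_intros)
    qed
    moreover have "real (2 * m + 1) * s ^ (2 * m) * (1 - s\<^sup>2) powr (a + 1)
        + ((a + 1) * (1 - s\<^sup>2) powr a * (- 2 * s)) * s ^ (2 * m + 1) = g s"
      using pos by (simp add: g_def powr_add algebra_simps power2_eq_square)
    ultimately show "((\<lambda>s. s ^ (2 * m + 1) * (1 - s\<^sup>2) powr (a + 1)) has_vector_derivative g s) (at s)"
      by (simp add: has_real_derivative_iff_has_vector_derivative)
  qed simp
  then have "integral {0..1} g = 0" by (simp add: integral_unique)
  moreover have "integral {0..1} g = (2 * real m + 1) * integral {0..1} (\<lambda>s. s ^ (2 * m) * (1 - s\<^sup>2) powr a)
      - (2 * a + 2 * real m + 3) * integral {0..1} (\<lambda>s. s ^ (2 * Suc m) * (1 - s\<^sup>2) powr a)"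
    unfolding g_def by (subst integral_diff) (intro integrable_on_mult_right int, intro integrable_on_mult_right int, simp)
  ultimately show ?thesis by simp
qed

text \<open>
Expand the cosine and integrate term by term. By the moment recurrence the coefficients of both sides
satisfy the same recurrence, hence agree up to the factor fixed by the zeroth moment. Only the sign of this
factor matters later, so the zeroth moment is left unevaluated.
\<close>

lemma Poisson_integral:
  fixes a z :: real
  assumes "a > 0"
  defines "\<nu> \<equiv> a + 1/2"
  shows "integral {0..1} (\<lambda>s. (1 - s\<^sup>2) powr a * cos (z * s))
       = integral {0..1} (\<lambda>s. (1 - s\<^sup>2) powr a) * Gamma (\<nu> + 1) * bessel_entire \<nu> (z\<^sup>2 / 4)"
proof -
  define M where "M m = integral {0..1} (\<lambda>s. s ^ (2 * m) * (1 - s\<^sup>2) powr a)" for m :: nat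
  have \<nu>: "\<nu> > -1" using assms by simp
  have int: "(\<lambda>s. s ^ n * (1 - s\<^sup>2) powr a) integrable_on {0..1}" for n
    using assms by (intro integrable_continuous_interval continuous_intros continuous_on_one_minus_square_powr) auto
  have coeff: "(-1) ^ m / fact (2 * m) * M m * 4 ^ m = M 0 * Gamma (\<nu> + 1) * bessel_coeff \<nu> m" for m
  proof (induction m)
    case 0
    then show ?case using Gamma_shift_pos(1)[OF \<nu>, of 0] by (simp add: bessel_coeff_def)
  next
    case (Suc m)
    have den: "real m + 1 > 0" "real m + \<nu> + 1 > 0" using \<nu> by auto
    have "(2 * real m + 2 * \<nu> + 2) * M (Suc m) = (2 * real m + 1) * M m"
      using even_moment_recurrence[OF assms(1), of m] by (simp add: M_def \<nu>_def algebra_simps)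
    then have M: "M (Suc m) = (2 * real m + 1) * M m / (2 * (real m + \<nu> + 1))"
      using den by (simp add: field_simps)
    have "(-1) ^ Suc m / fact (2 * Suc m) * M (Suc m) * 4 ^ Suc m
        = - ((-1) ^ m / fact (2 * m) * M m * 4 ^ m) / ((real m + 1) * (real m + \<nu> + 1))"
      unfolding M using den by (simp add: divide_simps) (simp add: algebra_simps)
    also have "\<dots> = M 0 * Gamma (\<nu> + 1) * bessel_coeff \<nu> (Suc m)"
      unfolding Suc bessel_coeff_Suc[OF \<nu>] by simp
    finally show ?case .
  qed
  define f where "f n s = (\<Sum>m<n. (-1) ^ m / fact (2 * m) * (z * s) ^ (2 * m)) * (1 - s\<^sup>2) powr a" for n :: nat and s :: real
  define S where "S = (\<Sum>m. \<bar>z\<bar> ^ (2 * m) / fact (2 * m))"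
  have sS: "summable (\<lambda>m. \<bar>z\<bar> ^ (2 * m) / fact (2 * m))"
  proof -
    have "summable (\<lambda>n. \<bar>z\<bar> ^ n / fact n)"
      using summable_exp[of "\<bar>z\<bar>"] by (simp add: divide_inverse mult.commute)
    then show ?thesis
      using summable_reindex[of "\<lambda>n. \<bar>z\<bar> ^ n / fact n" "\<lambda>m. 2 * m"] by (simp add: inj_on_def o_def)
  qed
  have lim: "(\<lambda>n. integral {0..1} (f n)) \<longlonglongrightarrow> integral {0..1} (\<lambda>s. cos (z * s) * (1 - s\<^sup>2) powr a)"
  proof (rule dominated_convergence(2))
    show "f n integrable_on {0..1}" for n
      unfolding f_def using assms
      by (intro integrable_continuous_interval continuous_intros continuous_on_one_minus_square_powr) auto
    show "(\<lambda>_. S) integrable_on {0..1::real}"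
      by (intro integrable_continuous_interval continuous_on_const)
    show "norm (f n s) \<le> S" if "s \<in> {0..1}" for n s
    proof -
      have "(1 - s\<^sup>2) powr a \<le> 1" using that assms by (intro powr_le1) (auto simp: power_le_one)
      moreover have "\<bar>\<Sum>m<n. (-1) ^ m / fact (2 * m) * (z * s) ^ (2 * m)\<bar> \<le> S"
      proof -
        have "\<bar>\<Sum>m<n. (-1) ^ m / fact (2 * m) * (z * s) ^ (2 * m)\<bar> \<le> (\<Sum>m<n. \<bar>z\<bar> ^ (2 * m) / fact (2 * m))"
        proof (rule sum_abs[THEN order_trans], rule sum_mono)
          fix m
          have "\<bar>z * s\<bar> ^ (2 * m) \<le> \<bar>z\<bar> ^ (2 * m)"
            using that by (intro power_mono) (auto simp: abs_mult mult_left_le)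
          then show "\<bar>(-1) ^ m / fact (2 * m) * (z * s) ^ (2 * m)\<bar> \<le> \<bar>z\<bar> ^ (2 * m) / fact (2 * m)"
            by (simp add: abs_mult power_abs divide_simps)
        qed
        also have "\<dots> \<le> S" unfolding S_def by (rule sum_le_suminf[OF sS]) auto
        finally show ?thesis .
      qed
      ultimately have "\<bar>\<Sum>m<n. (-1) ^ m / fact (2 * m) * (z * s) ^ (2 * m)\<bar> * (1 - s\<^sup>2) powr a \<le> S * 1"
        by (intro mult_mono) auto
      then show ?thesis by (simp add: f_def abs_mult)
    qed
    show "(\<lambda>n. f n s) \<longlonglongrightarrow> cos (z * s) * (1 - s\<^sup>2) powr a" for s
      unfolding f_def using cos_paired[of "z * s"]
      by (intro tendsto_mult tendsto_const) (simp add: sums_def)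
  qed
  have "integral {0..1} (f n) = M 0 * Gamma (\<nu> + 1) * (\<Sum>m<n. bessel_coeff \<nu> m * (z\<^sup>2 / 4) ^ m)" for n
  proof -
    have "integral {0..1} (f n) = integral {0..1} (\<lambda>s. \<Sum>m<n. ((-1) ^ m / fact (2 * m) * z ^ (2 * m)) * (s ^ (2 * m) * (1 - s\<^sup>2) powr a))"
      by (rule arg_cong[where f = "integral {0..1}"])
         (auto simp: fun_eq_iff f_def sum_distrib_left sum_distrib_right power_mult_distrib mult_ac)
    also have "\<dots> = (\<Sum>m<n. ((-1) ^ m / fact (2 * m) * z ^ (2 * m)) * M m)"
      unfolding M_def by (subst integral_sum) (auto intro!: integrable_on_mult_right int)
    also have "\<dots> = (\<Sum>m<n. M 0 * Gamma (\<nu> + 1) * (bessel_coeff \<nu> m * (z\<^sup>2 / 4) ^ m))"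
    proof (rule sum.cong[OF refl])
      fix m
      have "((-1) ^ m / fact (2 * m) * z ^ (2 * m)) * M m = ((-1) ^ m / fact (2 * m) * M m * 4 ^ m) * (z\<^sup>2 / 4) ^ m"
        by (simp add: power_divide power_mult)
      then show "((-1) ^ m / fact (2 * m) * z ^ (2 * m)) * M m = M 0 * Gamma (\<nu> + 1) * (bessel_coeff \<nu> m * (z\<^sup>2 / 4) ^ m)"
        unfolding coeff by simp
    qed
    finally show ?thesis by (simp add: sum_distrib_left)
  qed
  moreover have "(\<lambda>n. M 0 * Gamma (\<nu> + 1) * (\<Sum>m<n. bessel_coeff \<nu> m * (z\<^sup>2 / 4) ^ m))
      \<longlonglongrightarrow> M 0 * Gamma (\<nu> + 1) * bessel_entire \<nu> (z\<^sup>2 / 4)"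
    unfolding bessel_entire_def
    by (intro tendsto_mult tendsto_const summable_LIMSEQ summable_bessel_coeff \<nu>)
  ultimately have "integral {0..1} (\<lambda>s. cos (z * s) * (1 - s\<^sup>2) powr a) = M 0 * Gamma (\<nu> + 1) * bessel_entire \<nu> (z\<^sup>2 / 4)"
    using lim LIMSEQ_unique by simp
  then show ?thesis by (simp add: M_def mult.commute)
qed

text \<open>
Cauchy's theorem on the unit square with corners \<open>0, 1, 1 + \<i>, \<i>\<close>, applied to
\<open>(1 - w\<^sup>2) powr a * exp (\<i> z w)\<close>. On the imaginary axis this function is real and the line element is imaginary, so that the left side
contributes nothing to the real part; on the top side it is exponentially small in \<open>z\<close>. The oscillating
integral on the bottom side thereby becomes an exponentially damped one on the right side.
\<close>

lemma Poisson_integral_rotated: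
  fixes a z :: real
  assumes "a > 0" "z > 0"
  shows "\<exists>T. norm T \<le> 5 powr a * exp (- z) \<and>
     integral {0..1} (\<lambda>s. (1 - s\<^sup>2) powr a * cos (z * s))
     = - Re (\<i> * exp (\<i> * z) * integral {0..1} (\<lambda>y. (of_real (y\<^sup>2) - 2 * \<i> * of_real y) powr of_real a * of_real (exp (- z * y)))) - Re T"
proof -
  define f where "f w = (1 - w\<^sup>2) powr of_real a * exp (\<i> * of_real z * w)" for w :: complex
  define S where "S = cbox 0 (1 + \<i>)"
  have S: "w \<in> S \<longleftrightarrow> 0 \<le> Re w \<and> Re w \<le> 1 \<and> 0 \<le> Im w \<and> Im w \<le> 1" for w
    by (auto simp: S_def in_cbox_complex_iff)
  have Re_1: "Re (1 - w\<^sup>2) = 1 - (Re w)\<^sup>2 + (Im w)\<^sup>2" for w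
    by (simp add: power2_eq_square)
  have cont: "continuous_on S f"
    unfolding f_def
  proof (intro continuous_intros)
    show "S \<subseteq> {z. 0 \<le> Re (1 - z\<^sup>2) \<or> Im (1 - z\<^sup>2) \<noteq> 0}"
      unfolding Re_1 by (auto simp: S) (meson add_increasing2 diff_ge_0_iff_ge power_le_one zero_le_power2)
  qed (use assms in auto)
  have diff: "f field_differentiable at w" if "w \<in> interior S" for w
  proof -
    have "Re (1 - w\<^sup>2) > 0"
    proof -
      have "0 < Im w" "0 < Re w" "Re w < 1"
        using that by (auto simp: S_def interior_cbox in_box_complex_iff)
      then have "(Re w)\<^sup>2 < 1" by (simp add: power_less_one_iff)
      then show ?thesis unfolding Re_1 by (smt (verit) zero_le_power2)
    qed
    then have "1 - w\<^sup>2 \<notin> \<real>\<^sub>\<le>\<^sub>0" by (auto simp: complex_nonpos_Reals_iff)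
    then show ?thesis unfolding f_def field_differentiable_def
      by (intro exI) (rule derivative_eq_intros refl | simp)+
  qed
  have seg: "closed_segment u v \<subseteq> S" if "u \<in> S" "v \<in> S" for u v
    using that by (intro closed_segment_subset) (auto simp: S_def)
  have in_S: "0 \<in> S" "1 \<in> S" "1 + \<i> \<in> S" "\<i> \<in> S" by (auto simp: S)
  have ci: "f contour_integrable_on (linepath u v)" if "u \<in> S" "v \<in> S" for u v
    using seg[OF that] cont by (intro contour_integrable_continuous_linepath) (rule continuous_on_subset)
  have "(f has_contour_integral 0) (linepath 0 1 +++ linepath 1 (1 + \<i>) +++ linepath (1 + \<i>) \<i> +++ linepath \<i> 0)"
  proof (rule Cauchy_theorem_convex[where S = S and K = "{}"])
    show "path_image (linepath 0 1 +++ linepath 1 (1 + \<i>) +++ linepath (1 + \<i>) \<i> +++ linepath \<i> 0) \<subseteq> S"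
      by (simp only: path_image_join path_image_linepath pathfinish_join pathstart_join
          pathfinish_linepath pathstart_linepath Un_least seg in_S)
  qed (use cont diff in \<open>auto simp: S_def\<close>)
  moreover have "(f has_contour_integral (contour_integral (linepath 0 1) f + (contour_integral (linepath 1 (1 + \<i>)) f
      + (contour_integral (linepath (1 + \<i>) \<i>) f + contour_integral (linepath \<i> 0) f))))
      (linepath 0 1 +++ linepath 1 (1 + \<i>) +++ linepath (1 + \<i>) \<i> +++ linepath \<i> 0)"
    by (intro has_contour_integral_join has_contour_integral_integral ci in_S valid_path_join) auto
  ultimately have sum0: "contour_integral (linepath 0 1) f + (contour_integral (linepath 1 (1 + \<i>)) f
      + (contour_integral (linepath (1 + \<i>) \<i>) f + contour_integral (linepath \<i> 0) f)) = 0"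
    using has_contour_integral_unique by blast
  have hi: "((\<lambda>x. f (linepath u v x) * (v - u)) has_integral contour_integral (linepath u v) f) {0..1}"
    if "u \<in> S" "v \<in> S" for u v
    using has_contour_integral_integral[OF ci[OF that]] by (simp add: has_contour_integral_linepath)
  have hiRe: "((\<lambda>x. Re (f (linepath u v x) * (v - u))) has_integral Re (contour_integral (linepath u v) f)) {0..1}"
    if "u \<in> S" "v \<in> S" for u v
    using has_integral_linear[OF hi[OF that] bounded_linear_Re] by (simp add: o_def)
  have bottom: "Re (contour_integral (linepath 0 1) f) = integral {0..1} (\<lambda>s. (1 - s\<^sup>2) powr a * cos (z * s))"
  proof -
    have E: "Re (f (linepath 0 1 x) * (1 - 0)) = (1 - x\<^sup>2) powr a * cos (z * x)" if "x \<in> {0..1}" for x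
    proof -
      have "1 - (complex_of_real x)\<^sup>2 = complex_of_real (1 - x\<^sup>2)" by simp
      moreover have "1 - x\<^sup>2 \<ge> 0" using that by (simp add: power_le_one)
      ultimately have "(1 - (complex_of_real x)\<^sup>2) powr complex_of_real a = complex_of_real ((1 - x\<^sup>2) powr a)"
        by (simp only: powr_of_real)
      moreover have "Re (exp (\<i> * of_real z * of_real x)) = cos (z * x)"
        by (simp add: Re_exp)
      ultimately show ?thesis
        by (simp add: f_def linepath_def scaleR_conv_of_real)
    qed
    have "((\<lambda>s. (1 - s\<^sup>2) powr a * cos (z * s)) has_integral Re (contour_integral (linepath 0 1) f)) {0..1}"
      by (rule has_integral_eq[OF E hiRe[OF in_S(1,2)]])
    then show ?thesis by (simp add: integral_unique)
  qed
  have left: "Re (contour_integral (linepath \<i> 0) f) = 0"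
  proof -
    have "Re (f (linepath \<i> 0 x) * (0 - \<i>)) = 0" for x
    proof -
      have l: "linepath \<i> 0 x = \<i> * of_real (1 - x)"
        by (simp add: linepath_def scaleR_conv_of_real)
      have "1 - (\<i> * of_real (1 - x))\<^sup>2 = complex_of_real (1 + (1 - x)\<^sup>2)"
        by (simp add: power_mult_distrib)
      then have "(1 - (\<i> * of_real (1 - x))\<^sup>2) powr complex_of_real a = complex_of_real ((1 + (1 - x)\<^sup>2) powr a)"
        using powr_of_real[of "1 + (1 - x)\<^sup>2" a] by (simp only: add_nonneg_nonneg zero_le_one zero_le_power2)
      moreover have "exp (\<i> * of_real z * (\<i> * of_real (1 - x))) = complex_of_real (exp (- z * (1 - x)))"
        by (simp add: exp_of_real [symmetric] algebra_simps)
      ultimately have "f (linepath \<i> 0 x) = complex_of_real ((1 + (1 - x)\<^sup>2) powr a * exp (- z * (1 - x)))"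
        unfolding l f_def by simp
      then show ?thesis by simp
    qed
    then show ?thesis using hiRe[OF in_S(4,1)] by (simp add: has_integral_0_eq)
  qed
  have right: "contour_integral (linepath 1 (1 + \<i>)) f = \<i> * exp (\<i> * z) *
      integral {0..1} (\<lambda>y. (of_real (y\<^sup>2) - 2 * \<i> * of_real y) powr of_real a * of_real (exp (- z * y)))"
  proof -
    have "f (linepath 1 (1 + \<i>) y) * (1 + \<i> - 1) =
       \<i> * exp (\<i> * z) * ((of_real (y\<^sup>2) - 2 * \<i> * of_real y) powr of_real a * of_real (exp (- z * y)))" for y
    proof -
      have l: "linepath 1 (1 + \<i>) y = 1 + \<i> * of_real y"
        by (simp add: linepath_def scaleR_conv_of_real algebra_simps)
      have "1 - (1 + \<i> * of_real y)\<^sup>2 = of_real (y\<^sup>2) - 2 * \<i> * of_real y"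
        by (simp add: power2_eq_square algebra_simps)
      moreover have "exp (\<i> * of_real z * (1 + \<i> * of_real y)) = exp (\<i> * z) * of_real (exp (- z * y))"
        by (simp add: exp_of_real [symmetric] exp_add [symmetric] algebra_simps)
      ultimately show ?thesis unfolding l f_def by simp
    qed
    then have "contour_integral (linepath 1 (1 + \<i>)) f = integral {0..1} (\<lambda>y. \<i> * exp (\<i> * z) *
       ((of_real (y\<^sup>2) - 2 * \<i> * of_real y) powr of_real a * of_real (exp (- z * y))))"
      using integral_unique[OF hi[OF in_S(2,3)]] by (simp add: mult_ac)
    then show ?thesis by simp
  qed
  have top: "norm (contour_integral (linepath (1 + \<i>) \<i>) f) \<le> 5 powr a * exp (- z)"
  proof -
    have "norm (f w) \<le> 5 powr a * exp (- z)" if "w \<in> closed_segment (1 + \<i>) \<i>" for w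
    proof -
      have w: "w \<in> S" "Im w = 1"
        using subsetD[OF seg[OF in_S(3,4)] that] that by (simp, auto simp: in_segment)
      have "norm (1 - w\<^sup>2) \<le> 1 + (norm w)\<^sup>2"
        by (metis norm_one norm_power norm_triangle_ineq4)
      also have "(norm w)\<^sup>2 \<le> 1 + 1"
        using w unfolding S cmod_power2 by (intro add_mono) (auto simp: power_le_one)
      finally have "norm (1 - w\<^sup>2) \<le> 5" by simp
      then have "norm (1 - w\<^sup>2) powr a \<le> 5 powr a" using assms by (intro powr_mono2) auto
      moreover have "norm (exp (\<i> * of_real z * w)) = exp (- z)"
        using w by (simp add: norm_exp_eq_Re)
      ultimately show ?thesis
        unfolding f_def norm_mult by (simp only: norm_powr_real_powr'[OF Reals_of_real] Re_complex_of_real) simp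
    qed
    from contour_integral_bound_linepath[OF ci[OF in_S(3,4)] _ this]
    show ?thesis by simp
  qed
  show ?thesis
  proof (intro exI conjI)
    show "norm (contour_integral (linepath (1 + \<i>) \<i>) f) \<le> 5 powr a * exp (- z)" by (rule top)
    have "Re (contour_integral (linepath 0 1) f) + (Re (contour_integral (linepath 1 (1 + \<i>)) f)
      + (Re (contour_integral (linepath (1 + \<i>) \<i>) f) + Re (contour_integral (linepath \<i> 0) f))) = 0"
      using arg_cong[OF sum0, of Re] by simp
    then show "integral {0..1} (\<lambda>s. (1 - s\<^sup>2) powr a * cos (z * s))
     = - Re (\<i> * exp (\<i> * z) * integral {0..1} (\<lambda>y. (of_real (y\<^sup>2) - 2 * \<i> * of_real y) powr of_real a * of_real (exp (- z * y))))
       - Re (contour_integral (linepath (1 + \<i>) \<i>) f)"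
      unfolding left bottom right by linarith
  qed
qed

text \<open>
Watson's lemma in its simplest form: substitute \<open>y = u / z\<close>. The integrand then converges to
\<open>(- 2 \<i> u) powr a * exp (- u)\<close> and is dominated by \<open>(3 u) powr a * exp (- u)\<close>, because \<open>u \<le> z\<close>.
\<close>

lemma rotated_integral_limit:
  fixes a :: real and z :: "nat \<Rightarrow> real"
  assumes "a > 0" "filterlim z at_top sequentially" "\<And>m. z m > 0"
  shows "(\<lambda>m. of_real (z m powr (a + 1)) *
            integral {0..1} (\<lambda>y. (of_real (y\<^sup>2) - 2 * \<i> * of_real y) powr of_real a * of_real (exp (- z m * y))))
          \<longlonglongrightarrow> (- 2 * \<i>) powr of_real a * of_real (Gamma (a + 1))"
proof -
  define g where "g m x = (of_real (x\<^sup>2 / z m) - 2 * \<i> * of_real x) powr of_real a * of_real (exp (- x))"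
    for m :: nat and x :: real
  define h where "h x = 3 powr a * (x powr (a + 1 - 1) / exp x)" for x :: real
  have cont: "continuous_on {0..1} (\<lambda>y. (of_real (y\<^sup>2) - 2 * \<i> * of_real y) powr of_real a * complex_of_real (exp (- z m * y)))" for m
    using assms(1) by (intro continuous_intros) (auto simp: complex_eq_iff)
  have gint: "(g m has_integral of_real (z m powr (a + 1)) *
            integral {0..1} (\<lambda>y. (of_real (y\<^sup>2) - 2 * \<i> * of_real y) powr of_real a * of_real (exp (- z m * y)))) {0..z m}" for m
  proof -
    let ?k = "\<lambda>y. (of_real (y\<^sup>2) - 2 * \<i> * of_real y) powr of_real a * complex_of_real (exp (- z m * y))"
    have z: "z m > 0" by fact
    have "(?k has_integral integral {0..1} ?k) {0..1}"
      using integrable_continuous_interval[OF cont] by (simp add: has_integral_integral)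
    moreover have "(\<lambda>x. x / (1 / z m)) ` {0..1} = {0..z m}"
      using z image_mult_atLeastAtMost[of "z m" 0 1] by (simp add: mult.commute)
    ultimately
    have "((\<lambda>x. ?k (x / z m)) has_integral z m *\<^sub>R integral {0..1} ?k) {0..z m}"
      using has_integral_stretch_real[of ?k "integral {0..1} ?k" 0 1 "1 / z m"] z by simp
    from has_integral_mult_right[OF this, of "of_real (z m powr a)"]
    have "((\<lambda>x. of_real (z m powr a) * ?k (x / z m)) has_integral of_real (z m powr (a + 1)) * integral {0..1} ?k) {0..z m}"
      using z by (simp add: powr_add scaleR_conv_of_real mult_ac)
    moreover have "of_real (z m powr a) * ?k (x / z m) = g m x" for x
    proof -
      have "of_real (x\<^sup>2 / z m) - 2 * \<i> * of_real x
          = complex_of_real (z m) * (of_real ((x / z m)\<^sup>2) - 2 * \<i> * of_real (x / z m))"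
        using z by (simp add: field_simps power2_eq_square)
      moreover have "complex_of_real (z m) powr of_real a = of_real (z m powr a)"
        using z by (simp add: powr_of_real)
      ultimately have "(of_real (x\<^sup>2 / z m) - 2 * \<i> * of_real x) powr of_real a
          = of_real (z m powr a) * (of_real ((x / z m)\<^sup>2) - 2 * \<i> * of_real (x / z m)) powr of_real a"
        using z powr_times_real_left[of "of_real (z m)" "of_real ((x / z m)\<^sup>2) - 2 * \<i> * of_real (x / z m)" "of_real a"]
        by (simp only: Reals_of_real Re_complex_of_real less_imp_le)
      then show ?thesis using z by (simp add: g_def)
    qed
    ultimately show ?thesis by simp
  qed
  define G where "G m x = (if x \<in> {0..z m} then g m x else 0)" for m x
  have Gint: "(G m has_integral of_real (z m powr (a + 1)) *
            integral {0..1} (\<lambda>y. (of_real (y\<^sup>2) - 2 * \<i> * of_real y) powr of_real a * of_real (exp (- z m * y)))) {0..}" for m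
    unfolding G_def [abs_def] using gint[of m] by (subst has_integral_restrict) auto
  have hG: "((\<lambda>t. t powr (a + 1 - 1) / exp t) has_integral Gamma (a + 1)) {0..}"
    using assms(1) by (intro Gamma_integral_real) simp
  have "(\<lambda>m. integral {0..} (G m)) \<longlonglongrightarrow>
      integral {0..} (\<lambda>x. (- 2 * \<i>) powr of_real a * complex_of_real (x powr (a + 1 - 1) / exp x))"
  proof (rule dominated_convergence(2))
    show "G m integrable_on {0..}" for m using Gint by blast
    show "h integrable_on {0..}"
      unfolding h_def using hG by (intro integrable_on_mult_right) blast
    show "norm (G m x) \<le> h x" if "x \<in> {0..}" for m x
    proof (cases "x \<le> z m")
      case True
      have "norm (of_real (x\<^sup>2 / z m) - 2 * \<i> * of_real x) \<le> norm (complex_of_real (x\<^sup>2 / z m)) + norm (2 * \<i> * of_real x)"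
        by (rule norm_triangle_ineq4)
      also have "\<dots> = x\<^sup>2 / z m + 2 * x"
        using that assms(3)[of m] by (simp add: norm_mult norm_divide norm_power)
      also have "x\<^sup>2 / z m \<le> x"
        using True that assms(3)[of m] by (simp add: divide_simps power2_eq_square mult_left_mono)
      finally have "norm (of_real (x\<^sup>2 / z m) - 2 * \<i> * complex_of_real x) \<le> 3 * x" by simp
      then have "norm (of_real (x\<^sup>2 / z m) - 2 * \<i> * complex_of_real x) powr a \<le> (3 * x) powr a"
        using assms(1) by (intro powr_mono2) auto
      also have "\<dots> = 3 powr a * x powr a" using that by (simp add: powr_mult)
      finally have "norm (of_real (x\<^sup>2 / z m) - 2 * \<i> * complex_of_real x) powr a * exp (- x) \<le> 3 powr a * x powr a * exp (- x)"
        by (rule mult_right_mono) simp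
      moreover have "norm (G m x) = norm (of_real (x\<^sup>2 / z m) - 2 * \<i> * complex_of_real x) powr a * exp (- x)"
      proof -
        have "G m x = g m x" using True that by (simp add: G_def)
        then show ?thesis unfolding g_def
          by (simp only: norm_mult norm_powr_real_powr'[OF Reals_of_real] Re_complex_of_real norm_of_real) simp
      qed
      ultimately show ?thesis by (simp add: h_def exp_minus divide_inverse)
    next
      case False
      then show ?thesis by (simp add: G_def h_def)
    qed
    show "(\<lambda>m. G m x) \<longlonglongrightarrow> (- 2 * \<i>) powr of_real a * complex_of_real (x powr (a + 1 - 1) / exp x)"
      if "x \<in> {0..}" for x
    proof -
      have "eventually (\<lambda>m. z m \<ge> x) sequentially"
        using assms(2) by (simp add: filterlim_at_top)
      then have ev: "eventually (\<lambda>m. g m x = G m x) sequentially"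
        by eventually_elim (use that in \<open>auto simp: G_def\<close>)
      have inv: "(\<lambda>m. x\<^sup>2 / z m) \<longlonglongrightarrow> 0"
        by (rule real_tendsto_divide_at_top[OF tendsto_const assms(2)])
      have "(\<lambda>m. g m x) \<longlonglongrightarrow> (of_real 0 - 2 * \<i> * of_real x) powr of_real a * of_real (exp (- x))"
        unfolding g_def
        by (intro tendsto_intros inv) (use that assms(1) in \<open>auto simp: complex_nonpos_Reals_iff\<close>)
      also have "of_real 0 - 2 * \<i> * of_real x = complex_of_real x * (- 2 * \<i>)" by simp
      also have "(complex_of_real x * (- 2 * \<i>)) powr of_real a = of_real (x powr a) * (- 2 * \<i>) powr of_real a"
        using that by (subst powr_times_real_left) (auto simp: powr_of_real)
      finally have "(\<lambda>m. g m x) \<longlonglongrightarrow> (- 2 * \<i>) powr of_real a * complex_of_real (x powr (a + 1 - 1) / exp x)"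
        by (simp add: exp_minus divide_inverse mult_ac)
      then show ?thesis by (rule Lim_transform_eventually[OF _ ev])
    qed
  qed
  moreover have "integral {0..} (\<lambda>x. (- 2 * \<i>) powr of_real a * complex_of_real (x powr (a + 1 - 1) / exp x))
      = (- 2 * \<i>) powr of_real a * of_real (Gamma (a + 1))"
    by (intro integral_unique has_integral_mult_right has_integral_of_real hG)
  ultimately show ?thesis
    using integral_unique[OF Gint] by simp
qed

text \<open>
For fixed order, \<open>J_\<nu> t\<close> behaves like a positive multiple of \<open>sin (t - \<nu> pi/2 + pi/4) / sqrt t\<close>. It is
enough to record the resulting signs at points where that sine equals \<open>(-1) ^ m * sin (\<delta> pi)\<close>:
they determine the phase shift completely.
\<close>

lemma bessel_J_eventual_sign:
  assumes "\<nu> > 1/2" "0 < \<delta>" "\<delta> < 1"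
  shows "eventually (\<lambda>m. (-1) ^ m * bessel_J \<nu> ((real m + \<delta>) * pi + \<nu> * pi / 2 - pi / 4) > 0) sequentially"
proof -
  \<comment> \<open>In terms of \<open>a\<close> the evaluation points are \<open>(m + \<delta>) pi + a pi / 2\<close>; the power \<open>(- 2 \<i>) powr a\<close> in the limit cancels the second summand.\<close>
  define a where "a = \<nu> - 1/2"
  define z where "z m = (real m + \<delta>) * pi + \<nu> * pi / 2 - pi / 4" for m :: nat
  have a: "a > 0" using assms by (simp add: a_def)
  have z_eq: "z m = (real m + \<delta>) * pi + a * pi / 2" for m
    by (simp add: z_def a_def field_simps)
  have zpos: "z m > 0" for m
    unfolding z_eq using a assms by (intro add_nonneg_pos mult_nonneg_nonneg divide_pos_pos mult_pos_pos) auto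
  have ztop: "filterlim z at_top sequentially"
    unfolding z_eq [abs_def] by real_asymp
  define D where "D m = integral {0..1} (\<lambda>y. (of_real (y\<^sup>2) - 2 * \<i> * of_real y) powr of_real a * of_real (exp (- z m * y)))"
    for m :: nat
  have "\<forall>m. \<exists>T. norm T \<le> 5 powr a * exp (- z m) \<and>
      integral {0..1} (\<lambda>s. (1 - s\<^sup>2) powr a * cos (z m * s)) = - Re (\<i> * exp (\<i> * z m) * D m) - Re T"
    unfolding D_def by (intro allI Poisson_integral_rotated[OF a zpos])
  from choice[OF this] obtain T where T: "\<And>m. norm (T m) \<le> 5 powr a * exp (- z m)"
    and I: "\<And>m. integral {0..1} (\<lambda>s. (1 - s\<^sup>2) powr a * cos (z m * s))
      = - Re (\<i> * exp (\<i> * z m) * D m) - Re (T m)"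
    by blast
  define I' where "I' m = integral {0..1} (\<lambda>s. (1 - s\<^sup>2) powr a * cos (z m * s))" for m
  define E where "E = exp (\<i> * (\<delta> * pi + a * pi / 2))"
  have expz: "exp (\<i> * z m) = (-1) ^ m * E" for m
  proof -
    have "\<i> * z m = of_nat m * (\<i> * pi) + \<i> * (\<delta> * pi + a * pi / 2)"
      unfolding z_eq by (simp add: algebra_simps)
    then have "exp (\<i> * z m) = exp (of_nat m * (\<i> * pi)) * E"
      by (simp only: exp_add E_def)
    also have "exp (of_nat m * (\<i> * pi)) = (-1) ^ m"
      by (simp add: exp_of_nat_mult)
    finally show ?thesis .
  qed
  have lim1: "(\<lambda>m. of_real (z m powr (a + 1)) * D m) \<longlonglongrightarrow> (- 2 * \<i>) powr of_real a * of_real (Gamma (a + 1))"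
    unfolding D_def by (rule rotated_integral_limit[OF a ztop zpos])
  have lim2: "(\<lambda>m. (-1) ^ m * (z m powr (a + 1) * Re (T m))) \<longlonglongrightarrow> 0"
  proof (rule Lim_null_comparison)
    have "((\<lambda>x. x powr (a + 1) * (5 powr a * exp (- x))) \<longlongrightarrow> 0) at_top"
      by real_asymp
    from filterlim_compose[OF this ztop]
    show "(\<lambda>m. z m powr (a + 1) * (5 powr a * exp (- z m))) \<longlonglongrightarrow> 0" .
    have "norm ((-1) ^ m * (z m powr (a + 1) * Re (T m))) \<le> z m powr (a + 1) * (5 powr a * exp (- z m))" for m
    proof -
      have "\<bar>Re (T m)\<bar> \<le> 5 powr a * exp (- z m)"
        using abs_Re_le_cmod[of "T m"] T[of m] by linarith
      then show ?thesis
        by (simp add: abs_mult mult_left_mono)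
    qed
    then show "\<forall>\<^sub>F m in sequentially. norm ((-1) ^ m * (z m powr (a + 1) * Re (T m)))
        \<le> z m powr (a + 1) * (5 powr a * exp (- z m))"
      by (intro always_eventually allI)
  qed
  have "(\<lambda>m. - Re (\<i> * E * (of_real (z m powr (a + 1)) * D m)) - (-1) ^ m * (z m powr (a + 1) * Re (T m)))
      \<longlonglongrightarrow> - Re (\<i> * E * ((- 2 * \<i>) powr of_real a * of_real (Gamma (a + 1)))) - 0"
    by (rule tendsto_diff[OF tendsto_minus[OF tendsto_Re[OF tendsto_mult[OF tendsto_const lim1]]] lim2])
  moreover have "- Re (\<i> * E * ((- 2 * \<i>) powr of_real a * of_real (Gamma (a + 1)))) - 0
      = 2 powr a * Gamma (a + 1) * sin (\<delta> * pi)"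
  proof -
    have "(- 2 * \<i>) powr of_real a = complex_of_real (2 powr a) * exp (- \<i> * (a * pi / 2))"
    proof -
      have "(complex_of_real 2 * (- \<i>)) powr of_real a = of_real 2 powr of_real a * (- \<i>) powr of_real a"
        by (rule powr_times_real_left) auto
      moreover have "(- \<i>) powr complex_of_real a = exp (- \<i> * (a * pi / 2))"
        by (simp add: powr_def algebra_simps)
      moreover have "complex_of_real 2 powr of_real a = of_real (2 powr a)"
        by (rule powr_of_real) simp
      ultimately show ?thesis by simp
    qed
    moreover have "E * exp (- \<i> * (a * pi / 2)) = exp (\<i> * (\<delta> * pi))"
      unfolding E_def exp_add [symmetric] by (simp add: algebra_simps)
    ultimately have eq: "\<i> * E * ((- 2 * \<i>) powr of_real a * of_real (Gamma (a + 1)))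
        = of_real (2 powr a * Gamma (a + 1)) * (\<i> * exp (\<i> * (\<delta> * pi)))"
      by (simp add: algebra_simps)
    have "Re (\<i> * exp (\<i> * (\<delta> * pi))) = - sin (\<delta> * pi)"
      using Im_exp[of "\<i> * (\<delta> * pi)"] by simp
    moreover have "Re (of_real r * u) = r * Re u" for r u by simp
    ultimately show ?thesis unfolding eq by (simp only:)
  qed
  moreover have "- Re (\<i> * E * (of_real (z m powr (a + 1)) * D m)) - (-1) ^ m * (z m powr (a + 1) * Re (T m))
      = z m powr (a + 1) * ((-1) ^ m * I' m)" for m
    unfolding I'_def I expz by (cases "even m") (simp_all add: algebra_simps)
  ultimately have "(\<lambda>m. z m powr (a + 1) * ((-1) ^ m * I' m)) \<longlonglongrightarrow> 2 powr a * Gamma (a + 1) * sin (\<delta> * pi)"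
    by simp
  moreover have "2 powr a * Gamma (a + 1) * sin (\<delta> * pi) > 0"
    using a assms by (intro mult_pos_pos Gamma_real_pos sin_gt_zero) auto
  ultimately have "eventually (\<lambda>m. z m powr (a + 1) * ((-1) ^ m * I' m) > 0) sequentially"
    by (rule order_tendstoD)
  then show ?thesis
  proof eventually_elim
    case (elim m)
    define C where "C = integral {0..1} (\<lambda>s::real. (1 - s\<^sup>2) powr a) * Gamma (\<nu> + 1)"
    have "(-1) ^ m * I' m > 0" using elim zpos[of m] by (simp add: zero_less_mult_iff)
    moreover have "I' m = C * bessel_entire \<nu> ((z m)\<^sup>2 / 4)"
      unfolding I'_def C_def using Poisson_integral[OF a, of "z m"] by (simp add: a_def)
    moreover have "C \<ge> 0"
      unfolding C_def using assms a
      by (intro mult_nonneg_nonneg integral_nonneg less_imp_le[OF Gamma_real_pos]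
            integrable_continuous_interval continuous_on_one_minus_square_powr) auto
    ultimately have "(-1) ^ m * bessel_entire \<nu> ((z m)\<^sup>2 / 4) > 0"
      by (auto simp: zero_less_mult_iff mult_less_0_iff)
    moreover have "bessel_J \<nu> (z m) = (z m / 2) powr \<nu> * bessel_entire \<nu> ((z m)\<^sup>2 / 4)"
      using assms zpos by (intro bessel_J_eq) auto
    ultimately show ?case
      unfolding z_def[symmetric] using zpos[of m] by (simp add: zero_less_mult_iff mult_less_0_iff) 
  qed
qed

section \<open>Liouville-Green variables and the Pruefer angle\<close>

text \<open>
The Liouville-Green approximation (prefix \<open>lg\<close>) of \<open>(t d/dt)\<^sup>2 J = - (t\<^sup>2 - \<nu>\<^sup>2) J\<close> beyond the turning point
\<open>t = \<nu>\<close>. The new independent variable is \<open>\<tau> = lg_phase \<nu> t\<close>, the primitive of \<open>lg_momentum \<nu> t / t\<close>,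
and \<open>v = sqrt (lg_momentum \<nu> t) * J\<close> is the new dependent variable. The equation becomes
\<open>v'' + (1 + lg_error) v = 0\<close>, and \<open>lg_error_integral\<close> is the primitive of \<open>lg_error\<close> with respect to \<open>\<tau>\<close>
that vanishes at infinity.
\<close>

definition lg_momentum :: "real \<Rightarrow> real \<Rightarrow> real" where
  "lg_momentum \<nu> t = sqrt (t\<^sup>2 - \<nu>\<^sup>2)"

definition lg_phase :: "real \<Rightarrow> real \<Rightarrow> real" where
  "lg_phase \<nu> t = lg_momentum \<nu> t - \<nu> * arctan (lg_momentum \<nu> t / \<nu>)"

definition lg_error :: "real \<Rightarrow> real \<Rightarrow> real" where
  "lg_error \<nu> t = (let P = lg_momentum \<nu> t in (1 / P ^ 2 + 6 * \<nu> ^ 2 / P ^ 4 + 5 * \<nu> ^ 4 / P ^ 6) / 4)"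

definition lg_error_integral :: "real \<Rightarrow> real \<Rightarrow> real" where
  "lg_error_integral \<nu> t = (let P = lg_momentum \<nu> t in - (1 / (4 * P) + 5 * \<nu> ^ 2 / (12 * P ^ 3)))"

lemma lg_momentum_pos: "0 < \<nu> \<Longrightarrow> \<nu> < t \<Longrightarrow> lg_momentum \<nu> t > 0"
  unfolding lg_momentum_def by (simp add: power_strict_mono)

lemma lg_momentum_sq: "0 < \<nu> \<Longrightarrow> \<nu> < t \<Longrightarrow> t\<^sup>2 = (lg_momentum \<nu> t)\<^sup>2 + \<nu>\<^sup>2"
  unfolding lg_momentum_def by (simp add: power_mono)

lemma DERIV_lg_momentum:
  assumes "0 < \<nu>" "\<nu> < t"
  shows "(lg_momentum \<nu> has_real_derivative t / lg_momentum \<nu> t) (at t)"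
proof -
  have "t\<^sup>2 - \<nu>\<^sup>2 > 0" using assms by (simp add: power_strict_mono)
  then show ?thesis
    unfolding lg_momentum_def [abs_def]
    by (auto intro!: derivative_eq_intros simp: divide_simps)
qed

lemma DERIV_lg_phase:
  assumes "0 < \<nu>" "\<nu> < t"
  shows "(lg_phase \<nu> has_real_derivative lg_momentum \<nu> t / t) (at t)"
proof -
  define P where "P = lg_momentum \<nu> t"
  have P: "P > 0" "t\<^sup>2 = P\<^sup>2 + \<nu>\<^sup>2" "t > 0"
    using assms lg_momentum_pos lg_momentum_sq by (auto simp: P_def)
  have DP: "(lg_momentum \<nu> has_real_derivative t / P) (at t)"
    unfolding P_def by (rule DERIV_lg_momentum[OF assms])
  have "(lg_phase \<nu> has_real_derivative t / P - \<nu> * ((1 / (1 + (P / \<nu>)\<^sup>2)) * (t / P / \<nu>))) (at t)"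
    unfolding lg_phase_def [abs_def]
    using DERIV_diff[OF DP DERIV_cmult[OF DERIV_chain2[OF DERIV_arctan DERIV_cdivide[OF DP, of \<nu>]], of \<nu>]]
    by (simp add: inverse_eq_divide P_def)
  moreover have "t / P - \<nu> * ((1 / (1 + (P / \<nu>)\<^sup>2)) * (t / P / \<nu>)) = P / t"
  proof -
    have "1 + (P / \<nu>)\<^sup>2 = t\<^sup>2 / \<nu>\<^sup>2"
      using assms P(2) by (simp add: power_divide field_simps)
    then have "t / P - \<nu> * ((1 / (1 + (P / \<nu>)\<^sup>2)) * (t / P / \<nu>)) = (t\<^sup>2 - \<nu>\<^sup>2) / (P * t)"
      using assms P(1,3) by (simp add: power2_eq_square field_simps)
    also have "\<dots> = P / t" using P by (simp add: power2_eq_square)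
    finally show ?thesis .
  qed
  ultimately show ?thesis by (simp add: P_def)
qed

lemma lg_error_pos: "0 < \<nu> \<Longrightarrow> \<nu> < t \<Longrightarrow> lg_error \<nu> t > 0"
  using lg_momentum_pos[of \<nu> t]
  by (auto simp: lg_error_def Let_def intro!: add_pos_pos divide_pos_pos)

lemma lg_error_eq:
  assumes "0 < \<nu>" "\<nu> < t"
  shows "lg_error \<nu> t = t\<^sup>2 * ((lg_momentum \<nu> t)\<^sup>2 + 5 * \<nu>\<^sup>2) / (4 * lg_momentum \<nu> t ^ 6)"
proof -
  define P where "P = lg_momentum \<nu> t"
  have P: "P > 0" "t\<^sup>2 = P\<^sup>2 + \<nu>\<^sup>2"
    using assms lg_momentum_pos lg_momentum_sq by (auto simp: P_def)
  have "1 / P ^ 2 + 6 * \<nu> ^ 2 / P ^ 4 + 5 * \<nu> ^ 4 / P ^ 6 = (P ^ 4 + 6 * \<nu> ^ 2 * P ^ 2 + 5 * \<nu> ^ 4) / P ^ 6"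
    using P(1) by (simp add: divide_simps eval_nat_numeral) (simp add: algebra_simps)
  then show ?thesis
    unfolding lg_error_def Let_def P(2) P_def[symmetric]
    by (simp add: algebra_simps eval_nat_numeral)
qed

lemma DERIV_const_over_power:
  fixes c p :: real
  assumes "p \<noteq> 0"
  shows "((\<lambda>p. c / p ^ Suc n) has_real_derivative - (real (Suc n) * c / p ^ (n + 2))) (at p)"
proof -
  have "((\<lambda>p. c / p ^ Suc n) has_real_derivative
      (0 * p ^ Suc n - c * (real (Suc n) * p ^ n)) / (p ^ Suc n * p ^ Suc n)) (at p)"
    using DERIV_divide[OF DERIV_const DERIV_pow[of "Suc n" p], of c] assms by simp
  moreover have "(0 * p ^ Suc n - c * (real (Suc n) * p ^ n)) / (p ^ Suc n * p ^ Suc n)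
      = - (real (Suc n) * c / p ^ (n + 2))"
    using assms by (simp add: field_simps)
  ultimately show ?thesis by simp
qed

lemma DERIV_lg_error_integral:
  assumes "0 < \<nu>" "\<nu> < t"
  shows "(lg_error_integral \<nu> has_real_derivative lg_error \<nu> t * (lg_momentum \<nu> t / t)) (at t)"
proof -
  define P where "P = lg_momentum \<nu> t"
  have P: "P > 0" "t > 0"
    using assms lg_momentum_pos by (auto simp: P_def)
  have "(lg_error_integral \<nu> has_real_derivative (1 / (4 * P ^ 2) + 5 * \<nu> ^ 2 / (4 * P ^ 4)) * (t / P)) (at t)"
  proof -
    have "((\<lambda>p. - (1 / (4 * p) + 5 * \<nu> ^ 2 / (12 * p ^ 3))) has_real_derivative
        1 / (4 * P ^ 2) + 5 * \<nu> ^ 2 / (4 * P ^ 4)) (at P)"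
      using DERIV_minus[OF DERIV_add[OF DERIV_const_over_power[of P "1/4" 0] DERIV_const_over_power[of P "5 * \<nu>\<^sup>2 / 12" 2]]] P
      by (simp add: eval_nat_numeral mult_ac add_ac)
    from DERIV_chain2[OF this[unfolded P_def] DERIV_lg_momentum[OF assms]] show ?thesis
      by (simp only: lg_error_integral_def [abs_def] Let_def P_def)
  qed
  moreover have "(1 / (4 * P ^ 2) + 5 * \<nu> ^ 2 / (4 * P ^ 4)) * (t / P) = lg_error \<nu> t * (P / t)"
    unfolding lg_error_eq[OF assms] P_def[symmetric] using P
    by (simp add: divide_simps) (simp add: eval_nat_numeral algebra_simps)
  ultimately show ?thesis by (simp add: P_def)
qed

lemma DERIV_lg_error:
  assumes "0 < \<nu>" "\<nu> < t"
  shows "\<exists>D. (lg_error \<nu> has_real_derivative D) (at t) \<and> D \<le> 0"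
proof -
  define P where "P = lg_momentum \<nu> t"
  have P: "P > 0" "t > 0"
    using assms lg_momentum_pos by (auto simp: P_def)
  have "(lg_error \<nu> has_real_derivative - (2 / P ^ 3 + 24 * \<nu> ^ 2 / P ^ 5 + 30 * \<nu> ^ 4 / P ^ 7) / 4 * (t / P)) (at t)"
  proof -
    have "((\<lambda>p. (1 / p ^ 2 + 6 * \<nu> ^ 2 / p ^ 4 + 5 * \<nu> ^ 4 / p ^ 6) / 4) has_real_derivative
        - (2 / P ^ 3 + 24 * \<nu> ^ 2 / P ^ 5 + 30 * \<nu> ^ 4 / P ^ 7) / 4) (at P)"
      using DERIV_cdivide[OF DERIV_add[OF DERIV_add[OF DERIV_const_over_power[of P 1 1]
              DERIV_const_over_power[of P "6 * \<nu> ^ 2" 3]] DERIV_const_over_power[of P "5 * \<nu> ^ 4" 5]], of 4] P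
      by (simp add: eval_nat_numeral algebra_simps)
    from DERIV_chain2[OF this[unfolded P_def] DERIV_lg_momentum[OF assms]] show ?thesis
      by (simp only: lg_error_def [abs_def] Let_def P_def)
  qed
  moreover have "- (2 / P ^ 3 + 24 * \<nu> ^ 2 / P ^ 5 + 30 * \<nu> ^ 4 / P ^ 7) / 4 * (t / P) \<le> 0"
  proof -
    have "(2 / P ^ 3 + 24 * \<nu> ^ 2 / P ^ 5 + 30 * \<nu> ^ 4 / P ^ 7) / 4 * (t / P) \<ge> 0"
      using P by (intro mult_nonneg_nonneg divide_nonneg_pos add_nonneg_nonneg) auto
    then show ?thesis
      by (simp only: minus_divide_left [symmetric] mult_minus_left neg_le_0_iff_le)
  qed
  ultimately show ?thesis by blast
qed

lemma lg_limits:
  assumes "0 < \<nu>"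
  shows "((\<lambda>t. lg_phase \<nu> t - t) \<longlongrightarrow> - \<nu> * pi / 2) at_top"
    and "((\<lambda>t. lg_error \<nu> t) \<longlongrightarrow> 0) at_top"
    and "((\<lambda>t. lg_error_integral \<nu> t) \<longlongrightarrow> 0) at_top"
  unfolding lg_phase_def lg_error_def lg_error_integral_def Let_def lg_momentum_def
  using assms by real_asymp+

text \<open>
The primitive \<open>F\<close> of \<open>f' / f\<close> makes \<open>f * exp (- F)\<close> constant. Its imaginary part is a continuous choice of the argument
of \<open>f\<close>, differentiable by construction.
\<close>

lemma continuous_log_along_real_path:
  fixes f f' :: "real \<Rightarrow> complex"
  assumes der: "\<And>t. t \<ge> a \<Longrightarrow> (f has_vector_derivative f' t) (at t)"
    and cont: "continuous_on {a..} f'"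
    and nz: "\<And>t. t \<ge> a \<Longrightarrow> f t \<noteq> 0"
  shows "\<exists>g. \<forall>t>a. f t = exp (g t) \<and> (g has_vector_derivative f' t / f t) (at t)"
proof -
  define F where "F t = integral {a..t} (\<lambda>s. f' s / f s)" for t
  have contf: "continuous_on {a..} f"
    using der by (intro continuous_at_imp_continuous_on ballI) (auto intro: has_vector_derivative_continuous)
  have contq: "continuous_on {a..} (\<lambda>s. f' s / f s)"
    using nz by (intro continuous_on_divide cont contf) auto
  have F: "(F has_vector_derivative f' t / f t) (at t)" if "t > a" for t
  proof -
    have "continuous_on {a..t + 1} (\<lambda>s. f' s / f s)"
      using contq by (rule continuous_on_subset) auto
    from integral_has_vector_derivative[OF this, of t] that
    have "(F has_vector_derivative f' t / f t) (at t within {a..t + 1})"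
      by (auto simp: F_def [abs_def])
    moreover have "at t within {a..t + 1} = at t"
      using that by (intro at_within_interior) auto
    ultimately show ?thesis by simp
  qed
  define H where "H t = f t * exp (- F t)" for t
  have H: "(H has_vector_derivative 0) (at t)" if "t > a" for t
  proof -
    have "((\<lambda>t. exp (- F t)) has_vector_derivative - (f' t / f t) * exp (- F t)) (at t)"
      using field_vector_diff_chain_at[OF has_vector_derivative_minus[OF F[OF that]] DERIV_exp]
      by (simp add: o_def)
    from has_vector_derivative_mult[OF der[of t] this] that
    have "(H has_vector_derivative f t * (- (f' t / f t) * exp (- F t)) + f' t * exp (- F t)) (at t)"
      by (simp add: H_def [abs_def])
    then show ?thesis using nz[of t] that by simp
  qed
  have "H t = H (a + 1)" if "t > a" for t
  proof -
    have "\<exists>c. \<forall>x\<in>{a<..}. H x = c"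
    proof (rule has_derivative_zero_constant)
      show "(H has_derivative (\<lambda>h. 0)) (at x within {a<..})" if "x \<in> {a<..}" for x
        using H[of x] that by (simp add: has_vector_derivative_def has_derivative_at_withinI)
    qed simp
    then show ?thesis using that by force
  qed
  then have fF: "f t = H (a + 1) * exp (F t)" if "t > a" for t
    using that by (simp add: H_def exp_minus field_simps)
  have "H (a + 1) \<noteq> 0" using nz[of "a + 1"] by (simp add: H_def)
  then have "f t = exp (Ln (H (a + 1)) + F t)" if "t > a" for t
    using fF[OF that] by (simp add: exp_add)
  moreover have "((\<lambda>t. Ln (H (a + 1)) + F t) has_vector_derivative f' t / f t) (at t)" if "t > a" for t
    using has_vector_derivative_add[OF has_vector_derivative_const F[OF that]] by simp
  ultimately show ?thesis by (intro exI[of _ "\<lambda>t. Ln (H (a + 1)) + F t"] allI impI conjI)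
qed

text \<open>
The Pruefer angle of \<open>v'' + (1 + \<epsilon>) v = 0\<close>: writing \<open>v = r sin \<Theta>\<close> and \<open>v' = r cos \<Theta>\<close>, where the
prime is the derivative with respect to \<open>\<tau>\<close>, gives \<open>\<Theta>' = 1 + \<epsilon> (sin \<Theta>)\<^sup>2\<close>. Zeros of the Bessel
function are thus the points where the angle is a multiple of \<open>pi\<close>.
\<close>

lemma bessel_J_Pruefer:
  assumes "0 < \<nu>" "\<nu> < a"
  shows "\<exists>\<Theta> r. \<forall>t>a. r t > 0 \<and> bessel_J \<nu> t = r t * sin (\<Theta> t) \<and>
    (\<Theta> has_real_derivative lg_momentum \<nu> t / t * (1 + lg_error \<nu> t * (sin (\<Theta> t))\<^sup>2)) (at t)"
proof -
  \<comment> \<open>All derivatives are computed in terms of \<open>q\<close>, using \<open>t\<^sup>2 = q ^ 4 + \<nu>\<^sup>2\<close>; \<open>w\<close> is the derivative of \<open>v\<close> with respect to \<open>\<tau>\<close>.\<close>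
  define q where "q t = sqrt (lg_momentum \<nu> t)" for t
  define v where "v t = q t * bessel_J \<nu> t" for t
  define w where "w t = bessel_K \<nu> t / q t + t\<^sup>2 * bessel_J \<nu> t / (2 * q t ^ 5)" for t
  define f where "f t = Complex (w t) (v t)" for t
  define f' where "f' t = Complex (lg_momentum \<nu> t / t * (- (1 + lg_error \<nu> t) * v t)) (lg_momentum \<nu> t / t * w t)" for t
  have q: "q t > 0" "(q t)\<^sup>2 = lg_momentum \<nu> t" "t\<^sup>2 = q t ^ 4 + \<nu>\<^sup>2" "t > 0" if "t \<ge> a" for t
  proof -
    have P: "lg_momentum \<nu> t > 0" "t\<^sup>2 = (lg_momentum \<nu> t)\<^sup>2 + \<nu>\<^sup>2"
      using that assms lg_momentum_pos lg_momentum_sq by auto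
    then show "q t > 0" and *: "(q t)\<^sup>2 = lg_momentum \<nu> t" by (auto simp: q_def)
    show "t\<^sup>2 = q t ^ 4 + \<nu>\<^sup>2" unfolding P(2) *[symmetric] by simp
    show "t > 0" using that assms by simp
  qed
  have Dq: "(q has_real_derivative t / (2 * q t ^ 3)) (at t)" if "t \<ge> a" for t
  proof -
    have "(q has_real_derivative (inverse (sqrt (lg_momentum \<nu> t)) / 2) * (t / lg_momentum \<nu> t)) (at t)"
      unfolding q_def [abs_def] using that assms lg_momentum_pos[of \<nu> t]
      by (intro DERIV_chain2[OF DERIV_real_sqrt] DERIV_lg_momentum) auto
    moreover have "(inverse (sqrt (lg_momentum \<nu> t)) / 2) * (t / lg_momentum \<nu> t) = t / (2 * q t ^ 3)"
      unfolding q(2)[OF that, symmetric] using q(1)[OF that]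
      by (simp add: eval_nat_numeral field_simps)
    ultimately show ?thesis by simp
  qed
  have DJ: "(bessel_J \<nu> has_real_derivative bessel_K \<nu> t / t) (at t)"
    "(bessel_K \<nu> has_real_derivative (\<nu>\<^sup>2 - t\<^sup>2) / t * bessel_J \<nu> t) (at t)" if "t \<ge> a" for t
    using that assms by (intro DERIV_bessel_J_K DERIV_bessel_K; simp)+
  have Dv: "(v has_real_derivative lg_momentum \<nu> t / t * w t) (at t)" if "t \<ge> a" for t
  proof -
    have "(v has_real_derivative t / (2 * q t ^ 3) * bessel_J \<nu> t + bessel_K \<nu> t / t * q t) (at t)"
      unfolding v_def [abs_def] by (intro DERIV_mult Dq DJ that)
    moreover have "t / (2 * q t ^ 3) * bessel_J \<nu> t + bessel_K \<nu> t / t * q t = lg_momentum \<nu> t / t * w t"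
      unfolding w_def q(2)[OF that, symmetric] using q(1,4)[OF that]
      by (simp add: field_simps eval_nat_numeral)
    ultimately show ?thesis by simp
  qed
  have Dw: "(w has_real_derivative lg_momentum \<nu> t / t * (- (1 + lg_error \<nu> t) * v t)) (at t)" if "t \<ge> a" for t
  proof -
    define Q where "Q = q t"
    define J where "J = bessel_J \<nu> t"
    define K where "K = bessel_K \<nu> t"
    have Q: "Q > 0" "t > 0" "\<nu>\<^sup>2 = t\<^sup>2 - Q ^ 4" "lg_momentum \<nu> t = Q\<^sup>2" using q[OF that] by (auto simp: Q_def)
    have "(w has_real_derivative
       ((\<nu>\<^sup>2 - t\<^sup>2) / t * J * Q - K * (t / (2 * Q ^ 3))) / (Q * Q)
       + ((2 * t * J + K / t * t\<^sup>2) * (2 * Q ^ 5) - t\<^sup>2 * J * (2 * (5 * Q ^ 4 * (t / (2 * Q ^ 3)))))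
           / ((2 * Q ^ 5) * (2 * Q ^ 5))) (at t)"
      unfolding w_def [abs_def] Q_def J_def K_def
      by (intro DERIV_add DERIV_divide DERIV_mult DERIV_cmult Dq DJ that DERIV_power[THEN DERIV_cong])
         (use q[OF that] in \<open>auto intro!: derivative_eq_intros Dq that\<close>)
    moreover have "((\<nu>\<^sup>2 - t\<^sup>2) / t * J * Q - K * (t / (2 * Q ^ 3))) / (Q * Q)
       + ((2 * t * J + K / t * t\<^sup>2) * (2 * Q ^ 5) - t\<^sup>2 * J * (2 * (5 * Q ^ 4 * (t / (2 * Q ^ 3)))))
           / ((2 * Q ^ 5) * (2 * Q ^ 5)) = Q\<^sup>2 / t * (- (1 + t\<^sup>2 * (Q ^ 4 + 5 * (t\<^sup>2 - Q ^ 4)) / (4 * Q ^ 12)) * (Q * J))"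
    proof -
      have "((\<nu>\<^sup>2 - t\<^sup>2) / t * J * Q - K * (t / (2 * Q ^ 3))) / (Q * Q) = - (Q ^ 3 / t * J) - K * t / (2 * Q ^ 5)"
        unfolding Q(3) using Q(1,2) by (simp add: field_simps eval_nat_numeral)
      moreover have "((2 * t * J + K / t * t\<^sup>2) * (2 * Q ^ 5) - t\<^sup>2 * J * (2 * (5 * Q ^ 4 * (t / (2 * Q ^ 3)))))
           / ((2 * Q ^ 5) * (2 * Q ^ 5)) = t * J / Q ^ 5 + K * t / (2 * Q ^ 5) - 5 * t ^ 3 * J / (4 * Q ^ 9)"
        using Q(1,2) by (simp add: field_simps eval_nat_numeral)
      moreover have "Q\<^sup>2 / t * (- (1 + t\<^sup>2 * (Q ^ 4 + 5 * (t\<^sup>2 - Q ^ 4)) / (4 * Q ^ 12)) * (Q * J))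
          = - (Q ^ 3 / t * J) + t * J / Q ^ 5 - 5 * t ^ 3 * J / (4 * Q ^ 9)"
        using Q(1,2) by (simp add: field_simps eval_nat_numeral)
      ultimately show ?thesis by linarith
    qed
    moreover have "lg_error \<nu> t = t\<^sup>2 * (Q ^ 4 + 5 * (t\<^sup>2 - Q ^ 4)) / (4 * Q ^ 12)"
      using lg_error_eq[of \<nu> t] assms that unfolding Q(4) Q(3)[symmetric] by simp
    ultimately show ?thesis
      unfolding v_def Q(4) J_def[symmetric] Q_def[symmetric] by simp
  qed
  have "\<exists>g. \<forall>t>a. f t = exp (g t) \<and> (g has_vector_derivative f' t / f t) (at t)"
  proof (rule continuous_log_along_real_path)
    show "(f has_vector_derivative f' t) (at t)" if "t \<ge> a" for t
      unfolding f_def [abs_def] f'_def using Dv[OF that] Dw[OF that]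
      by (auto intro!: has_vector_derivative_complex_iff[THEN iffD2] simp: has_vector_derivative_complex_iff has_real_derivative_iff_has_vector_derivative)
    have cont: "continuous_on {a..} v" "continuous_on {a..} w"
      using Dv Dw by (auto intro!: continuous_at_imp_continuous_on DERIV_isCont)
    have cont2: "continuous_on {a..} (lg_momentum \<nu>)" "continuous_on {a..} (lg_error \<nu>)"
    proof -
      have "isCont (lg_momentum \<nu>) x" "isCont (lg_error \<nu>) x" if "x \<ge> a" for x
        using DERIV_isCont[OF DERIV_lg_momentum[of \<nu> x]] DERIV_lg_error[of \<nu> x] that assms
        by (auto dest: DERIV_isCont)
      then show "continuous_on {a..} (lg_momentum \<nu>)" "continuous_on {a..} (lg_error \<nu>)"
        by (auto intro!: continuous_at_imp_continuous_on)
    qed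
    show "continuous_on {a..} f'"
      unfolding f'_def Complex_eq using assms by (intro continuous_intros cont cont2) auto
    show "f t \<noteq> 0" if "t \<ge> a" for t
    proof
      assume "f t = 0"
      then have "v t = 0" "w t = 0" by (auto simp: f_def complex_eq_iff)
      then have "bessel_J \<nu> t = 0" "bessel_K \<nu> t = 0" using q[OF that] by (auto simp: v_def w_def)
      then show False using bessel_J_no_common_zero[of \<nu> t] assms q[OF that] by (simp add: bessel_K_def)
    qed
  qed
  then obtain g where g: "\<And>t. t > a \<Longrightarrow> f t = exp (g t)"
    and Dg: "\<And>t. t > a \<Longrightarrow> (g has_vector_derivative f' t / f t) (at t)" by blast
  define \<Theta> where "\<Theta> t = Im (g t)" for t
  define R where "R t = exp (Re (g t))" for t
  have vw: "v t = R t * sin (\<Theta> t)" "w t = R t * cos (\<Theta> t)" if "t > a" for t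
    using arg_cong[OF g[OF that], of Im] arg_cong[OF g[OF that], of Re]
    by (auto simp: f_def R_def \<Theta>_def Re_exp Im_exp)
  show ?thesis
  proof (rule exI[of _ \<Theta>], rule exI[of _ "\<lambda>t. R t / q t"], intro allI impI conjI)
    fix t assume t: "t > a"
    show "R t / q t > 0" using q[of t] t by (simp add: R_def)
    have "bessel_J \<nu> t = v t / q t" using q[of t] t by (simp add: v_def)
    then show "bessel_J \<nu> t = R t / q t * sin (\<Theta> t)" by (simp add: vw t)
    have "Im (f' t / f t) = lg_momentum \<nu> t / t * ((w t)\<^sup>2 + (1 + lg_error \<nu> t) * (v t)\<^sup>2) / ((w t)\<^sup>2 + (v t)\<^sup>2)"
      unfolding f'_def f_def Im_divide by (simp add: algebra_simps power2_eq_square add_divide_distrib)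
    also have "(w t)\<^sup>2 + (v t)\<^sup>2 = (R t)\<^sup>2"
      unfolding vw[OF t] power_mult_distrib by (simp flip: distrib_left)
    also have "(w t)\<^sup>2 + (1 + lg_error \<nu> t) * (v t)\<^sup>2 = ((w t)\<^sup>2 + (v t)\<^sup>2) + lg_error \<nu> t * (v t)\<^sup>2"
      by (simp add: algebra_simps)
    also have "\<dots> = (R t)\<^sup>2 * (1 + lg_error \<nu> t * (sin (\<Theta> t))\<^sup>2)"
      unfolding \<open>(w t)\<^sup>2 + (v t)\<^sup>2 = (R t)\<^sup>2\<close> unfolding vw[OF t] by (simp add: algebra_simps)
    finally have "Im (f' t / f t) = lg_momentum \<nu> t / t * (1 + lg_error \<nu> t * (sin (\<Theta> t))\<^sup>2)"
      by (simp add: R_def)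
    moreover have "(\<Theta> has_real_derivative Im (f' t / f t)) (at t)"
      using Dg[OF t] unfolding \<Theta>_def [abs_def] has_vector_derivative_complex_iff
      by (simp add: has_real_derivative_iff_has_vector_derivative)
    ultimately show "(\<Theta> has_real_derivative lg_momentum \<nu> t / t * (1 + lg_error \<nu> t * (sin (\<Theta> t))\<^sup>2)) (at t)"
      by simp
  qed
qed

section \<open>The phase and its expansion\<close>

lemma DERIV_Pruefer_minus_lg_phase:
  assumes "0 < \<nu>" "\<nu> < t"
    and "(\<Theta> has_real_derivative lg_momentum \<nu> t / t * (1 + lg_error \<nu> t * (sin (\<Theta> t))\<^sup>2)) (at t)"
  shows "((\<lambda>t. \<Theta> t - lg_phase \<nu> t) has_real_derivative
    lg_momentum \<nu> t / t * (lg_error \<nu> t * (sin (\<Theta> t))\<^sup>2)) (at t)"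
  using DERIV_diff[OF assms(3) DERIV_lg_phase[OF assms(1,2)]] by (simp add: distrib_left)

text \<open>
The difference is nondecreasing, and it becomes nonincreasing when \<open>lg_error_integral\<close> is subtracted,
because \<open>0 \<le> (sin \<Theta>)\<^sup>2 \<le> 1\<close>.
\<close>

lemma Pruefer_phase_limit_exists:
  assumes "0 < \<nu>" "\<nu> < a"
    and der: "\<And>t. t > a \<Longrightarrow> (\<Theta> has_real_derivative lg_momentum \<nu> t / t * (1 + lg_error \<nu> t * (sin (\<Theta> t))\<^sup>2)) (at t)"
  shows "\<exists>L. ((\<lambda>t. \<Theta> t - lg_phase \<nu> t) \<longlongrightarrow> L) at_top"
proof -
  define D where "D t = \<Theta> t - lg_phase \<nu> t" for t
  have P: "lg_momentum \<nu> t / t \<ge> 0" "lg_error \<nu> t \<ge> 0" if "t > a" for t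
    using that assms(1,2) less_imp_le[OF lg_momentum_pos[of \<nu> t]] less_imp_le[OF lg_error_pos[of \<nu> t]] by auto
  have DD: "(D has_real_derivative lg_momentum \<nu> t / t * (lg_error \<nu> t * (sin (\<Theta> t))\<^sup>2)) (at t)" if "t > a" for t
    unfolding D_def [abs_def] using that assms(1,2) der by (intro DERIV_Pruefer_minus_lg_phase) auto
  have mono: "D s \<le> D t" if "a < s" "s \<le> t" for s t
  proof (rule DERIV_nonneg_imp_nondecreasing[OF that(2)])
    fix x assume "s \<le> x" "x \<le> t"
    then have "a < x" using that by simp
    from DD[OF this] P[OF this] show "\<exists>y. (D has_real_derivative y) (at x) \<and> y \<ge> 0"
      by (intro exI conjI) (assumption, intro mult_nonneg_nonneg, auto)
  qed
  have anti: "D t - lg_error_integral \<nu> t \<le> D s - lg_error_integral \<nu> s" if "a < s" "s \<le> t" for s t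
  proof (rule DERIV_nonpos_imp_nonincreasing[OF that(2)])
    fix x assume x: "s \<le> x" "x \<le> t"
    have "((\<lambda>t. D t - lg_error_integral \<nu> t) has_real_derivative lg_momentum \<nu> x / x * (lg_error \<nu> x * (sin (\<Theta> x))\<^sup>2)
       - lg_error \<nu> x * (lg_momentum \<nu> x / x)) (at x)"
      using x that assms(1,2) by (intro DERIV_diff DD DERIV_lg_error_integral) auto
    moreover have "lg_momentum \<nu> x / x * (lg_error \<nu> x * (sin (\<Theta> x))\<^sup>2) - lg_error \<nu> x * (lg_momentum \<nu> x / x)
        = - (lg_momentum \<nu> x / x * lg_error \<nu> x * (1 - (sin (\<Theta> x))\<^sup>2))"
      by (simp add: algebra_simps diff_divide_distrib)
    moreover have "lg_momentum \<nu> x / x * lg_error \<nu> x * (1 - (sin (\<Theta> x))\<^sup>2) \<ge> 0"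
      using P[of x] x that by (intro mult_nonneg_nonneg) (auto simp: abs_square_le_1)
    ultimately show "\<exists>y. ((\<lambda>t. D t - lg_error_integral \<nu> t) has_real_derivative y) (at x) \<and> y \<le> 0"
      by force
  qed
  have neg: "lg_error_integral \<nu> t \<le> 0" if "t > a" for t
  proof -
    have "lg_momentum \<nu> t > 0" using that assms(1,2) by (intro lg_momentum_pos) auto
    then have "1 / (4 * lg_momentum \<nu> t) + 5 * \<nu>\<^sup>2 / (12 * lg_momentum \<nu> t ^ 3) \<ge> 0"
      by (intro add_nonneg_nonneg divide_nonneg_pos) auto
    then show ?thesis by (simp only: lg_error_integral_def Let_def neg_le_0_iff_le)
  qed
  define B where "B = D (a + 1) - lg_error_integral \<nu> (a + 1)"
  have le: "D t \<le> B" if "t \<ge> a + 1" for t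
    using anti[of "a + 1" t] neg[of t] that by (simp add: B_def)
  have bdd: "bdd_above (D ` {a + 1..})" using le by (auto intro!: bdd_aboveI)
  have "(D \<longlongrightarrow> (SUP t\<in>{a + 1..}. D t)) at_top"
  proof (rule increasing_tendsto)
    show "\<forall>\<^sub>F t in at_top. D t \<le> (SUP t\<in>{a + 1..}. D t)"
      using eventually_ge_at_top[of "a + 1"] by eventually_elim (auto intro: cSUP_upper bdd)
    fix x assume "x < (SUP t\<in>{a + 1..}. D t)"
    then obtain s where s: "s \<ge> a + 1" "x < D s"
      using less_cSUP_iff[OF _ bdd] by auto
    show "\<forall>\<^sub>F t in at_top. x < D t"
      using eventually_ge_at_top[of s]
    proof eventually_elim
      case (elim t)
      then show ?case using mono[of s t] s by simp
    qed
  qed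
  then show ?thesis by (auto simp: D_def [abs_def])
qed

text \<open>
The Pruefer angle is determined up to multiples of \<open>2 pi\<close>. The limit in the last clause selects the one
branch for which, as shown below, the zero with angle \<open>k pi\<close> is the zero number \<open>k\<close>.
\<close>

definition bessel_phase :: "real \<Rightarrow> real \<Rightarrow> (real \<Rightarrow> real) \<Rightarrow> bool" where
  "bessel_phase \<nu> a \<Theta> \<longleftrightarrow> 0 < \<nu> \<and> \<nu> < a \<and>
     (\<forall>t>a. bessel_J \<nu> t = 0 \<longleftrightarrow> sin (\<Theta> t) = 0) \<and>
     (\<forall>t>a. (\<Theta> has_real_derivative lg_momentum \<nu> t / t * (1 + lg_error \<nu> t * (sin (\<Theta> t))\<^sup>2)) (at t)) \<and>
     ((\<lambda>t. \<Theta> t - lg_phase \<nu> t) \<longlongrightarrow> pi / 4) at_top"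

lemma sin_nonneg_half_period_imp_multiple:
  fixes c :: real
  assumes "\<And>\<delta>. 0 < \<delta> \<Longrightarrow> \<delta> < 1 \<Longrightarrow> sin (\<delta> * pi + c) \<ge> 0"
  shows "\<exists>n::int. c = of_int n * (2 * pi)"
proof -
  have *: "sin (x * pi + c) \<ge> 0" if "x \<in> {0..1}" for x
  proof (rule continuous_ge_on_closure[of "{0<..<1}" "\<lambda>x. sin (x * pi + c)"])
    show "continuous_on (closure {0<..<1}) (\<lambda>x. sin (x * pi + c))"
      by (intro continuous_intros)
  qed (use that assms in auto)
  have "sin c = 0" using *[of 0] *[of 1] by (simp add: sin_add)
  moreover have "cos c \<ge> 0" using *[of "1/2"] by (simp add: sin_add)
  ultimately have "cos c = 1"
    using sin_cos_squared_add[of c] by (simp add: power2_eq_1_iff)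
  then show ?thesis by (auto simp: cos_one_2pi_int mult_ac)
qed

text \<open>
The limit of the angle minus \<open>lg_phase\<close> is congruent to \<open>pi/4\<close> modulo \<open>2 pi\<close>, since otherwise the
signs of \<open>sin \<Theta>\<close> would contradict the known signs of the Bessel function at large arguments.
\<close>

lemma bessel_phase_exists:
  assumes "1/2 < \<nu>" "\<nu> < a"
  shows "\<exists>\<Theta>. bessel_phase \<nu> a \<Theta>"
proof -
  have \<nu>: "0 < \<nu>" using assms by simp
  obtain \<Theta> r where r: "\<And>t. t > a \<Longrightarrow> r t > 0" "\<And>t. t > a \<Longrightarrow> bessel_J \<nu> t = r t * sin (\<Theta> t)"
    and D: "\<And>t. t > a \<Longrightarrow> (\<Theta> has_real_derivative lg_momentum \<nu> t / t * (1 + lg_error \<nu> t * (sin (\<Theta> t))\<^sup>2)) (at t)"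
    using bessel_J_Pruefer[OF \<nu> assms(2)] by blast
  obtain L where L: "((\<lambda>t. \<Theta> t - lg_phase \<nu> t) \<longlongrightarrow> L) at_top"
    using Pruefer_phase_limit_exists[OF \<nu> assms(2) D] by blast
  have L2: "((\<lambda>t. \<Theta> t - t) \<longlongrightarrow> L - \<nu> * pi / 2) at_top"
    using tendsto_add[OF L lg_limits(1)[OF \<nu>]] by simp
  have "\<exists>n::int. L - pi / 4 = of_int n * (2 * pi)"
  proof (rule sin_nonneg_half_period_imp_multiple)
    fix \<delta> :: real assume \<delta>: "0 < \<delta>" "\<delta> < 1"
    define z where "z m = (real m + \<delta>) * pi + \<nu> * pi / 2 - pi / 4" for m :: nat
    have ztop: "filterlim z at_top sequentially"
      unfolding z_def [abs_def] by real_asymp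
    have "(\<lambda>m. \<Theta> (z m) - z m) \<longlonglongrightarrow> L - \<nu> * pi / 2"
      by (rule filterlim_compose[OF L2 ztop])
    from tendsto_add[OF this tendsto_const[of "\<delta> * pi + \<nu> * pi / 2 - pi / 4"]]
    have "(\<lambda>m. \<Theta> (z m) - real m * pi) \<longlonglongrightarrow> \<delta> * pi + (L - pi / 4)"
      by (simp add: z_def algebra_simps)
    then have lim: "(\<lambda>m. sin (\<Theta> (z m) - real m * pi)) \<longlonglongrightarrow> sin (\<delta> * pi + (L - pi / 4))"
      by (intro tendsto_sin)
    have "eventually (\<lambda>m. (-1) ^ m * bessel_J \<nu> (z m) > 0) sequentially"
      unfolding z_def by (rule bessel_J_eventual_sign) (use assms \<delta> in auto)
    moreover have "eventually (\<lambda>m. z m > a) sequentially"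
      using ztop by (simp add: filterlim_at_top_dense)
    ultimately have "eventually (\<lambda>m. sin (\<Theta> (z m) - real m * pi) \<ge> 0) sequentially"
    proof eventually_elim
      case (elim m)
      have "(-1) ^ m * sin (\<Theta> (z m)) > 0"
        using elim(1) r[OF elim(2)] by (simp add: zero_less_mult_iff mult_less_0_iff)
      moreover have "sin (\<Theta> (z m) - real m * pi) = (-1) ^ m * sin (\<Theta> (z m))"
        by (simp add: sin_diff mult.commute[of _ pi])
      ultimately show ?case by simp
    qed
    then show "sin (\<delta> * pi + (L - pi / 4)) \<ge> 0"
      by (rule tendsto_lowerbound[OF lim]) simp
  qed
  then obtain n :: int where "L - pi / 4 = of_int n * (2 * pi)" by blast
  then have n: "L = pi / 4 + of_int n * (2 * pi)" by simp
  define \<Theta>' where "\<Theta>' t = \<Theta> t - of_int n * (2 * pi)" for t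
  have s: "sin (\<Theta>' t) = sin (\<Theta> t)" for t
    unfolding \<Theta>'_def using cos_int_2pin[of n] sin_int_2pin[of n] by (simp add: sin_diff mult_ac)
  have "bessel_phase \<nu> a \<Theta>'"
    unfolding bessel_phase_def s
  proof (intro conjI allI impI)
    show "bessel_J \<nu> t = 0 \<longleftrightarrow> sin (\<Theta> t) = 0" if "t > a" for t
      using r[OF that] by auto
    show "(\<Theta>' has_real_derivative lg_momentum \<nu> t / t * (1 + lg_error \<nu> t * (sin (\<Theta> t))\<^sup>2)) (at t)" if "t > a" for t
      unfolding \<Theta>'_def [abs_def] using DERIV_diff[OF D[OF that] DERIV_const] by simp
    show "((\<lambda>t. \<Theta>' t - lg_phase \<nu> t) \<longlongrightarrow> pi / 4) at_top"
      using tendsto_diff[OF L tendsto_const[of "of_int n * (2 * pi)"]] by (simp add: \<Theta>'_def n algebra_simps)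
  qed (use \<nu> assms in auto)
  then show ?thesis by blast
qed

context
  fixes \<nu> a :: real and \<Theta> :: "real \<Rightarrow> real"
  assumes phase: "bessel_phase \<nu> a \<Theta>"
begin

lemma bessel_phase_order: "0 < \<nu>" "\<nu> < a"
  and bessel_phase_zero_iff: "t > a \<Longrightarrow> bessel_J \<nu> t = 0 \<longleftrightarrow> sin (\<Theta> t) = 0"
  and DERIV_bessel_phase: "t > a \<Longrightarrow>
    (\<Theta> has_real_derivative lg_momentum \<nu> t / t * (1 + lg_error \<nu> t * (sin (\<Theta> t))\<^sup>2)) (at t)"
  and bessel_phase_tendsto: "((\<lambda>t. \<Theta> t - lg_phase \<nu> t) \<longlongrightarrow> pi / 4) at_top"
  using phase by (auto simp: bessel_phase_def)

lemma bessel_phase_tendsto': "((\<lambda>t. \<Theta> t - t) \<longlongrightarrow> pi / 4 - \<nu> * pi / 2) at_top"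
  using tendsto_add[OF bessel_phase_tendsto lg_limits(1)[OF bessel_phase_order(1)]] by simp

lemma bessel_phase_at_top: "filterlim \<Theta> at_top at_top"
proof -
  have "filterlim (\<lambda>t. (\<Theta> t - t) + t) at_top at_top"
    by (rule filterlim_tendsto_add_at_top[OF bessel_phase_tendsto' filterlim_ident])
  then show ?thesis by simp
qed

lemma bessel_phase_strict_mono:
  assumes "a < s" "s < t"
  shows "\<Theta> s < \<Theta> t"
proof (rule DERIV_pos_imp_increasing[OF assms(2)])
  fix x assume "s \<le> x" "x \<le> t"
  then have x: "a < x" "\<nu> < x" "0 < x" using assms bessel_phase_order by auto
  have "lg_momentum \<nu> x / x * (1 + lg_error \<nu> x * (sin (\<Theta> x))\<^sup>2) > 0"
    using x bessel_phase_order lg_momentum_pos[of \<nu> x] lg_error_pos[of \<nu> x]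
    by (intro mult_pos_pos divide_pos_pos add_pos_nonneg mult_nonneg_nonneg) auto
  then show "\<exists>y. (\<Theta> has_real_derivative y) (at x) \<and> y > 0"
    using DERIV_bessel_phase[OF x(1)] by blast
qed

lemma isCont_bessel_phase: "t > a \<Longrightarrow> isCont \<Theta> t"
  using DERIV_bessel_phase by (rule DERIV_isCont)

text \<open>
Since \<open>(sin \<Theta>)\<^sup>2\<close> has mean \<open>1/2\<close>, the angle exceeds \<open>lg_phase + pi/4\<close> by half of
\<open>lg_error_integral\<close> in first approximation. The oscillating remainder is removed by the summand
\<open>lg_error * sin (2 \<Theta>) / 4\<close>, whose derivative cancels it up to the terms \<open>lg_error\<^sup>2\<close> and
\<open>lg_error'\<close>; as \<open>lg_error\<close> is decreasing, these integrate to the stated bound. At \<open>t = \<nu> z\<close> with fixed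
\<open>z > 1\<close> this bound is of order \<open>1 / \<nu>\<^sup>2\<close>.
\<close>

lemma bessel_phase_expansion:
  assumes "t0 > a"
  shows "\<bar>\<Theta> t0 + lg_error \<nu> t0 * sin (2 * \<Theta> t0) / 4 - lg_phase \<nu> t0 - lg_error_integral \<nu> t0 / 2 - pi / 4\<bar>
     \<le> lg_error \<nu> t0 / 4 - lg_error \<nu> t0 * lg_error_integral \<nu> t0 / 2"
proof -
  \<comment> \<open>\<open>X\<close> tends to \<open>pi/4\<close>, \<open>Z\<close> tends to \<open>0\<close>, and \<open>Z\<close> is a primitive of an upper bound for the absolute derivative of \<open>X\<close> on \<open>[t0, \<infinity>)\<close>.\<close>
  define X where "X t = \<Theta> t + lg_error \<nu> t * sin (2 * \<Theta> t) / 4 - lg_phase \<nu> t - lg_error_integral \<nu> t / 2" for t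
  define Z where "Z t = lg_error \<nu> t0 * lg_error_integral \<nu> t / 2 - lg_error \<nu> t / 4" for t
  have der: "\<exists>x z. (X has_real_derivative x) (at t) \<and> (Z has_real_derivative z) (at t) \<and> \<bar>x\<bar> \<le> z"
    if "t \<ge> t0" for t
  proof -
    have t: "a < t" "\<nu> < t" "0 < t" using that assms bessel_phase_order by auto
    note \<nu> = bessel_phase_order(1)
    define p where "p = lg_momentum \<nu> t / t"
    define e where "e = lg_error \<nu> t"
    define s where "s = sin (\<Theta> t)"
    obtain e' where e': "(lg_error \<nu> has_real_derivative e') (at t)" "e' \<le> 0"
      using DERIV_lg_error[OF \<nu> t(2)] by blast
    have e0: "e \<le> lg_error \<nu> t0"
      unfolding e_def
    proof (rule DERIV_nonpos_imp_nonincreasing[OF that])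
      fix x assume "t0 \<le> x" "x \<le> t"
      then show "\<exists>y. (lg_error \<nu> has_real_derivative y) (at x) \<and> y \<le> 0"
        using assms bessel_phase_order by (intro DERIV_lg_error) auto
    qed
    have pos: "p \<ge> 0" "e \<ge> 0"
      using less_imp_le[OF lg_momentum_pos[OF \<nu> t(2)]] less_imp_le[OF lg_error_pos[OF \<nu> t(2)]] t
      by (auto simp: p_def e_def)
    have DT: "(\<Theta> has_real_derivative p * (1 + e * s\<^sup>2)) (at t)"
      unfolding p_def e_def s_def by (rule DERIV_bessel_phase[OF t(1)])
    have DS: "((\<lambda>t. sin (2 * \<Theta> t)) has_real_derivative cos (2 * \<Theta> t) * (2 * (p * (1 + e * s\<^sup>2)))) (at t)"
      by (rule DERIV_chain2[OF DERIV_sin DERIV_cmult[OF DT]])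
    have DP: "(lg_phase \<nu> has_real_derivative p) (at t)"
      unfolding p_def by (rule DERIV_lg_phase[OF \<nu> t(2)])
    have DG: "(lg_error_integral \<nu> has_real_derivative e * p) (at t)"
      unfolding p_def e_def by (rule DERIV_lg_error_integral[OF \<nu> t(2)])
    have "(X has_real_derivative p * (1 + e * s\<^sup>2)
        + (e' * sin (2 * \<Theta> t) + cos (2 * \<Theta> t) * (2 * (p * (1 + e * s\<^sup>2))) * lg_error \<nu> t) / 4 - p - e * p / 2) (at t)"
      unfolding X_def [abs_def]
      by (intro DERIV_add DERIV_diff DERIV_cdivide DERIV_mult DT DS DP DG e')
    moreover have "p * (1 + e * s\<^sup>2)
        + (e' * sin (2 * \<Theta> t) + cos (2 * \<Theta> t) * (2 * (p * (1 + e * s\<^sup>2))) * lg_error \<nu> t) / 4 - p - e * p / 2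
        = e' / 4 * sin (2 * \<Theta> t) + e * e * p / 2 * (cos (2 * \<Theta> t) * s\<^sup>2)"
    proof -
      have c: "cos (2 * \<Theta> t) = 1 - 2 * s\<^sup>2"
        unfolding s_def by (simp add: cos_double_sin)
      show ?thesis unfolding e_def[symmetric] c by (simp add: field_simps power2_eq_square)
    qed
    ultimately have DX: "(X has_real_derivative e' / 4 * sin (2 * \<Theta> t) + e * e * p / 2 * (cos (2 * \<Theta> t) * s\<^sup>2)) (at t)"
      by simp
    have DZ: "(Z has_real_derivative lg_error \<nu> t0 * (e * p) / 2 - e' / 4) (at t)"
      unfolding Z_def [abs_def] by (intro DERIV_diff DERIV_cdivide DERIV_cmult DG e')
    have "\<bar>e' / 4 * sin (2 * \<Theta> t) + e * e * p / 2 * (cos (2 * \<Theta> t) * s\<^sup>2)\<bar>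
        \<le> \<bar>e' / 4\<bar> * \<bar>sin (2 * \<Theta> t)\<bar> + \<bar>e * e * p / 2\<bar> * \<bar>cos (2 * \<Theta> t) * s\<^sup>2\<bar>"
      unfolding abs_mult[symmetric] by (rule abs_triangle_ineq)
    also have "\<dots> \<le> \<bar>e' / 4\<bar> * 1 + \<bar>e * e * p / 2\<bar> * 1"
    proof (intro add_mono mult_left_mono)
      have "\<bar>cos (2 * \<Theta> t)\<bar> * \<bar>s\<^sup>2\<bar> \<le> 1 * 1"
        by (intro mult_mono) (auto simp: s_def abs_square_le_1)
      then show "\<bar>cos (2 * \<Theta> t) * s\<^sup>2\<bar> \<le> 1" by (simp add: abs_mult)
    qed auto
    also have "\<dots> \<le> lg_error \<nu> t0 * (e * p) / 2 - e' / 4"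
    proof -
      have "e * (e * p) \<le> lg_error \<nu> t0 * (e * p)"
        using e0 pos by (intro mult_right_mono) auto
      moreover have "e * (e * p) \<ge> 0" using pos by simp
      ultimately show ?thesis using e'(2) by (simp add: mult.assoc)
    qed
    finally show ?thesis using DX DZ by blast
  qed
  have limX: "(X \<longlongrightarrow> pi / 4) at_top"
  proof -
    have "((\<lambda>t. lg_error \<nu> t * sin (2 * \<Theta> t)) \<longlongrightarrow> 0) at_top"
    proof (rule Lim_null_comparison)
      show "((\<lambda>t. \<bar>lg_error \<nu> t\<bar>) \<longlongrightarrow> 0) at_top"
        using tendsto_rabs[OF lg_limits(2)[OF bessel_phase_order(1)]] by simp
      show "\<forall>\<^sub>F t in at_top. norm (lg_error \<nu> t * sin (2 * \<Theta> t)) \<le> \<bar>lg_error \<nu> t\<bar>"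
        by (intro always_eventually allI) (simp add: abs_mult mult_left_le)
    qed
    from tendsto_diff[OF tendsto_add[OF bessel_phase_tendsto tendsto_divide[OF this tendsto_const[of 4]]]
        tendsto_divide[OF lg_limits(3)[OF bessel_phase_order(1)] tendsto_const[of 2]]]
    show ?thesis by (simp add: X_def [abs_def] algebra_simps)
  qed
  have limZ: "(Z \<longlongrightarrow> 0) at_top"
    using tendsto_diff[OF tendsto_mult[OF tendsto_const[of "lg_error \<nu> t0 / 2"] lg_limits(3)[OF bessel_phase_order(1)]]
        tendsto_divide[OF lg_limits(2)[OF bessel_phase_order(1)] tendsto_const[of 4]]]
    by (simp add: Z_def [abs_def])
  have up: "X t0 + Z t0 \<le> X t + Z t" if "t \<ge> t0" for t
  proof (rule DERIV_nonneg_imp_nondecreasing[OF that])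
    fix x assume "t0 \<le> x" "x \<le> t"
    from der[OF this(1)] obtain d z where "(X has_real_derivative d) (at x)" "(Z has_real_derivative z) (at x)" "\<bar>d\<bar> \<le> z"
      by blast
    then show "\<exists>y. ((\<lambda>t. X t + Z t) has_real_derivative y) (at x) \<and> y \<ge> 0"
      by (intro exI[of _ "d + z"]) (auto intro!: DERIV_add)
  qed
  have down: "X t - Z t \<le> X t0 - Z t0" if "t \<ge> t0" for t
  proof (rule DERIV_nonpos_imp_nonincreasing[OF that])
    fix x assume "t0 \<le> x" "x \<le> t"
    from der[OF this(1)] obtain d z where "(X has_real_derivative d) (at x)" "(Z has_real_derivative z) (at x)" "\<bar>d\<bar> \<le> z"
      by blast
    then show "\<exists>y. ((\<lambda>t. X t - Z t) has_real_derivative y) (at x) \<and> y \<le> 0"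
      by (intro exI[of _ "d - z"]) (auto intro!: DERIV_diff)
  qed
  have "X t0 + Z t0 \<le> pi / 4 + 0"
    using up by (intro tendsto_lowerbound[OF tendsto_add[OF limX limZ]])
                (auto intro: eventually_mono[OF eventually_ge_at_top[of t0]])
  moreover have "pi / 4 - 0 \<le> X t0 - Z t0"
    using down by (intro tendsto_upperbound[OF tendsto_diff[OF limX limZ]])
                (auto intro: eventually_mono[OF eventually_ge_at_top[of t0]])
  ultimately have "\<bar>X t0 - pi / 4\<bar> \<le> - Z t0" by linarith
  then show ?thesis by (simp add: X_def Z_def)
qed

text \<open>
The angle increases strictly, so that each multiple of \<open>pi\<close> between its two values is taken exactly once.
\<close>

lemma card_bessel_zeros_increment:
  assumes "a < s" "s \<le> t"
  shows "int (card (bessel_zeros \<nu> t)) = int (card (bessel_zeros \<nu> s)) + (\<lfloor>\<Theta> t / pi\<rfloor> - \<lfloor>\<Theta> s / pi\<rfloor>)"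
proof -
  define Z where "Z = {y. s < y \<and> y \<le> t \<and> bessel_J \<nu> y = 0}"
  have s0: "s > 0" using assms bessel_phase_order by simp
  have split: "bessel_zeros \<nu> t = bessel_zeros \<nu> s \<union> Z" "bessel_zeros \<nu> s \<inter> Z = {}"
    using assms s0 by (auto simp: bessel_zeros_def Z_def)
  have fin: "finite (bessel_zeros \<nu> t)"
    using bessel_phase_order by (intro finite_bessel_zeros) auto
  have "bij_betw (\<lambda>y. \<lfloor>\<Theta> y / pi\<rfloor>) Z {\<lfloor>\<Theta> s / pi\<rfloor><..\<lfloor>\<Theta> t / pi\<rfloor>}"
  proof (rule bij_betwI')
    have int: "\<Theta> y / pi = of_int \<lfloor>\<Theta> y / pi\<rfloor>" if "y \<in> Z" for y
    proof -
      have "sin (\<Theta> y) = 0" using that bessel_phase_zero_iff[of y] assms by (auto simp: Z_def)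
      then obtain i :: int where "\<Theta> y = of_int i * pi" by (auto simp: sin_zero_iff_int2)
      then show ?thesis by simp
    qed
    have mono: "\<Theta> y / pi < \<Theta> y' / pi" if "a < y" "y < y'" for y y'
      using bessel_phase_strict_mono[OF that] by (simp add: divide_strict_right_mono)
    show "(\<lfloor>\<Theta> x / pi\<rfloor> = \<lfloor>\<Theta> y / pi\<rfloor>) = (x = y)" if "x \<in> Z" "y \<in> Z" for x y
    proof
      assume "\<lfloor>\<Theta> x / pi\<rfloor> = \<lfloor>\<Theta> y / pi\<rfloor>"
      then have "\<Theta> x / pi = \<Theta> y / pi" using int[OF that(1)] int[OF that(2)] by simp
      then show "x = y" using mono[of x y] mono[of y x] that assms
        by (cases x y rule: linorder_cases) (auto simp: Z_def)
    qed simp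
    show "\<lfloor>\<Theta> x / pi\<rfloor> \<in> {\<lfloor>\<Theta> s / pi\<rfloor><..\<lfloor>\<Theta> t / pi\<rfloor>}" if "x \<in> Z" for x
    proof -
      have x: "s < x" "x \<le> t" using that by (auto simp: Z_def)
      have "\<Theta> s / pi < of_int \<lfloor>\<Theta> x / pi\<rfloor>" using mono[of s x] int[OF that] x assms by simp
      moreover have "\<Theta> x / pi \<le> \<Theta> t / pi" using mono[of x t] x assms by (cases "x = t") auto
      ultimately show ?thesis by (auto simp: floor_less_iff intro: floor_mono)
    qed
    show "\<exists>x\<in>Z. i = \<lfloor>\<Theta> x / pi\<rfloor>" if "i \<in> {\<lfloor>\<Theta> s / pi\<rfloor><..\<lfloor>\<Theta> t / pi\<rfloor>}" for i
    proof -
      have i: "\<Theta> s < of_int i * pi" "of_int i * pi \<le> \<Theta> t"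
        using that by (auto simp: floor_less_iff le_floor_iff divide_simps)
      have "\<exists>x. s \<le> x \<and> x \<le> t \<and> \<Theta> x = of_int i * pi"
        using i assms isCont_bessel_phase by (intro IVT) auto
      then obtain x where x: "s \<le> x" "x \<le> t" "\<Theta> x = of_int i * pi" by blast
      have "x \<noteq> s" using x(3) i by auto
      then have "x \<in> Z"
        using x assms bessel_phase_zero_iff[of x] by (auto simp: Z_def sin_zero_iff_int2)
      then show ?thesis using x by (intro bexI[of _ x]) auto
    qed
  qed
  then have "card Z = card {\<lfloor>\<Theta> s / pi\<rfloor><..\<lfloor>\<Theta> t / pi\<rfloor>}" by (rule bij_betw_same_card)
  moreover have "\<Theta> s / pi \<le> \<Theta> t / pi"
    using bessel_phase_strict_mono[of s t] assms by (cases "s = t") (auto simp: divide_right_mono)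
  then have "\<lfloor>\<Theta> s / pi\<rfloor> \<le> \<lfloor>\<Theta> t / pi\<rfloor>" by (rule floor_mono)
  ultimately have "int (card Z) = \<lfloor>\<Theta> t / pi\<rfloor> - \<lfloor>\<Theta> s / pi\<rfloor>" by simp
  moreover have "card (bessel_zeros \<nu> t) = card (bessel_zeros \<nu> s) + card Z"
    using fin unfolding split(1) by (intro card_Un_disjoint split(2)) auto
  ultimately show ?thesis by simp
qed

end

section \<open>Numbering the zeros by the phase\<close>

text \<open>
The points in question are those where the angle is close to \<open>(m + \<delta>) pi\<close>; if zeros are numbered by
their angle, then there are \<open>m\<close> zeros up to there. The offset \<open>c\<close> is the error of this numbering.
\<close>

definition zero_offset :: "real \<Rightarrow> int \<Rightarrow> bool" where
  "zero_offset \<nu> c \<longleftrightarrow> (\<forall>\<delta>. 0 < \<delta> \<longrightarrow> \<delta> < 1 \<longrightarrow>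
     eventually (\<lambda>m. int (card (bessel_zeros \<nu> ((real m + \<delta>) * pi + \<nu> * pi / 2 - pi / 4))) = int m + c) sequentially)"

lemma zero_offsetD:
  assumes "zero_offset \<nu> c" "0 < \<delta>" "\<delta> < 1"
  shows "eventually (\<lambda>m. int (card (bessel_zeros \<nu> ((real m + \<delta>) * pi + \<nu> * pi / 2 - pi / 4))) = int m + c) sequentially"
  using assms unfolding zero_offset_def by blast

lemma zero_offset_half: "zero_offset (1/2) 0"
  unfolding zero_offset_def
  by (auto simp: card_bessel_zeros_half intro!: always_eventually)

text \<open>
The number of zeros up to \<open>t\<close> and the integer part of \<open>\<Theta> t / pi\<close> jump together, hence they differ by a constant;
at the points in the definition of the offset, that integer part is \<open>m\<close> as soon as \<open>m\<close> is large.
\<close>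

lemma zero_offset_phase:
  assumes "bessel_phase \<nu> a \<Theta>"
  shows "\<exists>c. zero_offset \<nu> c \<and> (\<forall>t>a. int (card (bessel_zeros \<nu> t)) = \<lfloor>\<Theta> t / pi\<rfloor> + c)"
proof -
  define c where "c = int (card (bessel_zeros \<nu> (a + 1))) - \<lfloor>\<Theta> (a + 1) / pi\<rfloor>"
  have card: "int (card (bessel_zeros \<nu> t)) = \<lfloor>\<Theta> t / pi\<rfloor> + c" if "t > a" for t
    using card_bessel_zeros_increment[OF assms, of "a + 1" t]
      card_bessel_zeros_increment[OF assms, of t "a + 1"] that
    by (cases "t \<le> a + 1") (auto simp: c_def)
  moreover have "zero_offset \<nu> c"
    unfolding zero_offset_def
  proof (intro allI impI)
    fix \<delta> :: real assume \<delta>: "0 < \<delta>" "\<delta> < 1"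
    define z where "z m = (real m + \<delta>) * pi + \<nu> * pi / 2 - pi / 4" for m :: nat
    have ztop: "filterlim z at_top sequentially"
      unfolding z_def [abs_def] by real_asymp
    have "(\<lambda>m. \<Theta> (z m) - z m) \<longlonglongrightarrow> pi / 4 - \<nu> * pi / 2"
      by (rule filterlim_compose[OF bessel_phase_tendsto'[OF assms] ztop])
    from tendsto_add[OF this tendsto_const[of "\<delta> * pi + \<nu> * pi / 2 - pi / 4"]]
    have "(\<lambda>m. \<Theta> (z m) - real m * pi) \<longlonglongrightarrow> \<delta> * pi"
      by (simp add: z_def algebra_simps)
    from tendsto_divide[OF this tendsto_const[of pi]]
    have lim: "(\<lambda>m. \<Theta> (z m) / pi - real m) \<longlonglongrightarrow> \<delta>"
      by (simp add: diff_divide_distrib)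
    have "eventually (\<lambda>m. z m > a) sequentially"
      using ztop by (simp add: filterlim_at_top_dense)
    moreover have "eventually (\<lambda>m. \<Theta> (z m) / pi - real m > 0) sequentially"
      by (rule order_tendstoD(1)[OF lim \<delta>(1)])
    moreover have "eventually (\<lambda>m. \<Theta> (z m) / pi - real m < 1) sequentially"
      by (rule order_tendstoD(2)[OF lim \<delta>(2)])
    ultimately have "eventually (\<lambda>m. int (card (bessel_zeros \<nu> (z m))) = int m + c) sequentially"
    proof eventually_elim
      case (elim m)
      have "\<lfloor>\<Theta> (z m) / pi\<rfloor> = int m" using elim by (simp add: floor_eq_iff)
      then show ?case using card[OF elim(1)] by simp
    qed
    then show "eventually (\<lambda>m. int (card (bessel_zeros \<nu> ((real m + \<delta>) * pi + \<nu> * pi / 2 - pi / 4))) = int m + c) sequentially"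
      by (simp add: z_def)
  qed
  ultimately show ?thesis by blast
qed

lemma zero_offset_exists:
  assumes "\<nu> > 1/2"
  shows "\<exists>c. zero_offset \<nu> c"
  using bessel_phase_exists[OF assms, of "\<nu> + 1"] zero_offset_phase by (metis less_add_one)

lemma zero_offset_unique:
  assumes "zero_offset \<nu> c" "zero_offset \<nu> c'"
  shows "c = c'"
proof -
  have "0 < (1/2 :: real)" "(1/2 :: real) < 1" by simp_all
  from zero_offsetD[OF assms(1) this] zero_offsetD[OF assms(2) this]
  have "eventually (\<lambda>m::nat. c = c') sequentially"
    by eventually_elim simp
  then show ?thesis by simp
qed

text \<open>
The counts of two neighbouring orders differ by \<open>0\<close> or \<open>1\<close>, and the angle of order \<open>\<nu> + 1\<close> lags behind
by \<open>pi/2\<close>. Where the angles are about \<open>(m + 3/4) pi\<close> and \<open>(m + 1/4) pi\<close>, the counts differ by \<open>c - c'\<close>, which is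
therefore not negative; where they are about \<open>(m + 5/4) pi\<close> and \<open>(m + 3/4) pi\<close>, the counts differ by \<open>c - c' + 1\<close>,
so that \<open>c - c'\<close> is not positive.
\<close>

lemma zero_offset_Suc_order:
  assumes "\<nu> > 0" "zero_offset \<nu> c" "zero_offset (\<nu> + 1) c'"
  shows "c' = c"
proof -
  have bound: "card (bessel_zeros (\<nu> + 1) t) \<le> card (bessel_zeros \<nu> t)"
    "card (bessel_zeros \<nu> t) \<le> Suc (card (bessel_zeros (\<nu> + 1) t))" for t
    using assms(1) by (auto intro: card_bessel_zeros_antimono card_bessel_zeros_Suc_order)
  have q: "0 < (1/4 :: real)" "(1/4 :: real) < 1" "0 < (3/4 :: real)" "(3/4 :: real) < 1" by simp_all
  from zero_offsetD[OF assms(2) q(3,4)] zero_offsetD[OF assms(3) q(1,2)]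
  have "eventually (\<lambda>m::nat. c' \<le> c) sequentially"
  proof eventually_elim
    case (elim m)
    have "(real m + 3/4) * pi + \<nu> * pi / 2 - pi / 4 = (real m + 1/4) * pi + (\<nu> + 1) * pi / 2 - pi / 4"
      by (simp add: field_simps)
    then show ?case
      using elim bound(1)[of "(real m + 1/4) * pi + (\<nu> + 1) * pi / 2 - pi / 4"] by simp
  qed
  moreover have "eventually (\<lambda>m::nat. c \<le> c') sequentially"
  proof -
    have "eventually (\<lambda>m. int (card (bessel_zeros \<nu> ((real (Suc m) + 1/4) * pi + \<nu> * pi / 2 - pi / 4))) = int (Suc m) + c) sequentially"
      using zero_offsetD[OF assms(2) q(1,2)]
      by (subst eventually_sequentially_Suc[where P = "\<lambda>m. int (card (bessel_zeros \<nu> ((real m + 1/4) * pi + \<nu> * pi / 2 - pi / 4))) = int m + c"])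
    from this zero_offsetD[OF assms(3) q(3,4)] show ?thesis
    proof eventually_elim
      case (elim m)
      have "(real (Suc m) + 1/4) * pi + \<nu> * pi / 2 - pi / 4 = (real m + 3/4) * pi + (\<nu> + 1) * pi / 2 - pi / 4"
        by (simp add: field_simps)
      then show ?case
        using elim bound(2)[of "(real m + 3/4) * pi + (\<nu> + 1) * pi / 2 - pi / 4"] by simp
    qed
  qed
  ultimately show ?thesis by simp
qed

text \<open>
Steps of one in the order preserve the offset, hence the order may be taken between \<open>1/2\<close>, where the offset
vanishes by inspection, and \<open>3/2\<close>, one step above it. By Sturm comparison the count for the given order
lies between the counts for these two orders, and there are points where the latter agree.
\<close>

lemma zero_offset_zero:
  assumes "\<nu> \<ge> 1/2"
  shows "zero_offset \<nu> 0"
proof -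
  have step: "zero_offset (\<kappa> + 1) 0" if "zero_offset \<kappa> 0" "\<kappa> \<ge> 1/2" for \<kappa>
    using zero_offset_exists[of "\<kappa> + 1"] zero_offset_Suc_order[of \<kappa> 0] that by fastforce
  define n where "n = nat \<lfloor>\<nu> - 1/2\<rfloor>"
  define \<mu> where "\<mu> = \<nu> - real n"
  have n: "real n = of_int \<lfloor>\<nu> - 1/2\<rfloor>" using assms by (simp add: n_def)
  then have \<mu>: "1/2 \<le> \<mu>" "\<mu> < 3/2" unfolding \<mu>_def by linarith+
  have base: "zero_offset \<mu> 0"
  proof (cases "\<mu> = 1/2")
    case True
    show ?thesis unfolding True by (rule zero_offset_half)
  next
    case False
    then obtain c where c: "zero_offset \<mu> c" using zero_offset_exists \<mu> by fastforce
    have three_halves: "zero_offset (3/2) 0" using step[OF zero_offset_half] by simp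
    \<comment> \<open>At this phase the angle of order \<open>1/2\<close> is at \<open>(m + 3/4) pi\<close> and that of order \<open>3/2\<close> at \<open>(m + 1/4) pi\<close>.\<close>
    define \<delta> where "\<delta> = 3/4 - (\<mu> - 1/2) / 2"
    have \<delta>: "0 < \<delta>" "\<delta> < 1" using \<mu> by (simp_all add: \<delta>_def field_simps)
    have q: "0 < (1/4 :: real)" "(1/4 :: real) < 1" "0 < (3/4 :: real)" "(3/4 :: real) < 1" by simp_all
    from zero_offsetD[OF c \<delta>] zero_offsetD[OF zero_offset_half q(3,4)] zero_offsetD[OF three_halves q(1,2)]
    have "eventually (\<lambda>m::nat. c = 0) sequentially"
    proof eventually_elim
      case (elim m)
      define t where "t = (real m + \<delta>) * pi + \<mu> * pi / 2 - pi / 4"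
      have t: "(real m + 3/4) * pi + 1/2 * pi / 2 - pi / 4 = t"
        "(real m + 1/4) * pi + 3/2 * pi / 2 - pi / 4 = t"
        by (auto simp: \<delta>_def t_def field_simps)
      have "card (bessel_zeros (3/2) t) \<le> card (bessel_zeros \<mu> t)"
        "card (bessel_zeros \<mu> t) \<le> card (bessel_zeros (1/2) t)"
        using \<mu> by (auto intro!: card_bessel_zeros_antimono)
      then show ?case using elim unfolding t t_def[symmetric] by linarith
    qed
    then show ?thesis using c by simp
  qed
  have "zero_offset (\<mu> + real i) 0" for i
  proof (induction i)
    case (Suc i)
    then show ?case using step[of "\<mu> + real i"] \<mu> by (simp add: add_ac)
  qed (use base in simp)
  from this[of n] show ?thesis by (simp add: \<mu>_def)
qed

lemma card_bessel_zeros_eq_phase: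
  assumes "bessel_phase \<nu> a \<Theta>" "\<nu> \<ge> 1/2" "t > a"
  shows "int (card (bessel_zeros \<nu> t)) = \<lfloor>\<Theta> t / pi\<rfloor>"
proof -
  obtain c where c: "zero_offset \<nu> c" "\<And>t. t > a \<Longrightarrow> int (card (bessel_zeros \<nu> t)) = \<lfloor>\<Theta> t / pi\<rfloor> + c"
    using zero_offset_phase[OF assms(1)] by blast
  have "c = 0" using zero_offset_unique[OF c(1) zero_offset_zero[OF assms(2)]] .
  then show ?thesis using c(2)[OF assms(3)] by simp
qed

lemma bessel_zero_eq_phase:
  assumes "bessel_phase \<nu> a \<Theta>" "\<nu> \<ge> 1/2" "t > a" "\<Theta> t = real k * pi"
  shows "bessel_zero \<nu> k = t"
proof (rule bessel_zero_eqI)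
  show "bessel_J \<nu> t = 0"
    using bessel_phase_zero_iff[OF assms(1,3)] assms(4) by simp
  show "card (bessel_zeros \<nu> t) = k"
    using card_bessel_zeros_eq_phase[OF assms(1-3)] assms(4) by simp
qed (use assms bessel_phase_order[OF assms(1)] in auto)

section \<open>Uniform expansion for large order\<close>

text \<open>
These are the quantities of the Liouville-Green approximation at \<open>t = \<nu> z\<close> with the dependence on \<open>\<nu>\<close> scaled
out. The function \<open>sigma\<close> is \<open>pi / debye_phase\<close>.
\<close>

definition debye_phase :: "real \<Rightarrow> real" where
  "debye_phase z = sqrt (z\<^sup>2 - 1) - arccos (1 / z)"

definition debye_correction :: "real \<Rightarrow> real" where
  "debye_correction z = (let s = sqrt (z\<^sup>2 - 1) in 1 / (4 * s) + 5 / (12 * s ^ 3))"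

definition debye_error :: "real \<Rightarrow> real" where
  "debye_error z = (let s = sqrt (z\<^sup>2 - 1) in (1 / s ^ 2 + 6 / s ^ 4 + 5 / s ^ 6) / 4)"

lemma sqrt_square_minus_one_pos:
  fixes z :: real
  assumes "z > 1"
  shows "sqrt (z\<^sup>2 - 1) > 0"
  using assms by (simp add: one_less_power)

text \<open>
The momentum at \<open>\<nu> z\<close> is \<open>\<nu> * sqrt (z\<^sup>2 - 1)\<close>, which makes the arcus tangens the natural form of the phase; this
is the bridge to the form with the arcus cosinus used in \<open>sigma\<close>.
\<close>

lemma arccos_inverse:
  fixes z :: real
  assumes "z > 1"
  shows "arccos (1 / z) = arctan (sqrt (z\<^sup>2 - 1))"
proof -
  have "cos (arctan (sqrt (z\<^sup>2 - 1))) = 1 / z"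
    using assms by (simp add: cos_arctan one_le_power)
  moreover have "arccos (cos (arctan (sqrt (z\<^sup>2 - 1)))) = arctan (sqrt (z\<^sup>2 - 1))"
  proof (rule arccos_cos)
    show "0 \<le> arctan (sqrt (z\<^sup>2 - 1))"
      using sqrt_square_minus_one_pos[OF assms] by (intro less_imp_le) (simp only: zero_less_arctan_iff)
    show "arctan (sqrt (z\<^sup>2 - 1)) \<le> pi"
      using arctan_ubound[of "sqrt (z\<^sup>2 - 1)"] pi_gt_zero by linarith
  qed
  ultimately show ?thesis by simp
qed

lemma lg_scaling:
  assumes "\<nu> > 0" "z > 1"
  shows "lg_phase \<nu> (\<nu> * z) = \<nu> * debye_phase z"
    and "lg_error \<nu> (\<nu> * z) = debye_error z / \<nu>\<^sup>2"
    and "lg_error_integral \<nu> (\<nu> * z) = - debye_correction z / \<nu>"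
proof -
  have m: "lg_momentum \<nu> (\<nu> * z) = \<nu> * sqrt (z\<^sup>2 - 1)"
  proof -
    have "(\<nu> * z)\<^sup>2 - \<nu>\<^sup>2 = \<nu>\<^sup>2 * (z\<^sup>2 - 1)" by (simp add: power_mult_distrib algebra_simps)
    then show ?thesis using assms by (simp add: lg_momentum_def real_sqrt_mult)
  qed
  define s where "s = sqrt (z\<^sup>2 - 1)"
  have s: "s > 0" unfolding s_def by (rule sqrt_square_minus_one_pos[OF assms(2)])
  show "lg_phase \<nu> (\<nu> * z) = \<nu> * debye_phase z"
    unfolding lg_phase_def m debye_phase_def arccos_inverse[OF assms(2)] using assms by (simp add: algebra_simps)
  show "lg_error \<nu> (\<nu> * z) = debye_error z / \<nu>\<^sup>2"
    unfolding lg_error_def m debye_error_def Let_def s_def[symmetric] using assms s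
    by (simp add: field_simps eval_nat_numeral)
  show "lg_error_integral \<nu> (\<nu> * z) = - debye_correction z / \<nu>"
    unfolding lg_error_integral_def m debye_correction_def Let_def s_def[symmetric] using assms s
    by (simp add: field_simps eval_nat_numeral)
qed

lemma debye_bounds:
  assumes "1 < z0" "z0 \<le> z"
  shows "0 \<le> debye_error z" "debye_error z \<le> debye_error z0"
    "0 \<le> debye_correction z" "debye_correction z \<le> debye_correction z0"
proof -
  define s where "s = sqrt (z\<^sup>2 - 1)"
  define s0 where "s0 = sqrt (z0\<^sup>2 - 1)"
  have s0: "0 < s0" unfolding s0_def by (rule sqrt_square_minus_one_pos[OF assms(1)])
  have le: "s0 \<le> s" unfolding s_def s0_def using assms by (intro real_sqrt_le_mono diff_mono power_mono) auto
  show "0 \<le> debye_error z" "debye_error z \<le> debye_error z0"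
    "0 \<le> debye_correction z" "debye_correction z \<le> debye_correction z0"
    unfolding debye_error_def debye_correction_def Let_def s_def[symmetric] s0_def[symmetric]
    using s0 le
    by (auto intro!: add_nonneg_nonneg divide_nonneg_pos divide_right_mono add_mono divide_left_mono power_mono mult_pos_pos mult_left_mono)
qed

text \<open>
The first two terms of the Debye expansion of the phase, with an error that is uniform in \<open>z > z0\<close>.
\<close>

lemma bessel_phase_Debye:
  assumes phase: "bessel_phase \<nu> (\<nu> * z0) \<Theta>" and "1 \<le> \<nu>" "1 < z0" "z0 < z"
  shows "\<bar>\<Theta> (\<nu> * z) - (\<nu> * debye_phase z + pi / 4 - debye_correction z / (2 * \<nu>))\<bar>
     \<le> debye_error z0 * (1 + debye_correction z0) / \<nu>\<^sup>2"
proof -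
  define e where "e = debye_error z / \<nu>\<^sup>2"
  define E where "E = debye_correction z / \<nu>"
  have z: "\<nu> * z0 < \<nu> * z" "1 < z" "0 < \<nu>" using assms by auto
  note sc = lg_scaling[OF z(3,2)]
  note b = debye_bounds[OF assms(3) less_imp_le[OF assms(4)]]
  have e: "0 \<le> e" "e \<le> debye_error z0 / \<nu>\<^sup>2"
    using b by (auto simp: e_def divide_right_mono)
  have E: "0 \<le> E" "E \<le> debye_correction z0"
  proof -
    show "0 \<le> E" using b z by (simp add: E_def)
    have "E \<le> debye_correction z / 1" unfolding E_def using b assms(2) by (intro divide_left_mono) auto
    then show "E \<le> debye_correction z0" using b by simp
  qed
  have "\<bar>\<Theta> (\<nu> * z) + e * sin (2 * \<Theta> (\<nu> * z)) / 4 - \<nu> * debye_phase z + E / 2 - pi / 4\<bar>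
      \<le> e / 4 + e * E / 2"
    using bessel_phase_expansion[OF phase z(1)] unfolding sc by (simp add: e_def E_def)
  moreover have "\<bar>e * sin (2 * \<Theta> (\<nu> * z)) / 4\<bar> \<le> e / 4"
    using e(1) by (simp add: abs_mult mult_left_le)
  moreover have "\<nu> * debye_phase z + pi / 4 - debye_correction z / (2 * \<nu>) = \<nu> * debye_phase z + pi / 4 - E / 2"
    by (simp add: E_def)
  moreover have "e * E \<ge> 0" using e E by simp
  ultimately have "\<bar>\<Theta> (\<nu> * z) - (\<nu> * debye_phase z + pi / 4 - debye_correction z / (2 * \<nu>))\<bar> \<le> e * (1 + E)"
    using e(1) unfolding distrib_left abs_le_iff by linarith
  also have "\<dots> \<le> debye_error z0 / \<nu>\<^sup>2 * (1 + debye_correction z0)"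
    using e E by (intro mult_mono) auto
  finally show ?thesis by simp
qed

section \<open>Expansion of the zeros\<close>

lemma DERIV_debye_phase:
  assumes "z > 1"
  shows "(debye_phase has_real_derivative sqrt (z\<^sup>2 - 1) / z) (at z)"
proof -
  define s where "s = sqrt (z\<^sup>2 - 1)"
  have s: "s > 0" "s\<^sup>2 = z\<^sup>2 - 1"
    using sqrt_square_minus_one_pos[OF assms] by (auto simp: s_def)
  have Ds: "((\<lambda>z. sqrt (z\<^sup>2 - 1)) has_real_derivative z / s) (at z)"
    using s by (auto intro!: derivative_eq_intros simp: s_def divide_simps)
  have "((\<lambda>z. sqrt (z\<^sup>2 - 1) - arctan (sqrt (z\<^sup>2 - 1))) has_real_derivative
      z / s - inverse (1 + s\<^sup>2) * (z / s)) (at z)"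
    unfolding s_def by (rule DERIV_diff[OF Ds[unfolded s_def] DERIV_chain2[OF DERIV_arctan Ds[unfolded s_def]]])
  moreover have "z / s - inverse (1 + s\<^sup>2) * (z / s) = s / z"
  proof -
    have "1 + s\<^sup>2 = z\<^sup>2" using s by simp
    then have "z / s - inverse (1 + s\<^sup>2) * (z / s) = (z\<^sup>2 - 1) / (z * s)"
      using s(1) assms by (simp add: field_simps power2_eq_square)
    then show ?thesis using s assms unfolding s(2)[symmetric] by (simp add: power2_eq_square)
  qed
  ultimately have D: "((\<lambda>z. sqrt (z\<^sup>2 - 1) - arctan (sqrt (z\<^sup>2 - 1))) has_real_derivative s / z) (at z)"
    by simp
  show ?thesis
    unfolding s_def[symmetric]
    by (rule has_field_derivative_transform_within_open[OF D open_greaterThan[of 1]])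
       (use assms in \<open>auto simp: debye_phase_def arccos_inverse\<close>)
qed

lemma DERIV_debye_phase_deriv:
  assumes "z > 1"
  shows "((\<lambda>z. sqrt (z\<^sup>2 - 1) / z) has_real_derivative 1 / (z\<^sup>2 * sqrt (z\<^sup>2 - 1))) (at z)"
proof -
  define s where "s = sqrt (z\<^sup>2 - 1)"
  have s: "s > 0" "s\<^sup>2 = z\<^sup>2 - 1"
    using sqrt_square_minus_one_pos[OF assms] by (auto simp: s_def)
  have Ds: "((\<lambda>z. sqrt (z\<^sup>2 - 1)) has_real_derivative z / s) (at z)"
    using s by (auto intro!: derivative_eq_intros simp: s_def divide_simps)
  have "((\<lambda>z. sqrt (z\<^sup>2 - 1) / z) has_real_derivative (z / s * z - s * 1) / (z * z)) (at z)"
    using DERIV_divide[OF Ds DERIV_ident] assms by (simp add: s_def)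
  moreover have "(z / s * z - s * 1) / (z * z) = 1 / (z\<^sup>2 * s)"
  proof -
    have "z / s * z - s * 1 = (z\<^sup>2 - s\<^sup>2) / s" using s(1) by (simp add: field_simps power2_eq_square)
    also have "\<dots> = 1 / s" unfolding s(2) by simp
    finally show ?thesis by (simp add: power2_eq_square mult.commute)
  qed
  ultimately show ?thesis by (simp add: s_def)
qed

text \<open>
The derivative \<open>sqrt (z\<^sup>2 - 1) / z\<close> is increasing, hence bounded below by its value at \<open>z0\<close>. This converts an estimate for
\<open>debye_phase\<close> into an estimate for its argument.
\<close>

lemma debye_phase_increase:
  assumes "1 < z0" "z0 \<le> y" "y \<le> z"
  shows "sqrt (z0\<^sup>2 - 1) / z0 * (z - y) \<le> debye_phase z - debye_phase y"
proof -
  define c where "c = sqrt (z0\<^sup>2 - 1) / z0"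
  have c: "c \<le> sqrt (t\<^sup>2 - 1) / t" if "t \<ge> z0" for t
    unfolding c_def
  proof (rule DERIV_nonneg_imp_nondecreasing[OF that])
    fix u assume "z0 \<le> u"
    then have "u > 1" using assms by simp
    from DERIV_debye_phase_deriv[OF this]
    show "\<exists>y. ((\<lambda>t. sqrt (t\<^sup>2 - 1) / t) has_real_derivative y) (at u) \<and> y \<ge> 0"
      using sqrt_square_minus_one_pos[OF \<open>u > 1\<close>] by (intro exI conjI) auto
  qed
  have "debye_phase y - c * y \<le> debye_phase z - c * z"
  proof (rule DERIV_nonneg_imp_nondecreasing[OF assms(3)])
    fix u assume u: "y \<le> u"
    then have "((\<lambda>u. debye_phase u - c * u) has_real_derivative sqrt (u\<^sup>2 - 1) / u - c * 1) (at u)"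
      using assms by (intro DERIV_diff DERIV_debye_phase DERIV_cmult DERIV_ident) auto
    then show "\<exists>D. ((\<lambda>u. debye_phase u - c * u) has_real_derivative D) (at u) \<and> D \<ge> 0"
      using c[of u] u assms by (intro exI conjI) auto
  qed
  then show ?thesis by (simp add: c_def right_diff_distrib)
qed

text \<open>
By the intermediate value theorem \<open>sigma\<close> attains the value \<open>x\<close>; \<open>sigma_inv x\<close> is then a point with that
value.
\<close>

lemma sigma_inv_debye_phase:
  assumes "x > 0"
  shows "sigma_inv x > 1" "debye_phase (sigma_inv x) = pi / x"
proof -
  \<comment> \<open>\<open>debye_phase B \<ge> sqrt (B\<^sup>2 - 1) - pi \<ge> (B - 1) - pi\<close>.\<close>
  define B where "B = pi / x + pi + 1"
  have B: "B > 1" using assms by (simp add: B_def add_pos_pos)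
  have cont: "continuous_on {1..B} debye_phase"
    unfolding debye_phase_def
    by (intro continuous_intros) (auto simp: divide_simps)
  have "debye_phase B \<ge> pi / x"
  proof -
    have "(B - 1)\<^sup>2 \<le> B\<^sup>2 - 1" using B by (simp add: power2_eq_square algebra_simps)
    then have "B - 1 \<le> sqrt (B\<^sup>2 - 1)" by (rule real_le_rsqrt)
    moreover have "arccos (1 / B) \<le> pi"
      using B by (intro arccos_ubound) (auto simp: divide_simps)
    ultimately show ?thesis by (simp add: debye_phase_def B_def)
  qed
  moreover have d1: "debye_phase 1 = 0" by (simp add: debye_phase_def)
  ultimately obtain \<alpha> where \<alpha>: "1 \<le> \<alpha>" "\<alpha> \<le> B" "debye_phase \<alpha> = pi / x"
    using IVT'[of debye_phase 1 "pi / x" B] cont B assms by auto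
  have "\<alpha> \<noteq> 1" using \<alpha>(3) d1 assms by auto
  then have "\<alpha> \<in> {1<..}" using \<alpha> by simp
  moreover have sig: "sigma z = pi / debye_phase z" for z by (simp add: sigma_def debye_phase_def)
  have "sigma \<alpha> = x" unfolding sig \<alpha>(3) by simp
  ultimately have im: "x \<in> sigma ` {1<..}" by blast
  show "sigma_inv x > 1" using inv_into_into[OF im] by (simp add: sigma_inv_def)
  have "pi / debye_phase (sigma_inv x) = x"
    using f_inv_into_f[OF im] by (simp add: sigma_inv_def sig)
  then show "debye_phase (sigma_inv x) = pi / x"
    using assms by (cases "debye_phase (sigma_inv x) = 0") (auto simp: field_simps)
qed

text \<open>
If \<open>f z = f \<alpha> - p / n + q / n\<^sup>2 + o (1 / n\<^sup>2)\<close>, then \<open>z\<close> has an expansion of the same form around \<open>\<alpha>\<close>. By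
Taylor's theorem \<open>f z - f \<alpha> = (f' \<alpha> + b (z - \<alpha>)) (z - \<alpha>)\<close> with \<open>b\<close> tending to \<open>f'' \<alpha> / 2\<close>; dividing by the
first factor gives the first-order term, and inserting this into the quadratic term gives the second.
\<close>

lemma second_order_inversion:
  fixes f f' f'' :: "real \<Rightarrow> real" and n z :: "nat \<Rightarrow> real"
  assumes D1: "\<And>t. t > l \<Longrightarrow> (f has_real_derivative f' t) (at t)"
    and D2: "\<And>t. t > l \<Longrightarrow> (f' has_real_derivative f'' t) (at t)"
    and cont: "isCont f'' \<alpha>" and \<alpha>: "l < \<alpha>" "f' \<alpha> \<noteq> 0"
    and n: "filterlim n at_top sequentially"
    and z: "z \<longlonglongrightarrow> \<alpha>"
    and lim: "(\<lambda>k. (n k)\<^sup>2 * (f (z k) - f \<alpha> + p / n k)) \<longlonglongrightarrow> q"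
  shows "(\<lambda>k. (n k)\<^sup>2 * (z k - \<alpha> + p / (f' \<alpha> * n k))) \<longlonglongrightarrow> (q - f'' \<alpha> / 2 * (p / f' \<alpha>)\<^sup>2) / f' \<alpha>"
proof -
  define a where "a = f' \<alpha>"
  define d where "d k = z k - \<alpha>" for k
  have d0: "d \<longlonglongrightarrow> 0" unfolding d_def using tendsto_diff[OF z tendsto_const[of \<alpha>]] by simp
  have taylor: "\<exists>t. \<bar>t - \<alpha>\<bar> \<le> \<bar>y - \<alpha>\<bar> \<and> f y - f \<alpha> = a * (y - \<alpha>) + f'' t / 2 * (y - \<alpha>)\<^sup>2" if "y > l" for y
  proof (cases "y = \<alpha>")
    case False
    define diff where "diff = (\<lambda>m::nat. if m = 0 then f else if m = 1 then f' else f'')"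
    have "\<exists>t. (if y < \<alpha> then y < t \<and> t < \<alpha> else \<alpha> < t \<and> t < y) \<and>
        f y = (\<Sum>m<2. diff m \<alpha> / fact m * (y - \<alpha>) ^ m) + diff 2 t / fact 2 * (y - \<alpha>) ^ 2"
    proof (rule Taylor[of 2 diff f "min y \<alpha>" "max y \<alpha>" \<alpha> y])
      show "\<forall>m t. m < 2 \<and> min y \<alpha> \<le> t \<and> t \<le> max y \<alpha> \<longrightarrow> (diff m has_real_derivative diff (Suc m) t) (at t)"
        using D1 D2 that \<alpha> by (auto simp: diff_def less_2_cases_iff)
    qed (use False in \<open>auto simp: diff_def\<close>)
    then obtain t where t: "if y < \<alpha> then y < t \<and> t < \<alpha> else \<alpha> < t \<and> t < y"
      "f y = (\<Sum>m<2. diff m \<alpha> / fact m * (y - \<alpha>) ^ m) + diff 2 t / fact 2 * (y - \<alpha>) ^ 2" by blast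
    have "f y - f \<alpha> = a * (y - \<alpha>) + f'' t / 2 * (y - \<alpha>)\<^sup>2"
      using t(2) by (simp add: diff_def a_def numeral_2_eq_2)
    moreover have "\<bar>t - \<alpha>\<bar> \<le> \<bar>y - \<alpha>\<bar>" using t(1) by (auto split: if_splits)
    ultimately show ?thesis by blast
  qed (use exI[of _ \<alpha>] in auto)
  obtain t where t: "\<And>y. y > l \<Longrightarrow> \<bar>t y - \<alpha>\<bar> \<le> \<bar>y - \<alpha>\<bar>"
    "\<And>y. y > l \<Longrightarrow> f y - f \<alpha> = a * (y - \<alpha>) + f'' (t y) / 2 * (y - \<alpha>)\<^sup>2"
    using taylor by metis
  define b where "b k = f'' (t (z k)) / 2" for k
  have evl: "eventually (\<lambda>k. z k > l) sequentially" by (rule order_tendstoD(1)[OF z \<alpha>(1)])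
  have npos: "eventually (\<lambda>k. n k > 0) sequentially" using n by (simp add: filterlim_at_top_dense)
  have b: "b \<longlonglongrightarrow> f'' \<alpha> / 2"
  proof -
    have "(\<lambda>k. t (z k) - \<alpha>) \<longlonglongrightarrow> 0"
    proof (rule Lim_null_comparison)
      show "(\<lambda>k. \<bar>d k\<bar>) \<longlonglongrightarrow> 0" using d0 by (rule tendsto_rabs_zero)
      show "\<forall>\<^sub>F k in sequentially. norm (t (z k) - \<alpha>) \<le> \<bar>d k\<bar>"
        using evl by eventually_elim (use t(1) in \<open>auto simp: d_def\<close>)
    qed
    then have "(\<lambda>k. t (z k)) \<longlonglongrightarrow> \<alpha>" by (simp add: LIM_zero_iff)
    from isCont_tendsto_compose[OF cont this] show ?thesis
      unfolding b_def by (intro tendsto_divide) auto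
  qed
  have inv: "(\<lambda>k. inverse (n k)) \<longlonglongrightarrow> 0"
    by (rule tendsto_inverse_0_at_top[OF n])
  have nd: "(\<lambda>k. n k * d k) \<longlonglongrightarrow> - p / a"
  proof -
    have "(\<lambda>k. inverse (n k) * ((n k)\<^sup>2 * (f (z k) - f \<alpha> + p / n k)) - p) \<longlonglongrightarrow> 0 * q - p"
      by (intro tendsto_intros inv lim)
    moreover have "(\<lambda>k. a + b k * d k) \<longlonglongrightarrow> a + f'' \<alpha> / 2 * 0"
      by (intro tendsto_intros b d0)
    ultimately have L: "(\<lambda>k. (inverse (n k) * ((n k)\<^sup>2 * (f (z k) - f \<alpha> + p / n k)) - p) / (a + b k * d k))
        \<longlonglongrightarrow> (0 * q - p) / (a + f'' \<alpha> / 2 * 0)"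
      using \<alpha>(2) by (intro tendsto_divide) (auto simp: a_def)
    have nz: "eventually (\<lambda>k. a + b k * d k \<noteq> 0) sequentially"
      using tendsto_imp_eventually_ne[OF \<open>(\<lambda>k. a + b k * d k) \<longlonglongrightarrow> a + f'' \<alpha> / 2 * 0\<close>, of 0] \<alpha>(2)
      by (simp add: a_def)
    have "eventually (\<lambda>k. (inverse (n k) * ((n k)\<^sup>2 * (f (z k) - f \<alpha> + p / n k)) - p) / (a + b k * d k) = n k * d k) sequentially"
      using nz npos evl
    proof eventually_elim
      case (elim k)
      have "inverse (n k) * ((n k)\<^sup>2 * (f (z k) - f \<alpha> + p / n k)) - p = n k * (f (z k) - f \<alpha>)"
        using elim by (simp add: field_simps power2_eq_square)
      also have "\<dots> = n k * d k * (a + b k * d k)"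
        unfolding t(2)[OF elim(3)] b_def d_def[symmetric] by (simp add: algebra_simps power2_eq_square)
      finally show ?case using elim by simp
    qed
    from Lim_transform_eventually[OF L this] show ?thesis by simp
  qed
  have "(\<lambda>k. ((n k)\<^sup>2 * (f (z k) - f \<alpha> + p / n k) - b k * (n k * d k)\<^sup>2) / a) \<longlonglongrightarrow> (q - f'' \<alpha> / 2 * (- p / a)\<^sup>2) / a"
    using \<alpha>(2) by (intro tendsto_intros lim b nd) (auto simp: a_def)
  moreover have "eventually (\<lambda>k. ((n k)\<^sup>2 * (f (z k) - f \<alpha> + p / n k) - b k * (n k * d k)\<^sup>2) / a
      = (n k)\<^sup>2 * (z k - \<alpha> + p / (a * n k))) sequentially"
    using npos evl
  proof eventually_elim
    case (elim k)
    have "(n k)\<^sup>2 * (f (z k) - f \<alpha> + p / n k) - b k * (n k * d k)\<^sup>2 = (n k)\<^sup>2 * (a * d k + p / n k)"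
      unfolding t(2)[OF elim(2)] b_def d_def[symmetric] by (simp add: algebra_simps power_mult_distrib)
    then show ?case using \<alpha>(2) elim(1) by (simp add: a_def[symmetric] d_def field_simps)
  qed
  ultimately show ?thesis
    unfolding a_def[symmetric] by (subst (asm) tendsto_cong) (auto simp: power_divide)
qed

text \<open>
With \<open>\<nu> = x k\<close> one has \<open>k pi = \<nu> * debye_phase \<alpha>\<close>. At a point slightly to the left of \<open>\<nu> \<alpha>\<close> the angle is
below \<open>k pi\<close> as soon as \<open>k\<close> is large, hence it takes the value \<open>k pi\<close> further to the right, in the range where
the Debye expansion is uniform; the point where it does so is the zero number \<open>k\<close>.
\<close>

lemma bessel_zero_Debye:
  assumes "x > 0"
  defines "\<alpha> \<equiv> sigma_inv x"
  defines "z0 \<equiv> (1 + \<alpha>) / 2"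
  shows "\<exists>z. eventually (\<lambda>k. z k > z0 \<and> bessel_zero (x * real k) k = x * real k * z k \<and>
     \<bar>debye_phase (z k) - debye_phase \<alpha> + pi / 4 / (x * real k) - debye_correction (z k) / 2 / (x * real k)\<^sup>2\<bar>
       \<le> debye_error z0 * (1 + debye_correction z0) / (x * real k) ^ 3) sequentially"
proof -
  define C where "C = debye_error z0 * (1 + debye_correction z0)"
  have \<alpha>: "\<alpha> > 1" "debye_phase \<alpha> = pi / x"
    using sigma_inv_debye_phase[OF assms(1)] by (auto simp: \<alpha>_def)
  define z1 where "z1 = (z0 + \<alpha>) / 2"
  have z: "1 < z0" "z0 < z1" "z1 < \<alpha>" using \<alpha>(1) by (auto simp: z0_def z1_def)
  define g where "g = debye_phase \<alpha> - debye_phase z1"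
  have "0 < sqrt (z0\<^sup>2 - 1) / z0 * (\<alpha> - z1)"
    using z sqrt_square_minus_one_pos[OF z(1)] by simp
  also have "\<dots> \<le> g" unfolding g_def using z by (intro debye_phase_increase) auto
  finally have g: "g > 0" .
  have C: "C \<ge> 0" unfolding C_def using debye_bounds[of z0 z0] z by simp
  have ev: "eventually (\<lambda>k. x * real k \<ge> 1) sequentially" "eventually (\<lambda>k. x * real k * g > pi / 4 + C) sequentially"
    using assms(1) g by real_asymp+
  have "\<exists>z. z > z0 \<and> bessel_zero (x * real k) k = x * real k * z \<and>
     \<bar>debye_phase z - debye_phase \<alpha> + pi / 4 / (x * real k) - debye_correction z / 2 / (x * real k)\<^sup>2\<bar>
       \<le> C / (x * real k) ^ 3"
    if k: "x * real k \<ge> 1" "x * real k * g > pi / 4 + C" for k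
  proof -
    define \<nu> where "\<nu> = x * real k"
    have \<nu>: "\<nu> \<ge> 1" using k by (simp add: \<nu>_def)
    have kpi: "real k * pi = \<nu> * debye_phase \<alpha>" using assms(1) by (simp add: \<nu>_def \<alpha>(2))
    have "1/2 < \<nu>" "\<nu> < \<nu> * z0" using \<nu> z by auto
    then obtain \<Theta> where phase: "bessel_phase \<nu> (\<nu> * z0) \<Theta>" using bessel_phase_exists by blast
    note debye = bessel_phase_Debye[OF phase \<nu> z(1), folded C_def]
    have "\<Theta> (\<nu> * z1) < real k * pi"
    proof -
      have "C / \<nu>\<^sup>2 \<le> C / 1"
        using C \<nu> by (intro divide_left_mono) (auto simp: one_le_power)
      then have "C / \<nu>\<^sup>2 \<le> C" by simp
      moreover have "debye_correction z1 / (2 * \<nu>) \<ge> 0" using debye_bounds(3)[of z0 z1] z \<nu> by simp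
      moreover have "\<nu> * debye_phase \<alpha> = \<nu> * debye_phase z1 + \<nu> * g" by (simp add: g_def algebra_simps)
      ultimately show ?thesis
        using debye[OF z(2)] k(2) unfolding kpi \<nu>_def[symmetric] abs_le_iff by linarith
    qed
    moreover obtain T where T: "T \<ge> \<nu> * z1" "\<Theta> T \<ge> real k * pi"
    proof -
      have "eventually (\<lambda>t. \<Theta> t \<ge> real k * pi) at_top"
        using bessel_phase_at_top[OF phase] by (simp add: filterlim_at_top)
      then have "eventually (\<lambda>t. t \<ge> \<nu> * z1 \<and> \<Theta> t \<ge> real k * pi) at_top"
        using eventually_ge_at_top[of "\<nu> * z1"] by eventually_elim simp
      then show ?thesis using that by (auto simp: eventually_at_top_linorder)
    qed
    moreover have below: "\<nu> * z0 < \<nu> * z1" using z \<nu> by simp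
    ultimately obtain t where t: "\<nu> * z1 \<le> t" "t \<le> T" "\<Theta> t = real k * pi"
      using IVT[of \<Theta> "\<nu> * z1" "real k * pi" T] isCont_bessel_phase[OF phase] by auto
    have above: "t > \<nu> * z0" using below t(1) by linarith
    define y where "y = t / \<nu>"
    have y: "t = \<nu> * y" "z0 < y"
      using \<nu> above by (auto simp: y_def field_simps)
    have "bessel_zero \<nu> k = \<nu> * y"
      using bessel_zero_eq_phase[OF phase _ above t(3)] \<nu> y(1) by simp
    moreover have "\<bar>debye_phase y - debye_phase \<alpha> + pi / 4 / \<nu> - debye_correction y / 2 / \<nu>\<^sup>2\<bar> \<le> C / \<nu> ^ 3"
    proof -
      have "\<bar>\<nu> * debye_phase \<alpha> - (\<nu> * debye_phase y + pi / 4 - debye_correction y / (2 * \<nu>))\<bar> \<le> C / \<nu>\<^sup>2"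
        using debye[OF y(2)] t(3) unfolding y(1) kpi by simp
      then have "\<bar>\<nu> * debye_phase \<alpha> - (\<nu> * debye_phase y + pi / 4 - debye_correction y / (2 * \<nu>))\<bar> / \<nu> \<le> C / \<nu>\<^sup>2 / \<nu>"
        using \<nu> by (intro divide_right_mono) auto
      moreover have "\<bar>\<nu> * debye_phase \<alpha> - (\<nu> * debye_phase y + pi / 4 - debye_correction y / (2 * \<nu>))\<bar> / \<nu>
          = \<bar>(\<nu> * debye_phase \<alpha> - (\<nu> * debye_phase y + pi / 4 - debye_correction y / (2 * \<nu>))) / \<nu>\<bar>"
        using \<nu> by simp
      moreover have "(\<nu> * debye_phase \<alpha> - (\<nu> * debye_phase y + pi / 4 - debye_correction y / (2 * \<nu>))) / \<nu>
          = - (debye_phase y - debye_phase \<alpha> + pi / 4 / \<nu> - debye_correction y / 2 / \<nu>\<^sup>2)"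
        using \<nu> by (simp add: field_simps power2_eq_square)
      ultimately show ?thesis by (simp add: power2_eq_square power3_eq_cube)
    qed
    ultimately show ?thesis using y unfolding \<nu>_def by blast
  qed
  then have "\<forall>k. \<exists>z. x * real k \<ge> 1 \<and> x * real k * g > pi / 4 + C \<longrightarrow>
    z > z0 \<and> bessel_zero (x * real k) k = x * real k * z \<and>
     \<bar>debye_phase z - debye_phase \<alpha> + pi / 4 / (x * real k) - debye_correction z / 2 / (x * real k)\<^sup>2\<bar>
       \<le> C / (x * real k) ^ 3" by blast
  from choice[OF this] obtain z where z: "\<And>k. x * real k \<ge> 1 \<Longrightarrow> x * real k * g > pi / 4 + C \<Longrightarrow>
    z k > z0 \<and> bessel_zero (x * real k) k = x * real k * z k \<and>
     \<bar>debye_phase (z k) - debye_phase \<alpha> + pi / 4 / (x * real k) - debye_correction (z k) / 2 / (x * real k)\<^sup>2\<bar>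
       \<le> C / (x * real k) ^ 3" by blast
  show ?thesis
    unfolding C_def[symmetric]
  proof (rule exI[of _ z])
    from ev show "eventually (\<lambda>k. z k > z0 \<and> bessel_zero (x * real k) k = x * real k * z k \<and>
     \<bar>debye_phase (z k) - debye_phase \<alpha> + pi / 4 / (x * real k) - debye_correction (z k) / 2 / (x * real k)\<^sup>2\<bar>
       \<le> C / (x * real k) ^ 3) sequentially"
      by eventually_elim (rule z)
  qed
qed

theorem theorem1p2:
  fixes x :: real
  assumes "x > 0"
  shows "\<exists>\<zeta>::real.
    (\<lambda>k::nat. (bessel_zero (x * real k) k / real k - x * sigma_inv x)
        - (- (pi / (4 * real k)) * (sigma_inv x / sqrt ((sigma_inv x)\<^sup>2 - 1))
           + \<zeta> / (real k)\<^sup>2))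
      \<in> o[sequentially](\<lambda>k. 1 / (real k)\<^sup>2)"
proof -
  define \<alpha> where "\<alpha> = sigma_inv x"
  define z0 where "z0 = (1 + \<alpha>) / 2"
  define n where "n k = x * real k" for k :: nat
  define C where "C = debye_error z0 * (1 + debye_correction z0)"
  define c where "c = sqrt (z0\<^sup>2 - 1) / z0"
  define a where "a = sqrt (\<alpha>\<^sup>2 - 1) / \<alpha>"
  have \<alpha>: "\<alpha> > 1" using sigma_inv_debye_phase[OF assms] by (simp add: \<alpha>_def)
  have z0: "1 < z0" "z0 < \<alpha>" using \<alpha> by (auto simp: z0_def)
  have c: "c > 0" using z0 sqrt_square_minus_one_pos[OF z0(1)] by (simp add: c_def)
  have a: "a > 0" using \<alpha> sqrt_square_minus_one_pos[OF \<alpha>] by (simp add: a_def)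
  obtain z where z: "eventually (\<lambda>k. z k > z0 \<and> bessel_zero (n k) k = n k * z k \<and>
     \<bar>debye_phase (z k) - debye_phase \<alpha> + pi / 4 / n k - debye_correction (z k) / 2 / (n k)\<^sup>2\<bar> \<le> C / n k ^ 3) sequentially"
    using bessel_zero_Debye[OF assms] unfolding \<alpha>_def z0_def n_def C_def by blast
  have ntop: "filterlim n at_top sequentially"
    unfolding n_def using assms by real_asymp
  have npos: "eventually (\<lambda>k. n k > 0) sequentially" using ntop by (simp add: filterlim_at_top_dense)
  define r where "r k = debye_phase (z k) - debye_phase \<alpha> + pi / 4 / n k - debye_correction (z k) / 2 / (n k)\<^sup>2" for k
  have r: "(\<lambda>k. (n k)\<^sup>2 * r k) \<longlonglongrightarrow> 0"
  proof (rule Lim_null_comparison)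
    have "((\<lambda>t. C / t) \<longlongrightarrow> 0) at_top" by real_asymp
    from filterlim_compose[OF this ntop] show "(\<lambda>k. C / n k) \<longlonglongrightarrow> 0" .
    show "\<forall>\<^sub>F k in sequentially. norm ((n k)\<^sup>2 * r k) \<le> C / n k"
      using z npos
    proof eventually_elim
      case (elim k)
      then have "(n k)\<^sup>2 * \<bar>r k\<bar> \<le> (n k)\<^sup>2 * (C / n k ^ 3)"
        by (intro mult_left_mono) (auto simp: r_def)
      also have "\<dots> = C / n k" using elim by (simp add: field_simps eval_nat_numeral)
      finally show ?case by (simp add: abs_mult)
    qed
  qed
  have zlim: "z \<longlonglongrightarrow> \<alpha>"
  proof -
    have "(\<lambda>k. z k - \<alpha>) \<longlonglongrightarrow> 0"
    proof (rule Lim_null_comparison)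
      have "((\<lambda>t. C / t ^ 3 + pi / 4 / t + K / 2 / t\<^sup>2) \<longlongrightarrow> 0) at_top" for K
        by real_asymp
      from tendsto_divide[OF this tendsto_const[of c]] c
      have "((\<lambda>t. (C / t ^ 3 + pi / 4 / t + debye_correction z0 / 2 / t\<^sup>2) / c) \<longlongrightarrow> 0) at_top" by simp
      from filterlim_compose[OF this ntop]
      show "(\<lambda>k. (C / n k ^ 3 + pi / 4 / n k + debye_correction z0 / 2 / (n k)\<^sup>2) / c) \<longlonglongrightarrow> 0" .
      show "\<forall>\<^sub>F k in sequentially. norm (z k - \<alpha>) \<le> (C / n k ^ 3 + pi / 4 / n k + debye_correction z0 / 2 / (n k)\<^sup>2) / c"
        using z npos
      proof eventually_elim
        case (elim k)
        have "c * \<bar>z k - \<alpha>\<bar> \<le> \<bar>debye_phase (z k) - debye_phase \<alpha>\<bar>"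
          using debye_phase_increase[of z0 \<alpha> "z k"] debye_phase_increase[of z0 "z k" \<alpha>] z0 elim
          unfolding c_def[symmetric] by (cases "z k \<le> \<alpha>") (auto simp: abs_if)
        also have "\<dots> \<le> C / n k ^ 3 + pi / 4 / n k + debye_correction (z k) / 2 / (n k)\<^sup>2"
        proof -
          have "debye_correction (z k) / 2 / (n k)\<^sup>2 \<ge> 0" "pi / 4 / n k \<ge> 0"
            using debye_bounds(3)[of z0 "z k"] z0 elim by auto
          then show ?thesis using elim unfolding abs_le_iff by linarith
        qed
        also have "\<dots> \<le> C / n k ^ 3 + pi / 4 / n k + debye_correction z0 / 2 / (n k)\<^sup>2"
          using debye_bounds(4)[of z0 "z k"] z0 elim by (intro add_left_mono divide_right_mono) auto
        finally show ?case using c by (simp add: field_simps)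
      qed
    qed
    then show ?thesis by (simp add: LIM_zero_iff)
  qed
  have "isCont debye_correction \<alpha>"
  proof -
    have "isCont (\<lambda>z. 1 / (4 * sqrt (z\<^sup>2 - 1)) + 5 / (12 * sqrt (z\<^sup>2 - 1) ^ 3)) \<alpha>"
      using sqrt_square_minus_one_pos[OF \<alpha>] by (intro continuous_intros) auto
    then show ?thesis by (simp add: debye_correction_def [abs_def] Let_def)
  qed
  from isCont_tendsto_compose[OF this zlim]
  have corr: "(\<lambda>k. debye_correction (z k)) \<longlonglongrightarrow> debye_correction \<alpha>" .
  have "(\<lambda>k. (n k)\<^sup>2 * r k + debye_correction (z k) / 2) \<longlonglongrightarrow> 0 + debye_correction \<alpha> / 2"
    by (intro tendsto_intros r corr) auto
  moreover have "eventually (\<lambda>k. (n k)\<^sup>2 * r k + debye_correction (z k) / 2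
      = (n k)\<^sup>2 * (debye_phase (z k) - debye_phase \<alpha> + (pi / 4) / n k)) sequentially"
    using npos by eventually_elim (simp add: r_def field_simps)
  ultimately have lim: "(\<lambda>k. (n k)\<^sup>2 * (debye_phase (z k) - debye_phase \<alpha> + (pi / 4) / n k)) \<longlonglongrightarrow> debye_correction \<alpha> / 2"
    by (simp add: tendsto_cong)
  define q where "q = (debye_correction \<alpha> / 2 - 1 / (\<alpha>\<^sup>2 * sqrt (\<alpha>\<^sup>2 - 1)) / 2 * (pi / 4 / a)\<^sup>2) / a"
  have "isCont (\<lambda>z. 1 / (z\<^sup>2 * sqrt (z\<^sup>2 - 1))) \<alpha>"
    using sqrt_square_minus_one_pos[OF \<alpha>] \<alpha> by (intro continuous_intros) (auto simp: abs_square_eq_1)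
  from second_order_inversion[of 1 debye_phase _ _ \<alpha> n z, OF DERIV_debye_phase DERIV_debye_phase_deriv this \<alpha> _ ntop zlim lim,
    folded a_def, OF _ _ less_imp_neq[OF a, symmetric]]
  have main: "(\<lambda>k. (n k)\<^sup>2 * (z k - \<alpha> + pi / 4 / (a * n k))) \<longlonglongrightarrow> q"
    by (simp add: q_def)
  show ?thesis
  \<comment> \<open>Since \<open>n k = x k\<close>, multiplying \<open>z k\<close> by \<open>x\<close> turns the coefficient \<open>q\<close> of \<open>1 / n\<^sup>2\<close> into the coefficient \<open>q / x\<close> of \<open>1 / k\<^sup>2\<close>.\<close>
  proof (rule exI[of _ "q / x"], rule smalloI_tendsto)
    have "(\<lambda>k. (n k)\<^sup>2 * (z k - \<alpha> + pi / 4 / (a * n k)) / x - q / x) \<longlonglongrightarrow> q / x - q / x"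
      using assms by (intro tendsto_intros main) auto
    moreover have "eventually (\<lambda>k. (n k)\<^sup>2 * (z k - \<alpha> + pi / 4 / (a * n k)) / x - q / x =
      ((bessel_zero (x * real k) k / real k - x * sigma_inv x)
        - (- (pi / (4 * real k)) * (sigma_inv x / sqrt ((sigma_inv x)\<^sup>2 - 1)) + q / x / (real k)\<^sup>2)) / (1 / (real k)\<^sup>2)) sequentially"
      using z npos
    proof eventually_elim
      case (elim k)
      have k: "real k > 0" using elim assms by (simp add: n_def zero_less_mult_iff)
      have eqs: "bessel_zero (x * real k) k / real k = x * z k" "\<alpha> / sqrt (\<alpha>\<^sup>2 - 1) = 1 / a"
        using elim k by (simp_all add: n_def a_def)
      show ?case
        unfolding \<alpha>_def[symmetric] eqs using k assms a by (simp add: n_def field_simps power2_eq_square)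
    qed
    ultimately show "(\<lambda>k. ((bessel_zero (x * real k) k / real k - x * sigma_inv x)
        - (- (pi / (4 * real k)) * (sigma_inv x / sqrt ((sigma_inv x)\<^sup>2 - 1)) + q / x / (real k)\<^sup>2)) / (1 / (real k)\<^sup>2)) \<longlonglongrightarrow> 0"
      by (simp add: tendsto_cong)
    show "\<forall>\<^sub>F k in sequentially. 1 / (real k)\<^sup>2 \<noteq> 0"
      using eventually_gt_at_top[of "0::nat"] by eventually_elim simp
  qed
qed

end
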